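(* Let $G=(V,E)$ be an undirected graph with $n=|V|$ nodes and $|E|=\mathrm{poly}(n)$. There exists a deterministic and stateless routing table $A_G$ such that the following holds: given any set of source-destination pairs $d=\{(s_i,t_i)\}_{i=1}^k$ with $k\le \mathrm{poly}(n)$ (one packet per pair, packet $i$ starting at $s_i$ with destination $t_i$), $A_G$ routes each packet from $s_i$ to $t_i$ simultaneously with completion time at most $\mathrm{poly}(\log n)\cdot \mathrm{OPT}(d)$.
   Context: Routing model: the network is the graph $G$ (each undirected edge can be used in each direction; parallel edges and self-loops allowed, polynomially many edges). There is a set of packets, each with a source node, a destination node, and a unique identifier that is a natural number polynomially bounded in $n$. Time proceeds in synchronous steps; in each step, each (directed) edge can carry at most one packet. The completion time is the number of steps until every packet is at its destination. A routing table is a local algorithm: in each time step, each node decides which packets currently at it to forward over which incident edges based only on the current time step, the packets currently at that node (their sources, destinations and identifiers), and the graph $G$ (which is known to every node in advance; the demand is not). It is deterministic if it uses no randomness, and stateless if packets are never modified while being forwarded. A demand $d=\{(s_i,t_i)\}_{i=1}^k$ is a multiset of node pairs. A set of paths $P$ satisfies $d$ if for every node pair $(a,b)$ appearing $m$ times in $d$ there are at least $m$ paths from $a$ to $b$ in $P$. For a path set $P$, the dilation $D(P)$ is the maximum number of edges of a path in $P$, and the congestion $C(P)$ is the maximum over edges $e$ of the number of paths in $P$ containing $e$. The offline-optimum completion time is $\mathrm{OPT}(d):=\min_{P^*}\,(C(P^* )+D(P^* ))$, the minimum over all path sets $P^*$ satisfying $d$. *)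

theory Defs
  imports Complex_Main "HOL-Library.Multiset"
begin

text \<open>A network on nodes 0..n-1 is given by a list E of undirected edges (pairs of nodes);
parallel edges and self-loops are allowed. Edge number i < length E is E!i. A directed edge
is a pair (i, b): for b = True it is traversed from fst (E!i) to snd (E!i), for b = False
in the opposite direction.\<close>

type_synonym dedge = "nat \<times> bool"

definition wf_graph :: "nat \<Rightarrow> (nat \<times> nat) list \<Rightarrow> bool" where
  "wf_graph n E \<longleftrightarrow> (\<forall>(u, v) \<in> set E. u < n \<and> v < n)"

definition dtail :: "(nat \<times> nat) list \<Rightarrow> dedge \<Rightarrow> nat" where
  "dtail E d = (if snd d then fst (E ! fst d) else snd (E ! fst d))"

definition dhead :: "(nat \<times> nat) list \<Rightarrow> dedge \<Rightarrow> nat" where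
  "dhead E d = (if snd d then snd (E ! fst d) else fst (E ! fst d))"

text \<open>A packet is a triple (source, destination, identifier). Packets are never modified
(stateless routing).\<close>

type_synonym pkt = "nat \<times> nat \<times> nat"

definition psrc :: "pkt \<Rightarrow> nat" where "psrc p = fst p"
definition pdst :: "pkt \<Rightarrow> nat" where "pdst p = fst (snd p)"
definition pid :: "pkt \<Rightarrow> nat" where "pid p = snd (snd p)"

text \<open>A deterministic routing table: given the current time step, the node, and the (finite) set
of packets currently at that node, it decides for each packet over which outgoing directed edge
(if any) it is forwarded. It may depend on the graph because it is chosen after the graph.\<close>

type_synonym rtable = "nat \<Rightarrow> nat \<Rightarrow> pkt set \<Rightarrow> pkt \<Rightarrow> dedge option"

definition valid_table :: "nat \<Rightarrow> (nat \<times> nat) list \<Rightarrow> rtable \<Rightarrow> bool" where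
  "valid_table n E A \<longleftrightarrow>
     (\<forall>t v S. v < n \<longrightarrow> finite S \<longrightarrow>
        (\<forall>p d. A t v S p = Some d \<longrightarrow> p \<in> S \<and> fst d < length E \<and> dtail E d = v) \<and>
        inj_on (A t v S) {p. A t v S p \<noteq> None})"

text \<open>Synchronous execution. loc p is the current node of packet p. A packet that has reached its
destination is absorbed (it no longer takes part in the routing).\<close>

definition at_node :: "pkt set \<Rightarrow> (pkt \<Rightarrow> nat) \<Rightarrow> nat \<Rightarrow> pkt set" where
  "at_node P loc v = {q \<in> P. loc q = v \<and> loc q \<noteq> pdst q}"

definition step :: "(nat \<times> nat) list \<Rightarrow> rtable \<Rightarrow> pkt set \<Rightarrow> nat \<Rightarrow> (pkt \<Rightarrow> nat) \<Rightarrow> (pkt \<Rightarrow> nat)" where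
  "step E A P t loc = (\<lambda>p.
     if p \<in> at_node P loc (loc p) then
       (case A t (loc p) (at_node P loc (loc p)) p of None \<Rightarrow> loc p | Some d \<Rightarrow> dhead E d)
     else loc p)"

fun run :: "(nat \<times> nat) list \<Rightarrow> rtable \<Rightarrow> pkt set \<Rightarrow> nat \<Rightarrow> (pkt \<Rightarrow> nat)" where
  "run E A P 0 = psrc"
| "run E A P (Suc t) = step E A P t (run E A P t)"

definition delivered_by :: "(nat \<times> nat) list \<Rightarrow> rtable \<Rightarrow> pkt set \<Rightarrow> nat \<Rightarrow> bool" where
  "delivered_by E A P T \<longleftrightarrow> (\<forall>p \<in> P. run E A P T p = pdst p)"

type_synonym path = "nat \<times> dedge list"

definition path_end :: "(nat \<times> nat) list \<Rightarrow> path \<Rightarrow> nat" where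
  "path_end E q = (if snd q = [] then fst q else dhead E (last (snd q)))"

definition is_path :: "nat \<Rightarrow> (nat \<times> nat) list \<Rightarrow> path \<Rightarrow> bool" where
  "is_path n E q \<longleftrightarrow> fst q < n \<and>
     (\<forall>d \<in> set (snd q). fst d < length E) \<and>
     (snd q \<noteq> [] \<longrightarrow> dtail E (hd (snd q)) = fst q) \<and>
     (\<forall>i. Suc i < length (snd q) \<longrightarrow> dhead E (snd q ! i) = dtail E (snd q ! Suc i))"

definition satisfies :: "(nat \<times> nat) list \<Rightarrow> path multiset \<Rightarrow> (nat \<times> nat) multiset \<Rightarrow> bool" where
  "satisfies E Ps dem \<longleftrightarrow>
     (\<forall>ab. count dem ab \<le> size (filter_mset (\<lambda>q. (fst q, path_end E q) = ab) Ps))"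

definition dilation :: "path multiset \<Rightarrow> nat" where
  "dilation Ps = Max (insert 0 ((\<lambda>q. length (snd q)) ` set_mset Ps))"

definition congestion :: "(nat \<times> nat) list \<Rightarrow> path multiset \<Rightarrow> nat" where
  "congestion E Ps = Max (insert 0 ((\<lambda>e. size (filter_mset (\<lambda>q. e \<in> fst ` set (snd q)) Ps)) ` {..<length E}))"

definition OPT :: "nat \<Rightarrow> (nat \<times> nat) list \<Rightarrow> (nat \<times> nat) multiset \<Rightarrow> nat" where
  "OPT n E dem = (LEAST c. \<exists>Ps. (\<forall>q \<in># Ps. is_path n E q) \<and> satisfies E Ps dem \<and>
                                 c = congestion E Ps + dilation Ps)"

definition demand_of :: "pkt list \<Rightarrow> (nat \<times> nat) multiset" where
  "demand_of ps = mset (map (\<lambda>p. (psrc p, pdst p)) ps)"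

end

theory Submission
  imports Defs "HOL-Library.FuncSet" "HOL-Library.Disjoint_Sets"
begin

text \<open>
  Fix a guess \<open>h\<close> for the optimum. For edge weights \<open>w\<close> and a scale \<open>W\<close>, give an edge the length
  \<open>w e / W + 1 / h\<close>. Region growing yields for geometrically growing \<open>W\<close> clusterings of radius
  polylogarithmic in \<open>n\<close> such that most nodes are padded on all levels; two padded nodes are routed
  through their chains of cluster centres. If a demand has paths of length and congestion at most \<open>h\<close>,
  then a path leaving the cluster of a padded endpoint has weight at least \<open>W\<close> inside that cluster,
  so the number of packets leaving a cluster is bounded independently of the demand. Summing up,
  the weighted average over the edges of the worst-case load is at most \<open>h\<close> times a polylogarithm, and
  multiplicative weights turn this into a family of routings with small average load on every edge,
  each short pair being served by at least half of them.

  In a phase every packet follows the path of a routing of this family after some delay, and if too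
  many packets want to traverse an edge at the same time, they all stop; when the time is over, the
  stopped packets return to their sources by running the phase backwards. If routing and delay
  are chosen at random, the probability that more than half of \<open>k\<close> packets stop is at most \<open>2^-k\<close>, so
  by the method of conditional expectations logarithmically many fixed choices halve every demand
  of optimum at most \<open>h\<close>. Repeating them logarithmically often delivers such a demand,
  and the table tries \<open>h = 1, 2, 4, \<dots>\<close>.
\<close>

section \<open>Walks and demands\<close>

text \<open>The table knows neither the demand nor the past, and this shapes the proof. The load
  bound of a routing mentions the demand only through \<open>h\<close>, so the worst case over all
  demands can be taken before routings are averaged, and one family serves them all. Sending stopped
  packets home turns a phase with fixed choices into a map on sets of undelivered packets: phases
  compose, and a guess \<open>h\<close> that is too small leaves a clean state behind. The fixed
  choices must work for every demand. Among \<open>N\<close> possible packets there are up to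
  \<open>N^k\<close> demands of size \<open>k\<close>, so one choice failing with probability
  \<open>2^-k\<close> is not enough for a union bound, but about \<open>log N\<close> successive
  ones are; for this the exponent must stay the size of the original demand while its remainder
  shrinks. The term \<open>1 / h\<close> in the edge length keeps routes short; it also ensures that
  a walk of at most \<open>h\<close> hops can become long only through its weight. Random delays
  bring the mean load of an edge at one time down to 1, and letting each move take
  \<open>B = log n + O(1)\<close> steps absorbs the fluctuations.\<close>

fun walk :: "(nat \<times> nat) list \<Rightarrow> nat \<Rightarrow> dedge list \<Rightarrow> nat \<Rightarrow> bool" where
  "walk E u [] v \<longleftrightarrow> u = v"
| "walk E u (d # ds) v \<longleftrightarrow> fst d < length E \<and> dtail E d = u \<and> walk E (dhead E d) ds v"

definition nodes :: "(nat \<times> nat) list \<Rightarrow> nat \<Rightarrow> dedge list \<Rightarrow> nat list" where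
  "nodes E u ds = u # map (dhead E) ds"

definition flip :: "dedge \<Rightarrow> dedge" where
  "flip d = (fst d, \<not> snd d)"

lemma flip_simps [simp]:
  "fst (flip d) = fst d" "dtail E (flip d) = dhead E d" "dhead E (flip d) = dtail E d" "flip (flip d) = d"
  by (simp_all add: flip_def dtail_def dhead_def)

lemma inj_flip: "inj flip"
  by (metis flip_simps(4) injI)

lemma walk_append: "walk E u (xs @ ys) v \<longleftrightarrow> (\<exists>x. walk E u xs x \<and> walk E x ys v)"
  by (induction xs arbitrary: u) auto

lemma walk_flip: "walk E u ds v \<Longrightarrow> walk E v (rev (map flip ds)) u"
  by (induction ds arbitrary: u) (auto simp: walk_append)

lemma fst_set_rev_flip [simp]: "fst ` set (rev (map flip ds)) = fst ` set ds"
  by (simp add: image_image)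

lemma walk_edges: "walk E u ds v \<Longrightarrow> d \<in> set ds \<Longrightarrow> fst d < length E"
  by (induction ds arbitrary: u) auto

lemma length_nodes [simp]: "length (nodes E u ds) = Suc (length ds)"
  by (simp add: nodes_def)

lemma nodes_0 [simp]: "nodes E u ds ! 0 = u"
  by (simp add: nodes_def)

lemma nodes_Suc: "i < length ds \<Longrightarrow> nodes E u ds ! Suc i = dhead E (ds ! i)"
  by (simp add: nodes_def)

lemma walk_tail_nth: "walk E u ds v \<Longrightarrow> i < length ds \<Longrightarrow> dtail E (ds ! i) = nodes E u ds ! i"
proof (induction ds arbitrary: u i)
  case (Cons d ds)
  then show ?case by (cases i) (auto simp: nodes_def)
qed simp

lemma walk_last: "walk E u ds v \<Longrightarrow> nodes E u ds ! length ds = v"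
  by (induction ds arbitrary: u) (auto simp: nodes_def)

lemma nodes_bound:
  assumes "wf_graph n E" "walk E u ds v" "u < n"
  shows "set (nodes E u ds) \<subseteq> {..<n}"
  using assms(2,3)
proof (induction ds arbitrary: u)
  case (Cons d ds)
  have "E ! fst d \<in> set E" using Cons.prems by simp
  then have "dhead E d < n" using assms(1) by (auto simp: wf_graph_def dhead_def)
  then show ?case using Cons by (auto simp: nodes_def)
qed (simp add: nodes_def)

text \<open>A walk that returns to its first node is cut there. Keeping
  \<open>set ds' \<subseteq> set ds\<close> matters later: removing cycles never loads an edge that
  the original walk avoids.\<close>

lemma simple_walk_exists:
  assumes "walk E u ds v"
  shows "\<exists>ds'. walk E u ds' v \<and> distinct (nodes E u ds') \<and> set ds' \<subseteq> set ds \<and> length ds' \<le> length ds"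
  using assms
proof (induction ds arbitrary: u)
  case Nil
  then show ?case by (intro exI[of _ "[]"]) (simp add: nodes_def)
next
  case (Cons d ds)
  then obtain ds' where ds': "walk E (dhead E d) ds' v" "distinct (nodes E (dhead E d) ds')"
    "set ds' \<subseteq> set ds" "length ds' \<le> length ds" by fastforce
  show ?case
  proof (cases "u \<in> set (nodes E (dhead E d) ds')")
    case False
    then show ?thesis using ds' Cons.prems by (intro exI[of _ "d # ds'"]) (auto simp: nodes_def)
  next
    case True
    then obtain i where i: "i \<le> length ds'" "nodes E (dhead E d) ds' ! i = u"
      by (metis in_set_conv_nth length_nodes less_Suc_eq_le)
    have nd: "nodes E u (drop i ds') = drop i (nodes E (dhead E d) ds')"
    proof (cases i)
      case (Suc j)
      then show ?thesis using i by (auto simp: nodes_def drop_map Cons_nth_drop_Suc[symmetric])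
    qed (use i in \<open>simp add: nodes_def\<close>)
    have "walk E (dhead E d) (take i ds' @ drop i ds') v" using ds'(1) by simp
    then obtain x where x: "walk E (dhead E d) (take i ds') x" "walk E x (drop i ds') v"
      unfolding walk_append by blast
    have "x = u" using walk_last[OF x(1)] i by (cases i) (auto simp: nodes_def min_def)
    then show ?thesis using x(2) nd ds' set_drop_subset[of i ds']
      by (intro exI[of _ "drop i ds'"]) (auto simp: distinct_drop)
  qed
qed

lemma simple_walk_length:
  assumes "wf_graph n E" "walk E u ds v" "u < n" "distinct (nodes E u ds)"
  shows "length ds < n"
proof -
  have "card (set (nodes E u ds)) \<le> card {..<n}"
    using nodes_bound[OF assms(1-3)] by (intro card_mono) auto
  then show ?thesis using distinct_card[OF assms(4)] by simp
qed

text \<open>Two traversals of an undirected edge, in whatever directions, have the same pair of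
  endpoints and so would repeat a node. This allows sums along a walk to be read as sums over a set
  of edges.\<close>

lemma simple_walk_distinct_edges:
  assumes "walk E u ds v" "distinct (nodes E u ds)"
  shows "distinct (map fst ds)"
proof -
  have ne: False if "i < j" "j < length ds" "fst (ds ! i) = fst (ds ! j)" for i j
  proof -
    have "{dtail E d, dhead E d} = {fst (E ! fst d), snd (E ! fst d)}" for d
      by (auto simp: dtail_def dhead_def)
    then have "{dtail E (ds ! i), dhead E (ds ! i)} = {dtail E (ds ! j), dhead E (ds ! j)}"
      using that by simp
    then have "nodes E u ds ! i \<in> {nodes E u ds ! j, nodes E u ds ! Suc j}"
      using that walk_tail_nth[OF assms(1), of i] walk_tail_nth[OF assms(1), of j]
        nodes_Suc[of j ds E u] by auto
    then show False using that nth_eq_iff_index_eq[OF assms(2)] by auto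
  qed
  show ?thesis unfolding distinct_conv_nth
  proof (intro allI impI notI)
    fix i j assume "i < length (map fst ds)" "j < length (map fst ds)" "i \<noteq> j" "map fst ds ! i = map fst ds ! j"
    then show False using ne[of i j] ne[of j i] by (cases "i < j") auto
  qed
qed

lemma path_walk:
  assumes "is_path n E q"
  shows "walk E (fst q) (snd q) (path_end E q)"
proof -
  have "walk E u ds (if ds = [] then u else dhead E (last ds))"
    if "\<forall>d\<in>set ds. fst d < length E" "ds \<noteq> [] \<longrightarrow> dtail E (hd ds) = u"
      "\<forall>i. Suc i < length ds \<longrightarrow> dhead E (ds ! i) = dtail E (ds ! Suc i)" for u ds
    using that
  proof (induction ds arbitrary: u)
    case (Cons d ds)
    have "walk E (dhead E d) ds (if ds = [] then dhead E d else dhead E (last ds))"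
    proof (rule Cons.IH)
      show "ds \<noteq> [] \<longrightarrow> dtail E (hd ds) = dhead E d"
        using Cons.prems(3)[rule_format, of 0] by (cases ds) auto
      show "\<forall>i. Suc i < length ds \<longrightarrow> dhead E (ds ! i) = dtail E (ds ! Suc i)"
        using Cons.prems(3)[rule_format, of "Suc _"] by auto
    qed (use Cons.prems in auto)
    then show ?case using Cons.prems by auto
  qed simp
  then show ?thesis using assms by (auto simp: is_path_def path_end_def)
qed

text \<open>The form in which the optimum enters: one number bounds congestion and dilation
  separately. Simplicity is demanded so that the weight of a walk never exceeds the total weight of
  the edges (see \<open>N_L\<close>).\<close>

definition routable :: "(nat \<times> nat) list \<Rightarrow> nat \<Rightarrow> pkt set \<Rightarrow> bool" where
  "routable E h S \<longleftrightarrow> (\<exists>Q.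
     (\<forall>p\<in>S. walk E (psrc p) (Q p) (pdst p) \<and> distinct (nodes E (psrc p) (Q p)) \<and> length (Q p) \<le> h) \<and>
     (\<forall>e. card {p\<in>S. e \<in> fst ` set (Q p)} \<le> h))"

lemma routable_subset:
  assumes "routable E h S" "T \<subseteq> S" "finite S"
  shows "routable E h T"
proof -
  obtain Q where Q: "\<forall>p\<in>S. walk E (psrc p) (Q p) (pdst p) \<and> distinct (nodes E (psrc p) (Q p)) \<and> length (Q p) \<le> h"
    "\<forall>e. card {p\<in>S. e \<in> fst ` set (Q p)} \<le> h" using assms(1) unfolding routable_def by blast
  have "card {p\<in>T. e \<in> fst ` set (Q p)} \<le> h" for e
  proof -
    have "card {p\<in>T. e \<in> fst ` set (Q p)} \<le> card {p\<in>S. e \<in> fst ` set (Q p)}"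
      using assms by (intro card_mono) auto
    then show ?thesis using Q(2) le_trans by blast
  qed
  then show ?thesis using Q(1) assms(2) unfolding routable_def by blast
qed

lemma routable_mono: "routable E h S \<Longrightarrow> h \<le> h' \<Longrightarrow> routable E h' S"
  unfolding routable_def by (meson le_trans)

text \<open>Paths are taken out of \<open>Ps\<close> greedily along the list. Inclusion as multisets
  says that no path serves two packets, so the congestion of \<open>Ps\<close> bounds that of the
  selection.\<close>

lemma matching_path_list:
  assumes "\<And>ab. count (mset (map f ps)) ab \<le> size (filter_mset (\<lambda>q. g q = ab) Ps)"
  shows "\<exists>qs. mset qs \<subseteq># Ps \<and> map g qs = map f ps"
  using assms
proof (induction ps arbitrary: Ps)
  case (Cons p ps)
  have "filter_mset (\<lambda>q. g q = f p) Ps \<noteq> {#}"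
  proof
    assume *: "filter_mset (\<lambda>q. g q = f p) Ps = {#}"
    show False using Cons.prems[of "f p"] unfolding * by simp
  qed
  then obtain q where "q \<in># filter_mset (\<lambda>q. g q = f p) Ps" by (rule multiset_nonemptyE)
  then have q: "q \<in># Ps" "g q = f p" by auto
  then obtain Ps' where Ps': "Ps = add_mset q Ps'" by (meson multi_member_split)
  have "\<exists>qs. mset qs \<subseteq># Ps' \<and> map g qs = map f ps"
  proof (rule Cons.IH)
    fix ab
    show "count (mset (map f ps)) ab \<le> size (filter_mset (\<lambda>q. g q = ab) Ps')"
      using Cons.prems[of ab] q Ps' by (auto split: if_splits)
  qed
  then obtain qs where "mset qs \<subseteq># Ps'" "map g qs = map f ps" by blast
  then show ?case using Ps' q by (intro exI[of _ "q # qs"]) auto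
qed simp

lemma OPT_attained:
  assumes "\<forall>q\<in>#Ps. is_path n E q" "satisfies E Ps dem"
  shows "\<exists>Ps. (\<forall>q\<in>#Ps. is_path n E q) \<and> satisfies E Ps dem \<and> OPT n E dem = congestion E Ps + dilation Ps"
proof -
  have "\<exists>c Ps. (\<forall>q \<in># Ps. is_path n E q) \<and> satisfies E Ps dem \<and> c = congestion E Ps + dilation Ps"
    using assms by blast
  from LeastI_ex[OF this] show ?thesis unfolding OPT_def .
qed

lemma routable_OPT:
  assumes "\<forall>q\<in>#Ps. is_path n E q" "satisfies E Ps (demand_of ps)" "distinct ps"
  shows "routable E (OPT n E (demand_of ps)) (set ps)"
proof -
  obtain Ps where Ps: "\<forall>q\<in>#Ps. is_path n E q" "satisfies E Ps (demand_of ps)"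
    "OPT n E (demand_of ps) = congestion E Ps + dilation Ps" using OPT_attained[OF assms(1,2)] by blast
  obtain qs where qs: "mset qs \<subseteq># Ps" "map (\<lambda>q. (fst q, path_end E q)) qs = map (\<lambda>p. (psrc p, pdst p)) ps"
    using matching_path_list[of "\<lambda>p. (psrc p, pdst p)" ps "\<lambda>q. (fst q, path_end E q)" Ps] Ps(2)
    unfolding satisfies_def demand_of_def by blast
  have len: "length qs = length ps" using qs(2) map_eq_imp_length_eq by blast
  have "\<forall>p\<in>set ps. \<exists>i. i < length ps \<and> ps ! i = p" by (simp add: in_set_conv_nth)
  from bchoice[OF this] obtain i where i: "\<And>p. p \<in> set ps \<Longrightarrow> i p < length ps \<and> ps ! i p = p" by blast
  define R where "R = (\<lambda>p. qs ! i p)"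
  have R: "R p \<in># Ps" "fst (R p) = psrc p" "path_end E (R p) = pdst p" if "p \<in> set ps" for p
  proof -
    have "R p \<in># mset qs" using i[OF that] len by (simp add: R_def)
    then show "R p \<in># Ps" using mset_subset_eqD[OF qs(1)] by simp
    have "map (\<lambda>q. (fst q, path_end E q)) qs ! i p = map (\<lambda>p. (psrc p, pdst p)) ps ! i p"
      using qs(2) by simp
    then show "fst (R p) = psrc p" "path_end E (R p) = pdst p" using i[OF that] len by (auto simp: R_def)
  qed
  have "\<forall>p\<in>set ps. \<exists>ds. walk E (psrc p) ds (pdst p) \<and> distinct (nodes E (psrc p) ds) \<and>
     set ds \<subseteq> set (snd (R p)) \<and> length ds \<le> length (snd (R p))"
  proof
    fix p assume p: "p \<in> set ps"
    show "\<exists>ds. walk E (psrc p) ds (pdst p) \<and> distinct (nodes E (psrc p) ds) \<and>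
     set ds \<subseteq> set (snd (R p)) \<and> length ds \<le> length (snd (R p))"
      using simple_walk_exists[OF path_walk, of n E "R p"] R[OF p] Ps(1) by auto
  qed
  then obtain Q where Q: "\<And>p. p \<in> set ps \<Longrightarrow> walk E (psrc p) (Q p) (pdst p) \<and> distinct (nodes E (psrc p) (Q p)) \<and>
     set (Q p) \<subseteq> set (snd (R p)) \<and> length (Q p) \<le> length (snd (R p))" by metis
  have "length (Q p) \<le> OPT n E (demand_of ps)" if "p \<in> set ps" for p
  proof -
    have "length (snd (R p)) \<le> dilation Ps"
      unfolding dilation_def using R(1)[OF that] by (intro Max_ge) auto
    then show ?thesis using Q[OF that] Ps(3) by simp
  qed
  moreover have "card {p\<in>set ps. e \<in> fst ` set (Q p)} \<le> OPT n E (demand_of ps)" for e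
  proof (cases "e < length E")
    case True
    \<comment> \<open>Packets are counted by their list positions, because equal paths may serve
      several packets.\<close>
    have inj: "inj_on i (set ps)" using i by (metis inj_onI)
    have "card {p\<in>set ps. e \<in> fst ` set (Q p)} = card (i ` {p\<in>set ps. e \<in> fst ` set (Q p)})"
      using inj by (intro card_image[symmetric]) (auto simp: inj_on_def)
    also have "\<dots> \<le> card {j. j < length qs \<and> e \<in> fst ` set (snd (qs ! j))}"
    proof (intro card_mono)
      show "i ` {p\<in>set ps. e \<in> fst ` set (Q p)} \<subseteq> {j. j < length qs \<and> e \<in> fst ` set (snd (qs ! j))}"
      proof
        fix j assume "j \<in> i ` {p\<in>set ps. e \<in> fst ` set (Q p)}"
        then obtain p where p: "p \<in> set ps" "e \<in> fst ` set (Q p)" "j = i p" by blast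
        have "fst ` set (Q p) \<subseteq> fst ` set (snd (R p))" using Q[OF p(1)] by (intro image_mono) simp
        then show "j \<in> {j. j < length qs \<and> e \<in> fst ` set (snd (qs ! j))}"
          using p i[OF p(1)] len by (auto simp: R_def)
      qed
    qed simp
    also have "\<dots> = length (filter (\<lambda>q. e \<in> fst ` set (snd q)) qs)" by (simp add: length_filter_conv_card)
    also have "\<dots> = size (filter_mset (\<lambda>q. e \<in> fst ` set (snd q)) (mset qs))"
      by (simp flip: mset_filter size_mset)
    also have "\<dots> \<le> size (filter_mset (\<lambda>q. e \<in> fst ` set (snd q)) Ps)"
      using qs(1) by (intro size_mset_mono multiset_filter_mono)
    also have "\<dots> \<le> congestion E Ps" unfolding congestion_def using True by (intro Max_ge) auto
    finally show ?thesis using Ps(3) by simp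
  next
    case False
    then have "{p\<in>set ps. e \<in> fst ` set (Q p)} = {}" using walk_edges Q by fastforce
    then show ?thesis by (simp only: card.empty le0)
  qed
  ultimately show ?thesis unfolding routable_def using Q by blast
qed

section \<open>Padded decompositions and multiplicative weights\<close>

lemma exists_slow_growth:
  fixes f :: "nat \<Rightarrow> real"
  assumes "0 < f 0" "f (Suc R) < (1 + \<epsilon>) ^ Suc R * f 0" "0 \<le> \<epsilon>"
  shows "\<exists>j\<le>R. f (Suc j) \<le> (1 + \<epsilon>) * f j"
proof (rule ccontr)
  assume "\<not> ?thesis"
  then have H: "f (Suc j) > (1 + \<epsilon>) * f j" if "j \<le> R" for j using that by force
  have "(1 + \<epsilon>) ^ j * f 0 \<le> f j" if "j \<le> Suc R" for j using that
  proof (induction j)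
    case (Suc j)
    then have "(1 + \<epsilon>) ^ j * f 0 \<le> f j" by simp
    then have "(1 + \<epsilon>) * ((1 + \<epsilon>) ^ j * f 0) \<le> (1 + \<epsilon>) * f j"
      using assms(3) by (intro mult_left_mono) auto
    with H[of j] Suc.prems show ?case by (simp add: mult.assoc)
  qed simp
  from this[of "Suc R"] assms(2) show False by simp
qed

text \<open>Region growing: with a slowly growing radius, the core of radius \<open>2j\<close> and the complement of
  the ball of radius \<open>2j + 2\<close> are both padded for the cluster of radius \<open>2j + 1\<close>, and the ring in
  between, which is discarded, has little mass.\<close>

lemma padded_decomposition:
  fixes \<nu> :: "'a \<Rightarrow> real" and N :: "('a \<times> 'a) set"
  assumes "finite Y" "sym N" "refl N" "0 \<le> \<epsilon>"
    and pos: "\<And>v. v \<in> Y \<Longrightarrow> 0 < \<nu> v"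
    and growth: "\<And>v. v \<in> Y \<Longrightarrow> sum \<nu> Y < (1 + \<epsilon>) ^ Suc R * \<nu> v"
  shows "\<exists>c Z. Z \<subseteq> Y \<and> (\<forall>v\<in>Y. \<exists>j \<le> 2 * R + 1. (c v, v) \<in> N ^^ j)
     \<and> (\<forall>v\<in>Y - Z. \<forall>u\<in>Y. (v, u) \<in> N \<longrightarrow> c u = c v) \<and> sum \<nu> Z \<le> \<epsilon> * sum \<nu> Y"
  using assms(1) pos growth
proof (induction Y rule: finite_psubset_induct)
  case (psubset Y)
  show ?case
  proof (cases "Y = {}")
    case False
    then obtain a where a: "a \<in> Y" by blast
    have nn: "0 \<le> \<nu> v" if "v \<in> Y" for v using psubset.prems(1)[OF that] by simp
    define B where "B = (\<lambda>j. {v\<in>Y. (a, v) \<in> N ^^ j})"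
    have Bmono: "B j \<subseteq> B (Suc j)" for j
    proof
      fix v assume "v \<in> B j"
      moreover have "(v, v) \<in> N" using \<open>refl N\<close> by (rule reflD)
      ultimately show "v \<in> B (Suc j)" unfolding B_def by auto
    qed
    have BY: "B j \<subseteq> Y" for j by (auto simp: B_def)
    have fB: "finite (B j)" for j using BY psubset.hyps finite_subset by blast
    have "\<exists>j\<le>R. sum \<nu> (B (2 * Suc j)) \<le> (1 + \<epsilon>) * sum \<nu> (B (2 * j))"
    proof (rule exists_slow_growth)
      have B0: "B (2 * 0) = {a}" using a by (auto simp: B_def)
      show "0 < sum \<nu> (B (2 * 0))" using psubset.prems(1)[OF a] B0 by simp
      have "sum \<nu> (B (2 * Suc R)) \<le> sum \<nu> Y"
        using BY psubset.hyps nn by (intro sum_mono2) auto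
      also have "\<dots> < (1 + \<epsilon>) ^ Suc R * sum \<nu> (B (2 * 0))"
        using psubset.prems(2)[OF a] B0 by simp
      finally show "sum \<nu> (B (2 * Suc R)) < (1 + \<epsilon>) ^ Suc R * sum \<nu> (B (2 * 0))" .
    qed fact
    then obtain j where j: "j \<le> R" "sum \<nu> (B (2 * j + 2)) \<le> (1 + \<epsilon>) * sum \<nu> (B (2 * j))"
      by (auto simp: add.commute)
    define X where "X = B (2 * j + 1)"
    define Z0 where "Z0 = B (2 * j + 2) - B (2 * j)"
    have B02: "B (2 * j) \<subseteq> X" "X \<subseteq> B (2 * j + 2)"
      using Bmono[of "2 * j"] Bmono[of "2 * j + 1"] by (auto simp: X_def)
    have "a \<in> B i" for i
    proof (induction i)
      case 0 show ?case using a by (simp add: B_def)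
    qed (use Bmono in blast)
    then have "a \<in> X" by (simp add: X_def)
    then have sub: "Y - X \<subset> Y" using a by blast
    \<comment> \<open>The outer half of the ring remains in \<open>Y - X\<close>: its nodes are
      unpadded but still receive a centre in a later round.\<close>
    have "\<exists>c Z. Z \<subseteq> Y - X \<and> (\<forall>v\<in>Y - X. \<exists>j \<le> 2 * R + 1. (c v, v) \<in> N ^^ j)
     \<and> (\<forall>v\<in>(Y - X) - Z. \<forall>u\<in>Y - X. (v, u) \<in> N \<longrightarrow> c u = c v) \<and> sum \<nu> Z \<le> \<epsilon> * sum \<nu> (Y - X)"
    proof (rule psubset.IH[OF sub])
      fix v assume v: "v \<in> Y - X"
      then show "0 < \<nu> v" using psubset.prems(1) by blast
      have "sum \<nu> (Y - X) \<le> sum \<nu> Y"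
        using psubset.hyps nn by (intro sum_mono2) auto
      then show "sum \<nu> (Y - X) < (1 + \<epsilon>) ^ Suc R * \<nu> v" using psubset.prems(2)[of v] v by simp
    qed
    then obtain c Z where IH: "Z \<subseteq> Y - X" "\<forall>v\<in>Y - X. \<exists>j \<le> 2 * R + 1. (c v, v) \<in> N ^^ j"
      "\<forall>v\<in>(Y - X) - Z. \<forall>u\<in>Y - X. (v, u) \<in> N \<longrightarrow> c u = c v" "sum \<nu> Z \<le> \<epsilon> * sum \<nu> (Y - X)"
      by blast
    define c' where "c' = (\<lambda>v. if v \<in> X then a else c v)"
    have "Z0 \<union> Z \<subseteq> Y" using IH(1) BY by (auto simp: Z0_def)
    moreover have "\<exists>j \<le> 2 * R + 1. (c' v, v) \<in> N ^^ j" if "v \<in> Y" for v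
      using IH(2) that j(1) by (cases "v \<in> X") (auto simp: c'_def X_def B_def intro!: exI[of _ "2 * j + 1"])
    moreover have "c' u = c' v" if v: "v \<in> Y - (Z0 \<union> Z)" and u: "u \<in> Y" and N: "(v, u) \<in> N" for u v
    proof (cases "v \<in> X")
      case True
      then have "v \<in> B (2 * j)" using v B02 by (auto simp: Z0_def)
      then have "u \<in> X" using u N by (auto simp: X_def B_def)
      then show ?thesis using True by (simp add: c'_def)
    next
      case False
      then have "v \<notin> B (2 * j + 2)" using v B02 by (auto simp: Z0_def)
      moreover have "(u, v) \<in> N" using N \<open>sym N\<close> by (meson symD)
      ultimately have "u \<notin> X" using v by (auto simp: X_def B_def)
      then show ?thesis using False IH(3) v u N by (auto simp: c'_def)
    qed
    moreover have "sum \<nu> (Z0 \<union> Z) \<le> \<epsilon> * sum \<nu> Y"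
    proof -
      have "sum \<nu> (Z0 \<union> Z) \<le> sum \<nu> Z0 + sum \<nu> Z"
      proof -
        have "finite Z0" "finite Z" "0 \<le> sum \<nu> (Z0 \<inter> Z)"
          using fB IH(1) psubset.hyps nn BY finite_subset[of Z Y]
          by (auto simp: Z0_def intro!: sum_nonneg)
        then show ?thesis using sum.union_inter[of Z0 Z \<nu>] by simp
      qed
      also have "sum \<nu> Z0 = sum \<nu> (B (2 * j + 2)) - sum \<nu> (B (2 * j))"
        unfolding Z0_def using fB B02 by (intro sum_diff) auto
      also have "\<dots> \<le> \<epsilon> * sum \<nu> (B (2 * j))" using j(2) by (simp add: algebra_simps)
      \<comment> \<open>The ring is charged to \<open>X\<close>, which is removed, so the charges of
        different rounds are disjoint and add up to at most \<open>sum \<nu> Y\<close>.\<close>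
      also have "\<dots> \<le> \<epsilon> * sum \<nu> X"
        using fB B02(1) nn assms(4) subsetD[OF BY]
        by (intro mult_left_mono sum_mono2) (auto simp: X_def)
      also have "\<epsilon> * sum \<nu> X + sum \<nu> Z \<le> \<epsilon> * (sum \<nu> X + sum \<nu> (Y - X))"
        using IH(4) by (simp add: algebra_simps)
      also have "sum \<nu> X + sum \<nu> (Y - X) = sum \<nu> Y"
        using sum.subset_diff[of X Y \<nu>] psubset.hyps BY by (simp add: X_def)
      finally show ?thesis by simp
    qed
    ultimately show ?thesis by blast
  qed auto
qed

text \<open>Each response is chosen against the exponentials of the costs accumulated so far.\<close>

lemma multiplicative_weights:
  fixes cost :: "'x \<Rightarrow> 'i \<Rightarrow> real"
  assumes "finite I" "0 < U"
    and bnd: "\<And>x i. x \<in> X \<Longrightarrow> i \<in> I \<Longrightarrow> 0 \<le> cost x i \<and> cost x i \<le> U"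
    and best_response: "\<And>w. (\<And>i. i \<in> I \<Longrightarrow> 0 < w i) \<Longrightarrow> \<exists>x\<in>X. (\<Sum>i\<in>I. w i * cost x i) \<le> (\<Sum>i\<in>I. w i)"
  shows "\<exists>xs. xs \<noteq> [] \<and> set xs \<subseteq> X \<and> (\<forall>i\<in>I. (\<Sum>x\<leftarrow>xs. cost x i) \<le> 3 * length xs)"
proof -
  \<comment> \<open>This step size keeps \<open>\<eta> * cost\<close> in the unit interval, where
    \<open>exp y \<le> 1 + y + y^2 \<le> 1 + 2 * y\<close>.\<close>
  define \<eta> where "\<eta> = 1 / U"
  have \<eta>: "0 < \<eta>" using assms(2) by (simp add: \<eta>_def)
  define acc where "acc = (\<lambda>xs i. \<Sum>x\<leftarrow>xs. cost x i)"
  have "\<exists>xs. length xs = k \<and> set xs \<subseteq> X \<and> (\<Sum>i\<in>I. exp (\<eta> * acc xs i)) \<le> card I * (1 + 2 * \<eta>) ^ k" for k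
  proof (induction k)
    case 0 show ?case by (auto simp: acc_def)
  next
    case (Suc k)
    then obtain xs where xs: "length xs = k" "set xs \<subseteq> X"
      "(\<Sum>i\<in>I. exp (\<eta> * acc xs i)) \<le> card I * (1 + 2 * \<eta>) ^ k" by blast
    obtain x where x: "x \<in> X"
      "(\<Sum>i\<in>I. exp (\<eta> * acc xs i) * cost x i) \<le> (\<Sum>i\<in>I. exp (\<eta> * acc xs i))"
      using best_response[of "\<lambda>i. exp (\<eta> * acc xs i)"] by auto
    have "exp (\<eta> * acc (x # xs) i) \<le> exp (\<eta> * acc xs i) + 2 * \<eta> * (exp (\<eta> * acc xs i) * cost x i)"
      if i: "i \<in> I" for i
    proof -
      define y where "y = \<eta> * cost x i"
      have y: "0 \<le> y" "y \<le> 1" using bnd[OF x(1) i] \<eta> assms(2)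
        by (auto simp: y_def \<eta>_def divide_simps)
      have "exp y \<le> 1 + y + y\<^sup>2" using exp_bound[OF y] .
      also have "\<dots> \<le> 1 + 2 * y" using y by (simp add: power2_eq_square mult_left_le)
      finally have "exp (\<eta> * acc xs i) * exp y \<le> exp (\<eta> * acc xs i) * (1 + 2 * y)"
        by (intro mult_left_mono) auto
      then show ?thesis by (simp add: acc_def y_def exp_add distrib_left mult_ac)
    qed
    then have "(\<Sum>i\<in>I. exp (\<eta> * acc (x # xs) i))
        \<le> (\<Sum>i\<in>I. exp (\<eta> * acc xs i) + 2 * \<eta> * (exp (\<eta> * acc xs i) * cost x i))"
      by (intro sum_mono)
    also have "\<dots> = (\<Sum>i\<in>I. exp (\<eta> * acc xs i)) + 2 * \<eta> * (\<Sum>i\<in>I. exp (\<eta> * acc xs i) * cost x i)"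
      by (simp add: sum.distrib sum_distrib_left)
    also have "\<dots> \<le> (1 + 2 * \<eta>) * (\<Sum>i\<in>I. exp (\<eta> * acc xs i))"
      using x(2) \<eta> by (simp add: distrib_right)
    also have "\<dots> \<le> (1 + 2 * \<eta>) * (card I * (1 + 2 * \<eta>) ^ k)"
      using xs(3) \<eta> by (intro mult_left_mono) auto
    finally show ?case using xs(1,2) x(1) by (intro exI[of _ "x # xs"]) (auto simp: mult_ac)
  qed
  \<comment> \<open>With \<open>k \<ge> U * card I\<close> the initial potential, estimated by
    \<open>exp (card I)\<close>, contributes at most \<open>k\<close> to an accumulated cost; the
    factor \<open>1 + 2 * \<eta>\<close> contributes \<open>2 * k\<close>. Together this is the 3 of
    the conclusion.\<close>
  moreover define k where "k = Suc (nat \<lceil>U * card I\<rceil>)"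
  ultimately obtain xs where xs: "length xs = k" "set xs \<subseteq> X"
    "(\<Sum>i\<in>I. exp (\<eta> * acc xs i)) \<le> card I * (1 + 2 * \<eta>) ^ k" by blast
  have "acc xs i \<le> 3 * k" if i: "i \<in> I" for i
  proof -
    have "exp (\<eta> * acc xs i) \<le> (\<Sum>i\<in>I. exp (\<eta> * acc xs i))"
      using assms(1) i by (intro member_le_sum) auto
    also have "\<dots> \<le> card I * (1 + 2 * \<eta>) ^ k" by (rule xs(3))
    also have "\<dots> \<le> exp (card I) * exp (2 * \<eta>) ^ k"
      using \<eta> exp_ge_add_one_self[of "2 * \<eta>"] exp_ge_add_one_self[of "real (card I)"]
      by (intro mult_mono power_mono) (auto intro: order_trans[OF _ exp_ge_add_one_self])
    also have "\<dots> = exp (card I + 2 * \<eta> * k)" 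
      using exp_of_nat_mult[of k "2 * \<eta>"] by (simp add: exp_add mult_ac)
    finally have "\<eta> * acc xs i \<le> card I + 2 * \<eta> * k" by simp
    then have "acc xs i \<le> U * card I + 2 * k" using assms(2) by (simp add: \<eta>_def field_simps)
    moreover have "U * card I \<le> k" unfolding k_def by linarith
    ultimately show ?thesis by simp
  qed
  then show ?thesis using xs(1,2) unfolding acc_def k_def by (intro exI[of _ xs]) auto
qed

section \<open>Routing through a hierarchy of clusters\<close>

text \<open>\<open>w_min\<close> limits the spread of the weights, so that \<open>L\<close>
  doublings of the scale lead from clusters that are single nodes to clusters that contain all short
  pairs of padded nodes.\<close>

locale hop_metric =
  fixes n :: nat and E :: "(nat \<times> nat) list" and h L :: nat and w :: "nat \<Rightarrow> real"
  assumes wf: "wf_graph n E" and E_ne: "E \<noteq> []" and h_pos: "0 < h"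
    and w_pos: "e < length E \<Longrightarrow> 0 < w e"
    and w_min: "e < length E \<Longrightarrow> 2 * sum w {..<length E} \<le> 2 ^ L * w e"
begin

definition wt :: real where "wt = sum w {..<length E}"

definition W :: "nat \<Rightarrow> real" where "W i = wt * 2 ^ i / 2 ^ L"

text \<open>Normalised so that a walk of at most \<open>h\<close> hops and of weight at most
  \<open>W i\<close> has length at most 2, the threshold in \<open>N\<close>.\<close>

definition len :: "nat \<Rightarrow> dedge list \<Rightarrow> real" where
  "len i ds = (\<Sum>d\<leftarrow>ds. w (fst d) / W i + 1 / h)"

definition N :: "nat \<Rightarrow> (nat \<times> nat) set" where
  "N i = {(u, v). \<exists>ds. walk E u ds v \<and> len i ds \<le> 2}"

lemma wt_pos: "0 < wt"
  unfolding wt_def using E_ne w_pos by (intro sum_pos) auto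

lemma W_pos: "0 < W i"
  using wt_pos by (simp add: W_def)

lemma W_Suc: "W (Suc i) = 2 * W i"
  by (simp add: W_def)

lemma W_L: "W L = wt"
  by (simp add: W_def)

lemma len_append [simp]: "len i (xs @ ys) = len i xs + len i ys"
  by (simp add: len_def)

lemma len_flip [simp]: "len i (rev (map flip ds)) = len i ds"
  by (induction ds) (auto simp: len_def)

lemma len_Suc_le: "walk E u ds v \<Longrightarrow> len (Suc i) ds \<le> len i ds"
proof (induction ds arbitrary: u)
  case (Cons d ds)
  then have "w (fst d) / W (Suc i) \<le> w (fst d) / W i"
    using w_pos[of "fst d"] W_pos[of i] by (intro divide_left_mono) (auto simp: W_Suc)
  then show ?case using Cons by (auto simp: len_def intro!: add_mono)
qed (simp add: len_def)

lemma len_split: "len i ds = (\<Sum>d\<leftarrow>ds. w (fst d)) / W i + length ds / h"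
  by (induction ds) (auto simp: len_def add_divide_distrib)

lemma len_nonneg: "walk E u ds v \<Longrightarrow> 0 \<le> len i ds"
proof (induction ds arbitrary: u)
  case (Cons d ds)
  then show ?case using w_pos[of "fst d"] W_pos[of i] by (auto simp: len_def intro!: add_nonneg_nonneg)
qed (simp add: len_def)

lemma weight_list_nonneg: "walk E u ds v \<Longrightarrow> 0 \<le> (\<Sum>d\<leftarrow>ds. w (fst d))"
proof (induction ds arbitrary: u)
  case (Cons d ds)
  then show ?case using w_pos[of "fst d"] by (auto intro!: add_nonneg_nonneg)
qed simp

lemma refl_N: "refl (N i)"
  by (auto simp: N_def refl_on_def len_def intro!: exI[of _ "[]"])

lemma sym_N: "sym (N i)"
proof (rule symI)
  fix u v assume "(u, v) \<in> N i"
  then obtain ds where "walk E u ds v" "len i ds \<le> 2" by (auto simp: N_def)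
  then show "(v, u) \<in> N i" using walk_flip[of E u ds v]
    by (auto simp: N_def intro!: exI[of _ "rev (map flip ds)"] simp del: rev_map)
qed

lemma N_Suc: "N i \<subseteq> N (Suc i)"
  unfolding N_def using len_Suc_le order_trans by blast

lemma N_power: "(u, v) \<in> N i ^^ j \<Longrightarrow> \<exists>ds. walk E u ds v \<and> len i ds \<le> 2 * j"
proof (induction j arbitrary: v)
  case 0
  then show ?case by (intro exI[of _ "[]"]) (simp add: len_def)
next
  case (Suc j)
  then obtain x where "(u, x) \<in> N i ^^ j" "(x, v) \<in> N i" by auto
  from Suc.IH[OF this(1)] obtain ds where "walk E u ds x" "len i ds \<le> 2 * j" by blast
  moreover from \<open>(x, v) \<in> N i\<close> obtain ds' where "walk E x ds' v" "len i ds' \<le> 2"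
    by (auto simp: N_def)
  ultimately show ?case by (intro exI[of _ "ds @ ds'"]) (auto simp: walk_append)
qed

text \<open>By \<open>w_min\<close> a single edge weighs at least \<open>2 * W 0\<close> and is
  longer than 2. So singletons are padded clusters at the bottom, where every chain starts.\<close>

lemma N_0: "(u, v) \<in> N 0 \<Longrightarrow> u = v"
proof -
  assume "(u, v) \<in> N 0"
  then obtain ds where ds: "walk E u ds v" "len 0 ds \<le> 2" by (auto simp: N_def)
  show "u = v"
  proof (cases ds)
    case (Cons d ds')
    have d: "fst d < length E" and ds': "walk E (dhead E d) ds' v" using ds Cons by auto
    have "2 * W 0 \<le> w (fst d)" using w_min[OF d] by (simp add: W_def wt_def field_simps)
    then have "2 \<le> w (fst d) / W 0" using W_pos[of 0] by (simp add: field_simps)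
    moreover have "0 \<le> len 0 ds'" using len_nonneg[OF ds'] .
    moreover have "len 0 ds = w (fst d) / W 0 + 1 / h + len 0 ds'" by (simp add: Cons len_def)
    moreover have "1 / real h > 0" using h_pos by simp
    ultimately show ?thesis using ds(2) by linarith
  qed (use ds in simp)
qed

lemma sum_fst_set:
  fixes f :: "nat \<Rightarrow> real"
  assumes "distinct (map fst ds)"
  shows "(\<Sum>d\<leftarrow>ds. f (fst d)) = (\<Sum>e\<in>fst ` set ds. f e)"
  using sum_list_distinct_conv_sum_set[OF assms, of f] by (simp add: comp_def)

text \<open>At the top scale, weight and hops contribute at most 1 each. Hence padded endpoints of a
  short simple walk share their top centre.\<close>

lemma N_L:
  assumes "walk E u ds v" "distinct (nodes E u ds)" "length ds \<le> h"
  shows "(u, v) \<in> N L"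
proof -
  have "(\<Sum>d\<leftarrow>ds. w (fst d)) = (\<Sum>e\<in>fst ` set ds. w e)"
    using simple_walk_distinct_edges[OF assms(1,2)] by (rule sum_fst_set)
  also have "\<dots> \<le> wt" unfolding wt_def
    using walk_edges[OF assms(1)] w_pos by (intro sum_mono2) (auto intro: less_imp_le)
  finally have "(\<Sum>d\<leftarrow>ds. w (fst d)) / W L \<le> 1" using wt_pos by (simp add: W_L)
  moreover have "length ds / h \<le> 1" using assms(3) h_pos by simp
  ultimately show ?thesis using assms(1) unfolding N_def len_split by fastforce
qed

end

text \<open>\<open>Z\<close> collects the nodes that are unpadded at some level;
  \<open>\<rho>\<close> counts steps of \<open>N i\<close>, each of length at most 2.\<close>

locale hop_clusters = hop_metric +
  fixes c :: "nat \<Rightarrow> nat \<Rightarrow> nat" and Z :: "nat set" and \<rho> :: nat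
  assumes c_0: "c 0 u = u"
    and c_near: "i \<le> L \<Longrightarrow> u < n \<Longrightarrow> \<exists>ds. walk E (c i u) ds u \<and> len i ds \<le> 2 * \<rho>"
    and c_padded: "i \<le> L \<Longrightarrow> u < n \<Longrightarrow> u \<notin> Z \<Longrightarrow> v < n \<Longrightarrow> (u, v) \<in> N i \<Longrightarrow> c i v = c i u"
begin

text \<open>A link depends on a node only through this pair of consecutive centres. All packets of a
  class share the link, so loads can be counted class by class.\<close>

definition \<kappa> :: "nat \<Rightarrow> nat \<Rightarrow> nat \<times> nat" where "\<kappa> i u = (c i u, c (Suc i) u)"

definition link :: "nat \<Rightarrow> nat \<times> nat \<Rightarrow> dedge list" where
  "link i k = (SOME ds. walk E (fst k) ds (snd k) \<and> len (Suc i) ds \<le> 4 * \<rho>)"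

text \<open>From the lower centre to \<open>u\<close>, then to the upper centre:
  \<open>2 * \<rho>\<close> for each leg, since the first leg only gets shorter at the coarser
  scale.\<close>

lemma link:
  assumes "i < L" "u < n"
  shows "walk E (c i u) (link i (\<kappa> i u)) (c (Suc i) u)" "len (Suc i) (link i (\<kappa> i u)) \<le> 4 * \<rho>"
proof -
  obtain ds where ds: "walk E (c i u) ds u" "len i ds \<le> 2 * \<rho>" using c_near[of i u] assms by auto
  obtain ds' where ds': "walk E (c (Suc i) u) ds' u" "len (Suc i) ds' \<le> 2 * \<rho>"
    using c_near[of "Suc i" u] assms by auto
  have "walk E (c i u) (ds @ rev (map flip ds')) (c (Suc i) u) \<and> len (Suc i) (ds @ rev (map flip ds')) \<le> 4 * \<rho>"
    using ds ds' walk_flip[OF ds'(1)] len_Suc_le[OF ds(1), of i] len_flip[of "Suc i" ds']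
    by (auto simp: walk_append simp del: len_flip)
  then have "\<exists>ds. walk E (fst (\<kappa> i u)) ds (snd (\<kappa> i u)) \<and> len (Suc i) ds \<le> 4 * \<rho>"
    unfolding \<kappa>_def fst_conv snd_conv by blast
  from someI_ex[OF this] show "walk E (c i u) (link i (\<kappa> i u)) (c (Suc i) u)"
    "len (Suc i) (link i (\<kappa> i u)) \<le> 4 * \<rho>" unfolding link_def by (auto simp: \<kappa>_def)
qed

lemma link_length:
  assumes "i < L" "u < n"
  shows "length (link i (\<kappa> i u)) \<le> 4 * \<rho> * h"
proof -
  have "0 \<le> (\<Sum>d\<leftarrow>link i (\<kappa> i u). w (fst d)) / W (Suc i)"
    using weight_list_nonneg[OF link(1)[OF assms]] W_pos[of "Suc i"] by simp
  then have "length (link i (\<kappa> i u)) / h \<le> real (4 * \<rho>)"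
    using link(2)[OF assms] unfolding len_split by linarith
  then have "real (length (link i (\<kappa> i u))) \<le> real (4 * \<rho> * h)" using h_pos by (simp add: field_simps)
  then show ?thesis by (simp only: of_nat_le_iff)
qed

lemma link_weight:
  assumes "i < L" "u < n"
  shows "(\<Sum>e\<in>fst ` set (link i (\<kappa> i u)). w e) \<le> 4 * \<rho> * W (Suc i)"
proof -
  let ?l = "link i (\<kappa> i u)"
  have "(\<Sum>e\<in>fst ` set ?l. w e) \<le> (\<Sum>d\<leftarrow>ds. w (fst d))" if "walk E x ds y" "ds = ?l" for x y ds
  proof -
    have "(\<Sum>e\<in>fst ` set ds. w e) \<le> (\<Sum>d\<leftarrow>ds. w (fst d))" using that(1)
    proof (induction ds arbitrary: x)
      case (Cons d ds)
      then have "0 < w (fst d)" "(\<Sum>e\<in>fst ` set ds. w e) \<le> (\<Sum>d\<leftarrow>ds. w (fst d))" using w_pos by auto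
      then show ?case by (cases "fst d \<in> fst ` set ds") (auto simp: insert_absorb)
    qed simp
    then show ?thesis using that(2) by simp
  qed
  then have "(\<Sum>e\<in>fst ` set ?l. w e) \<le> (\<Sum>d\<leftarrow>?l. w (fst d))" using link(1)[OF assms] by blast
  moreover have "(\<Sum>d\<leftarrow>?l. w (fst d)) / W (Suc i) \<le> 4 * \<rho>"
    using link(2)[OF assms] unfolding len_split by (smt (verit) of_nat_0_le_iff divide_nonneg_nonneg)
  then have "(\<Sum>d\<leftarrow>?l. w (fst d)) \<le> 4 * \<rho> * W (Suc i)"
    using W_pos[of "Suc i"] by (simp add: divide_le_eq)
  ultimately show ?thesis by linarith
qed

fun up :: "nat \<Rightarrow> nat \<Rightarrow> dedge list" where
  "up 0 u = []"
| "up (Suc i) u = up i u @ link i (\<kappa> i u)"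

lemma up_walk: "i \<le> L \<Longrightarrow> u < n \<Longrightarrow> walk E u (up i u) (c i u)"
  by (induction i) (auto simp: c_0 walk_append link(1))

lemma up_length: "i \<le> L \<Longrightarrow> u < n \<Longrightarrow> length (up i u) \<le> i * (4 * \<rho> * h)"
proof (induction i)
  case (Suc i)
  then show ?case using link_length[of i u] by simp
qed simp

lemma up_edges: "e \<in> fst ` set (up i u) \<Longrightarrow> \<exists>j<i. e \<in> fst ` set (link j (\<kappa> j u))"
  by (induction i) (auto simp: less_Suc_eq image_Un)

text \<open>Climbing stops at the first common centre. Below it the two centres differ, so each link
  used can be charged to a walk that leaves the cluster.\<close>

definition meet :: "nat \<Rightarrow> nat \<Rightarrow> nat" where "meet s t = (LEAST i. c i s = c i t)"

definition conn :: "nat \<Rightarrow> nat \<Rightarrow> dedge list" where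
  "conn s t = up (meet s t) s @ rev (map flip (up (meet s t) t))"

definition route :: "nat \<Rightarrow> nat \<Rightarrow> dedge list option" where
  "route s t = (if s < n \<and> t < n \<and> s \<notin> Z \<and> t \<notin> Z \<and> (\<exists>i\<le>L. c i s = c i t)
     then Some (SOME ds. walk E s ds t \<and> distinct (nodes E s ds) \<and> set ds \<subseteq> set (conn s t) \<and> length ds \<le> length (conn s t))
     else None)"

lemma route_Some:
  assumes "route s t = Some ds"
  shows "s < n" "t < n" "s \<notin> Z" "t \<notin> Z" "meet s t \<le> L" "walk E s ds t" "distinct (nodes E s ds)"
    "set ds \<subseteq> set (conn s t)" "length ds \<le> 8 * L * \<rho> * h"
proof -
  have st: "s < n" "t < n" "s \<notin> Z" "t \<notin> Z" "\<exists>i\<le>L. c i s = c i t"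
    using assms by (auto simp: route_def split: if_splits)
  then obtain i where i: "i \<le> L" "c i s = c i t" by blast
  have m: "c (meet s t) s = c (meet s t) t" "meet s t \<le> L"
    using LeastI[of "\<lambda>i. c i s = c i t" i] Least_le[of "\<lambda>i. c i s = c i t" i] i by (auto simp: meet_def)
  have "walk E s (conn s t) t" unfolding conn_def walk_append
    using up_walk[OF m(2) st(1)] walk_flip[OF up_walk[OF m(2) st(2)]] m(1) by auto
  from someI_ex[OF simple_walk_exists[OF this]]
  have ds: "walk E s ds t \<and> distinct (nodes E s ds) \<and> set ds \<subseteq> set (conn s t) \<and> length ds \<le> length (conn s t)"
    using assms st by (auto simp: route_def)
  have "length (conn s t) \<le> 2 * (meet s t * (4 * \<rho> * h))"
    using up_length[OF m(2) st(1)] up_length[OF m(2) st(2)] by (simp add: conn_def)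
  also have "\<dots> \<le> 2 * (L * (4 * \<rho> * h))" using m(2) by (intro mult_le_mono) auto
  finally show "length ds \<le> 8 * L * \<rho> * h" using ds by (simp add: mult_ac)
  show "s < n" "t < n" "s \<notin> Z" "t \<notin> Z" "meet s t \<le> L" "walk E s ds t" "distinct (nodes E s ds)"
    "set ds \<subseteq> set (conn s t)" using st m ds by auto
qed

lemma route_defined:
  assumes "walk E s ds t" "distinct (nodes E s ds)" "length ds \<le> h" "s < n" "t < n" "s \<notin> Z" "t \<notin> Z"
  shows "route s t \<noteq> None"
  using c_padded[of L s t] N_L[OF assms(1-3)] assms by (auto simp: route_def)

definition Ek :: "nat \<Rightarrow> nat \<times> nat \<Rightarrow> nat set" where
  "Ek i k = {e. e < length E \<and> (\<kappa> i (fst (E ! e)) = k \<or> \<kappa> i (snd (E ! e)) = k)}"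

text \<open>A short walk leaving the class of a surviving node has length more than 2 until it leaves, of
  which the number of hops accounts for at most 1.\<close>

lemma exit_weight:
  assumes u: "u < n" "u \<notin> Z" and i: "i < L" and ds: "walk E u ds v" "distinct (map fst ds)" "length ds \<le> h"
    and ne: "c i v \<noteq> c i u"
  shows "W i \<le> (\<Sum>e\<in>fst ` set ds \<inter> Ek i (\<kappa> i u). w e)"
proof -
  define P where "P = (\<lambda>j. j \<le> length ds \<and> \<kappa> i (nodes E u ds ! j) \<noteq> \<kappa> i u)"
  define j where "j = (LEAST j. P j)"
  have "P (length ds)" using walk_last[OF ds(1)] ne by (simp add: P_def \<kappa>_def)
  then have Pj: "P j" unfolding j_def by (rule LeastI)
  have min: "\<not> P l" if "l < j" for l using that unfolding j_def by (rule not_less_Least)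
  have jl: "j \<le> length ds" using Pj by (simp add: P_def)
  have "walk E u (take j ds @ drop j ds) v" using ds(1) by simp
  then obtain x where x: "walk E u (take j ds) x" "walk E x (drop j ds) v" unfolding walk_append by blast
  have xj: "x = nodes E u ds ! j" using walk_last[OF x(1)] jl by (cases j) (auto simp: nodes_def min_def)
  have xn: "x < n" using nodes_bound[OF wf ds(1) u(1)] jl unfolding xj
    by (metis length_nodes lessThan_iff less_Suc_eq_le nth_mem subsetD)
  have "2 < len i (take j ds)"
  proof (rule ccontr)
    assume "\<not> 2 < len i (take j ds)"
    then have "(u, x) \<in> N i" using x(1) by (auto simp: N_def)
    \<comment> \<open>A class records two levels, so padding is used at both.\<close>
    moreover from this have "(u, x) \<in> N (Suc i)" using N_Suc by blast
    ultimately have "\<kappa> i x = \<kappa> i u" using c_padded[of _ u x] u xn i by (simp add: \<kappa>_def)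
    then show False using Pj xj by (simp add: P_def)
  qed
  moreover have "length (take j ds) / h \<le> 1" using ds(3) h_pos by simp
  ultimately have "1 < (\<Sum>d\<leftarrow>take j ds. w (fst d)) / W i" unfolding len_split by linarith
  then have "W i \<le> (\<Sum>d\<leftarrow>take j ds. w (fst d))" using W_pos[of i] by (simp add: less_divide_eq)
  also have "distinct (map fst (take j ds))" using ds(2) by (simp add: take_map[symmetric] distinct_take)
  then have "(\<Sum>d\<leftarrow>take j ds. w (fst d)) = (\<Sum>e\<in>fst ` set (take j ds). w e)" by (rule sum_fst_set)
  also have "\<dots> \<le> (\<Sum>e\<in>fst ` set ds \<inter> Ek i (\<kappa> i u). w e)"
  proof (intro sum_mono2 subsetI)
    fix e assume "e \<in> fst ` set (take j ds)"
    then obtain l where l: "l < j" "l < length ds" "e = fst (ds ! l)"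
      by (auto simp: in_set_conv_nth)
    have "\<kappa> i (nodes E u ds ! l) = \<kappa> i u" using min[OF l(1)] l(2) by (simp add: P_def)
    then have "\<kappa> i (dtail E (ds ! l)) = \<kappa> i u" using walk_tail_nth[OF ds(1) l(2)] by simp
    then have "e \<in> Ek i (\<kappa> i u)" using l walk_edges[OF ds(1), of "ds ! l"]
      by (auto simp: Ek_def dtail_def split: if_splits)
    then show "e \<in> fst ` set ds \<inter> Ek i (\<kappa> i u)" using l by simp
  qed (use walk_edges[OF ds(1)] w_pos in \<open>auto intro: less_imp_le\<close>)
  finally show ?thesis .
qed

text \<open>Double counting: by \<open>exit_weight\<close> each packet counted here uses weight at
  least \<open>W i\<close> among the edges touching the class, and each such edge carries at most
  \<open>h\<close> packets. The bound itself no longer depends on \<open>S\<close>.\<close>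

lemma class_load:
  fixes x y :: "'p \<Rightarrow> nat" and Q :: "'p \<Rightarrow> dedge list"
  assumes "finite S" and i: "i < L"
    and Q: "\<And>p. p \<in> S \<Longrightarrow> walk E (x p) (Q p) (y p) \<and> distinct (map fst (Q p)) \<and> length (Q p) \<le> h"
    and cong: "\<And>e. card {p\<in>S. e \<in> fst ` set (Q p)} \<le> h"
  shows "card {p\<in>S. x p < n \<and> x p \<notin> Z \<and> \<kappa> i (x p) = k \<and> c i (y p) \<noteq> c i (x p)} \<le> h * sum w (Ek i k) / W i"
    (is "real (card ?X) \<le> _")
proof -
  have fE: "finite (Ek i k)" by (simp add: Ek_def)
  have fX: "finite ?X" using assms(1) by simp
  have w0: "0 \<le> w e" if "e \<in> Ek i k" for e using that w_pos[of e] by (simp add: Ek_def)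
  have "card ?X * W i = (\<Sum>p\<in>?X. W i)" by simp
  also have "\<dots> \<le> (\<Sum>p\<in>?X. \<Sum>e\<in>Ek i k. if e \<in> fst ` set (Q p) then w e else 0)"
  proof (intro sum_mono)
    fix p assume "p \<in> ?X"
    then have p: "p \<in> S" "x p < n" "x p \<notin> Z" "\<kappa> i (x p) = k" "c i (y p) \<noteq> c i (x p)" by auto
    have "W i \<le> (\<Sum>e\<in>fst ` set (Q p) \<inter> Ek i k. w e)"
      using exit_weight[OF p(2,3) i, of "Q p" "y p"] Q[OF p(1)] p(4,5) by simp
    also have "\<dots> = (\<Sum>e\<in>Ek i k. if e \<in> fst ` set (Q p) then w e else 0)"
      using fE by (subst Int_commute) (rule sum.inter_restrict)
    finally show "W i \<le> (\<Sum>e\<in>Ek i k. if e \<in> fst ` set (Q p) then w e else 0)" .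
  qed
  also have "\<dots> = (\<Sum>e\<in>Ek i k. \<Sum>p\<in>?X. if e \<in> fst ` set (Q p) then w e else 0)" by (rule sum.swap)
  also have "\<dots> = (\<Sum>e\<in>Ek i k. w e * card {p\<in>?X. e \<in> fst ` set (Q p)})"
    using fX by (intro sum.cong refl) (simp flip: sum.inter_filter)
  also have "\<dots> \<le> (\<Sum>e\<in>Ek i k. w e * h)"
  proof (intro sum_mono mult_left_mono w0)
    fix e
    have "card {p\<in>?X. e \<in> fst ` set (Q p)} \<le> card {p\<in>S. e \<in> fst ` set (Q p)}"
      using assms(1) by (intro card_mono) auto
    then show "real (card {p\<in>?X. e \<in> fst ` set (Q p)}) \<le> real h" using cong[of e] by simp
  qed
  also have "\<dots> = h * sum w (Ek i k)" by (simp add: sum_distrib_left mult.commute)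
  finally show ?thesis using W_pos[of i] by (simp add: le_divide_eq)
qed

text \<open>The bound of \<open>class_load\<close>, summed over the links through \<open>e\<close>;
  the factor 2 covers the packets climbing from their sources and those descending to their
  destinations.\<close>

definition load :: "nat \<Rightarrow> real" where
  "load e = (\<Sum>i<L. \<Sum>k\<in>\<kappa> i ` {..<n}. if e \<in> fst ` set (link i k) then 2 * (h * sum w (Ek i k) / W i) else 0)"

lemma load_bound:
  assumes "finite S" "routable E h S"
  shows "card {p\<in>S. \<exists>ds. route (psrc p) (pdst p) = Some ds \<and> e \<in> fst ` set ds} \<le> load e"
    (is "real (card ?A) \<le> _")
proof -
  obtain Q where Q: "\<And>p. p\<in>S \<Longrightarrow> walk E (psrc p) (Q p) (pdst p) \<and> distinct (nodes E (psrc p) (Q p)) \<and> length (Q p) \<le> h"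
    "\<And>e. card {p\<in>S. e \<in> fst ` set (Q p)} \<le> h" using assms(2) unfolding routable_def by blast
  define X where "X = (\<lambda>i k. {p\<in>S. psrc p < n \<and> psrc p \<notin> Z \<and> \<kappa> i (psrc p) = k \<and> c i (pdst p) \<noteq> c i (psrc p)})"
  define Y where "Y = (\<lambda>i k. {p\<in>S. pdst p < n \<and> pdst p \<notin> Z \<and> \<kappa> i (pdst p) = k \<and> c i (psrc p) \<noteq> c i (pdst p)})"
  define I where "I = (SIGMA i:{..<L}. {k\<in>\<kappa> i ` {..<n}. e \<in> fst ` set (link i k)})"
  have fI: "finite I" by (simp add: I_def)
  have "?A \<subseteq> (\<Union>(i, k)\<in>I. X i k \<union> Y i k)"
  proof
    fix p assume "p \<in> ?A"
    then obtain ds where p: "p \<in> S" "route (psrc p) (pdst p) = Some ds" "e \<in> fst ` set ds" by blast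
    note r = route_Some[OF p(2)]
    have "e \<in> fst ` set (conn (psrc p) (pdst p))" using r(8) p(3) by blast
    then have "e \<in> fst ` set (up (meet (psrc p) (pdst p)) (psrc p)) \<or> e \<in> fst ` set (up (meet (psrc p) (pdst p)) (pdst p))"
      unfolding conn_def set_append image_Un fst_set_rev_flip by blast
    then obtain i u where i: "i < meet (psrc p) (pdst p)" "e \<in> fst ` set (link i (\<kappa> i u))" "u = psrc p \<or> u = pdst p"
      using up_edges by blast
    have "c i (psrc p) \<noteq> c i (pdst p)" using i(1) not_less_Least unfolding meet_def by blast
    then have "p \<in> X i (\<kappa> i u) \<union> Y i (\<kappa> i u)" using p(1) r(1-4) i(3) by (auto simp: X_def Y_def)
    moreover have "(i, \<kappa> i u) \<in> I" using i r(1,2,5) by (auto simp: I_def)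
    ultimately show "p \<in> (\<Union>(i, k)\<in>I. X i k \<union> Y i k)" by blast
  qed
  then have "card ?A \<le> card (\<Union>(i, k)\<in>I. X i k \<union> Y i k)"
    using fI assms(1) by (intro card_mono) (auto simp: X_def Y_def)
  also have "\<dots> \<le> (\<Sum>(i, k)\<in>I. card (X i k \<union> Y i k))"
    using card_UN_le[OF fI, of "\<lambda>(i, k). X i k \<union> Y i k"] by (simp add: case_prod_unfold)
  finally have "real (card ?A) \<le> (\<Sum>(i, k)\<in>I. real (card (X i k \<union> Y i k)))"
    by (simp add: case_prod_unfold flip: of_nat_sum)
  also have "\<dots> \<le> (\<Sum>(i, k)\<in>I. 2 * (h * sum w (Ek i k) / W i))"
  proof (intro sum_mono, clarify)
    fix i a b assume "(i, a, b) \<in> I"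
    then have i: "i < L" by (simp add: I_def)
    have "real (card (X i (a, b))) \<le> h * sum w (Ek i (a, b)) / W i" unfolding X_def
      using Q simple_walk_distinct_edges by (intro class_load[OF assms(1) i, of _ Q]) blast+
    \<comment> \<open>Seen from the destination, the walks are reversed so that they start at the
      padded node of the class.\<close>
    moreover have "real (card (Y i (a, b))) \<le> h * sum w (Ek i (a, b)) / W i" unfolding Y_def
    proof (intro class_load[OF assms(1) i, of _ "\<lambda>p. rev (map flip (Q p))"])
      fix p assume "p \<in> S"
      then have "walk E (psrc p) (Q p) (pdst p)" "distinct (map fst (Q p))" "length (Q p) \<le> h"
        using Q simple_walk_distinct_edges by blast+
      then show "walk E (pdst p) (rev (map flip (Q p))) (psrc p) \<and>
         distinct (map fst (rev (map flip (Q p)))) \<and> length (rev (map flip (Q p))) \<le> h"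
        using walk_flip[of E "psrc p" "Q p" "pdst p"] by (simp add: rev_map[symmetric] comp_def)
    qed (use Q(2) in \<open>simp only: fst_set_rev_flip\<close>)
    moreover have "card (X i (a, b) \<union> Y i (a, b)) \<le> card (X i (a, b)) + card (Y i (a, b))" by (rule card_Un_le)
    ultimately show "real (card (X i (a, b) \<union> Y i (a, b))) \<le> 2 * (h * sum w (Ek i (a, b)) / W i)" by simp
  qed
  also have "\<dots> = (\<Sum>i<L. \<Sum>k\<in>{k\<in>\<kappa> i ` {..<n}. e \<in> fst ` set (link i k)}. 2 * (h * sum w (Ek i k) / W i))"
    unfolding I_def by (rule sum.Sigma[symmetric]) auto
  also have "\<dots> = load e" unfolding load_def by (intro sum.cong refl sum.inter_filter) simp
  finally show ?thesis .
qed

lemma Ek_weight_nonneg: "0 \<le> h * sum w (Ek i k) / W i"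
proof -
  have "0 \<le> sum w (Ek i k)" using w_pos by (intro sum_nonneg) (auto simp: Ek_def intro: less_imp_le)
  then show ?thesis using W_pos[of i] by simp
qed

lemma load_nonneg: "0 \<le> load e"
  unfolding load_def
  by (intro sum_nonneg) (simp add: Ek_weight_nonneg del: times_divide_eq_right)

text \<open>An edge touches at most two classes, those of its endpoints.\<close>

lemma class_weight: "(\<Sum>k\<in>\<kappa> i ` {..<n}. sum w (Ek i k)) \<le> 2 * wt"
proof -
  have "(\<Sum>k\<in>\<kappa> i ` {..<n}. sum w (Ek i k))
      = (\<Sum>k\<in>\<kappa> i ` {..<n}. \<Sum>e<length E. if \<kappa> i (fst (E ! e)) = k \<or> \<kappa> i (snd (E ! e)) = k then w e else 0)"
  proof (rule sum.cong[OF refl])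
    fix k
    have "Ek i k = {e\<in>{..<length E}. \<kappa> i (fst (E ! e)) = k \<or> \<kappa> i (snd (E ! e)) = k}" by (auto simp: Ek_def)
    then show "sum w (Ek i k) = (\<Sum>e<length E. if \<kappa> i (fst (E ! e)) = k \<or> \<kappa> i (snd (E ! e)) = k then w e else 0)"
      by (simp only: sum.inter_filter[OF finite_lessThan])
  qed
  also have "\<dots> = (\<Sum>e<length E. \<Sum>k\<in>\<kappa> i ` {..<n}. if \<kappa> i (fst (E ! e)) = k \<or> \<kappa> i (snd (E ! e)) = k then w e else 0)"
    by (rule sum.swap)
  also have "\<dots> \<le> (\<Sum>e<length E. 2 * w e)"
  proof (intro sum_mono)
    fix e assume e: "e \<in> {..<length E}"
    let ?K = "{k\<in>\<kappa> i ` {..<n}. \<kappa> i (fst (E ! e)) = k \<or> \<kappa> i (snd (E ! e)) = k}"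
    have "card ?K \<le> card {\<kappa> i (fst (E ! e)), \<kappa> i (snd (E ! e))}" by (intro card_mono) auto
    also have "\<dots> \<le> 2" by (simp add: card_insert_if)
    finally have "card ?K * w e \<le> 2 * w e" using w_pos[of e] e by (intro mult_right_mono) auto
    then show "(\<Sum>k\<in>\<kappa> i ` {..<n}. if \<kappa> i (fst (E ! e)) = k \<or> \<kappa> i (snd (E ! e)) = k then w e else 0) \<le> 2 * w e"
      by (subst sum.inter_filter[symmetric]) auto
  qed
  finally show ?thesis by (simp add: wt_def sum_distrib_left)
qed

text \<open>The scale cancels: a link has weight at most
  \<open>4 * \<rho> * W (Suc i) = 8 * \<rho> * W i\<close> and carries at most
  \<open>2 * h / W i\<close> times the weight of its class, which makes 16.
  \<open>class_weight\<close> doubles this, and the sum over levels contributes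
  \<open>L\<close>.\<close>

lemma weighted_load: "(\<Sum>e<length E. w e * load e) \<le> 32 * L * \<rho> * h * wt"
proof -
  have "(\<Sum>e<length E. w e * load e)
     = (\<Sum>e<length E. \<Sum>i<L. \<Sum>k\<in>\<kappa> i ` {..<n}. if e \<in> fst ` set (link i k) then w e * (2 * (h * sum w (Ek i k) / W i)) else 0)"
    unfolding load_def sum_distrib_left by (intro sum.cong refl) simp
  also have "\<dots> = (\<Sum>i<L. \<Sum>e<length E. \<Sum>k\<in>\<kappa> i ` {..<n}. if e \<in> fst ` set (link i k) then w e * (2 * (h * sum w (Ek i k) / W i)) else 0)"
    by (rule sum.swap)
  also have "\<dots> = (\<Sum>i<L. \<Sum>k\<in>\<kappa> i ` {..<n}. \<Sum>e<length E. if e \<in> fst ` set (link i k) then w e * (2 * (h * sum w (Ek i k) / W i)) else 0)"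
    by (intro sum.cong refl sum.swap)
  also have "\<dots> \<le> (\<Sum>i<L. \<Sum>k\<in>\<kappa> i ` {..<n}. 16 * \<rho> * h * sum w (Ek i k))"
  proof (intro sum_mono)
    fix i k assume i: "i \<in> {..<L}" and "k \<in> \<kappa> i ` {..<n}"
    then obtain u where u: "u < n" "k = \<kappa> i u" by auto
    let ?s = "h * sum w (Ek i k) / W i"
    have s0: "0 \<le> ?s" by (rule Ek_weight_nonneg)
    have sub: "fst ` set (link i k) \<subseteq> {..<length E}" using walk_edges[OF link(1)] i u by auto
    have "(\<Sum>e<length E. if e \<in> fst ` set (link i k) then w e * (2 * ?s) else 0) = (\<Sum>e\<in>fst ` set (link i k). w e * (2 * ?s))"
      using sub by (simp add: sum.inter_restrict[symmetric] Int_absorb1)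
    also have "\<dots> = (\<Sum>e\<in>fst ` set (link i k). w e) * (2 * ?s)" by (rule sum_distrib_right[symmetric])
    also have "\<dots> \<le> (4 * \<rho> * W (Suc i)) * (2 * ?s)"
      using link_weight[of i u] i u s0 by (intro mult_right_mono) auto
    also have "\<dots> = 16 * \<rho> * h * sum w (Ek i k)" using W_pos[of i] by (simp add: W_Suc)
    finally show "(\<Sum>e<length E. if e \<in> fst ` set (link i k) then w e * (2 * ?s) else 0) \<le> 16 * \<rho> * h * sum w (Ek i k)" .
  qed
  also have "\<dots> = (\<Sum>i<L. 16 * \<rho> * h * (\<Sum>k\<in>\<kappa> i ` {..<n}. sum w (Ek i k)))" by (simp add: sum_distrib_left)
  also have "\<dots> \<le> (\<Sum>i<L. 16 * \<rho> * h * (2 * wt))" by (intro sum_mono mult_left_mono class_weight) auto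
  also have "\<dots> = 32 * L * \<rho> * h * wt" by simp
  finally show ?thesis .
qed

end

section \<open>Existence of the clusters, and routings that are good for all edges\<close>

lemma power_ge_two_power:
  assumes "0 < m"
  shows "2 ^ l \<le> (1 + 1 / real m) ^ (m * l)"
proof -
  have "2 \<le> (1 + 1 / real m) ^ m"
    using Bernoulli_inequality[of "1 / real m" m] assms by (simp add: order_trans[of "-1" 0])
  then have "2 ^ l \<le> ((1 + 1 / real m) ^ m) ^ l" by (intro power_mono) auto
  then show ?thesis by (simp add: power_mult)
qed

lemma sum_UN_le:
  fixes f :: "'a \<Rightarrow> real"
  assumes "finite J" "\<And>j. j \<in> J \<Longrightarrow> finite (A j)" "\<And>j x. j \<in> J \<Longrightarrow> x \<in> A j \<Longrightarrow> 0 \<le> f x"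
  shows "sum f (\<Union>j\<in>J. A j) \<le> (\<Sum>j\<in>J. sum f (A j))"
  using assms
proof (induction J rule: finite_induct)
  case (insert j J)
  let ?U = "\<Union>j\<in>J. A j"
  have "0 \<le> sum f (A j \<inter> ?U)" using insert.prems(2) by (intro sum_nonneg) auto
  moreover have "sum f (A j \<union> ?U) + sum f (A j \<inter> ?U) = sum f (A j) + sum f ?U"
    using insert by (intro sum.union_inter) auto
  moreover have "sum f ?U \<le> (\<Sum>j\<in>J. sum f (A j))" using insert.prems by (intro insert.IH) auto
  ultimately show ?case using insert.hyps by simp
qed simp

text \<open>Each of \<open>L\<close> levels may lose the fraction \<open>1 / (24 * L)\<close> of the
  mass. With \<open>m = 24 * L\<close>, growing \<open>m * (l + 2)\<close> times by the factor
  \<open>1 + 1 / m\<close> multiplies a mass by at least \<open>2 ^ (l + 2) > 2 * n\<close>, more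
  than \<open>min\<close> permits. Two steps of \<open>N\<close> per growth step give the radius
  \<open>48 * L * (l + 2)\<close>.\<close>

lemma (in hop_metric) hop_clusters_exist:
  fixes \<nu> :: "nat \<Rightarrow> real"
  assumes pos: "\<And>v. v < n \<Longrightarrow> 0 < \<nu> v" and min: "\<And>v. v < n \<Longrightarrow> sum \<nu> {..<n} \<le> 2 * n * \<nu> v"
    and n: "n \<le> 2 ^ l" and L: "0 < L"
  shows "\<exists>c Z. hop_clusters n E h L w c Z (48 * L * (l + 2)) \<and> Z \<subseteq> {..<n} \<and> 24 * sum \<nu> Z \<le> sum \<nu> {..<n}"
proof -
  define m where "m = 24 * L"
  define R where "R = m * (l + 2) - 1"
  have SR: "Suc R = m * (l + 2)" using L by (simp add: R_def m_def)
  have growth: "sum \<nu> {..<n} < (1 + 1 / real m) ^ Suc R * \<nu> v" if "v \<in> {..<n}" for v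
  proof -
    have "real n \<le> 2 ^ l" using n by (metis of_nat_le_iff of_nat_numeral of_nat_power)
    moreover have "(2::real) ^ (l + 2) = 4 * 2 ^ l" by (simp add: power_add)
    moreover have "0 < (2::real) ^ l" by simp
    ultimately have "2 * real n < 2 ^ (l + 2)" by linarith
    also have "\<dots> \<le> (1 + 1 / real m) ^ Suc R" unfolding SR using L by (intro power_ge_two_power) (simp add: m_def)
    finally have "2 * n * \<nu> v < (1 + 1 / real m) ^ Suc R * \<nu> v" using pos that by (intro mult_strict_right_mono) auto
    then show ?thesis using min[of v] that by simp
  qed
  have "\<exists>c Z. Z \<subseteq> {..<n} \<and> (\<forall>v\<in>{..<n}. \<exists>j \<le> 2 * R + 1. (c v, v) \<in> N i ^^ j)
     \<and> (\<forall>v\<in>{..<n} - Z. \<forall>u\<in>{..<n}. (v, u) \<in> N i \<longrightarrow> c u = c v) \<and> sum \<nu> Z \<le> 1 / real m * sum \<nu> {..<n}" for i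
    using pos growth by (intro padded_decomposition sym_N refl_N) auto
  then obtain C ZZ where CZ: "\<And>i. ZZ i \<subseteq> {..<n}" "\<And>i v. v < n \<Longrightarrow> \<exists>j \<le> 2 * R + 1. (C i v, v) \<in> N i ^^ j"
     "\<And>i v u. v < n \<Longrightarrow> v \<notin> ZZ i \<Longrightarrow> u < n \<Longrightarrow> (v, u) \<in> N i \<Longrightarrow> C i u = C i v"
     "\<And>i. sum \<nu> (ZZ i) \<le> 1 / real m * sum \<nu> {..<n}"
    unfolding Ball_def lessThan_iff Diff_iff by metis
  \<comment> \<open>Level 0 uses singletons, which are padded by \<open>N_0\<close>; only the levels
    1 to \<open>L\<close> contribute to \<open>Z\<close>.\<close>
  define c where "c = (\<lambda>i u. if i = 0 then u else C i u)"
  define Z where "Z = (\<Union>i\<in>{1..L}. ZZ i)"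
  have "hop_clusters n E h L w c Z (48 * L * (l + 2))"
  proof
    fix i u assume u: "i \<le> L" "u < n"
    show "\<exists>ds. walk E (c i u) ds u \<and> len i ds \<le> real (2 * (48 * L * (l + 2)))"
    proof (cases "i = 0")
      case True
      then show ?thesis by (intro exI[of _ "[]"]) (simp add: c_def len_def)
    next
      case False
      obtain j ds where j: "j \<le> 2 * R + 1" "walk E (C i u) ds u" "len i ds \<le> 2 * j"
        using CZ(2)[OF u(2)] N_power by blast
      have "j \<le> 2 * Suc R" using j(1) by simp
      also have "\<dots> = 48 * L * (l + 2)" unfolding SR m_def by simp
      finally have "real j \<le> real (48 * L * (l + 2))" by (simp only: of_nat_le_iff)
      then have "len i ds \<le> real (2 * (48 * L * (l + 2)))" using j(3) unfolding of_nat_mult[of 2] by linarith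
      then show ?thesis using j False by (auto simp: c_def)
    qed
  next
    fix i u v assume "i \<le> L" "u < n" "u \<notin> Z" "v < n" "(u, v) \<in> N i"
    then show "c i v = c i u" using N_0 CZ(3)[of u i v] by (cases "i = 0") (auto simp: c_def Z_def)
  qed (simp add: c_def)
  moreover have "Z \<subseteq> {..<n}" using CZ(1) by (auto simp: Z_def)
  moreover have "24 * sum \<nu> Z \<le> sum \<nu> {..<n}"
  proof -
    have fZ: "finite (ZZ i)" for i using CZ(1) finite_subset by blast
    have nn: "0 \<le> \<nu> v" if "v \<in> ZZ i" for v i using CZ(1)[of i] pos[of v] that by force
    have "sum \<nu> Z \<le> (\<Sum>i\<in>{1..L}. sum \<nu> (ZZ i))" unfolding Z_def using fZ nn
      by (intro sum_UN_le) auto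
    also have "\<dots> \<le> (\<Sum>i\<in>{1..L}. 1 / real m * sum \<nu> {..<n})" using CZ(4) by (intro sum_mono) blast
    also have "\<dots> = sum \<nu> {..<n} / 24" using L by (simp add: m_def)
    finally show ?thesis by simp
  qed
  ultimately show ?thesis by blast
qed

text \<open>\<open>None\<close> marks the pairs that a routing does not serve.\<close>

type_synonym routing = "nat \<Rightarrow> nat \<Rightarrow> dedge list option"

definition uses :: "routing \<Rightarrow> pkt set \<Rightarrow> nat \<Rightarrow> pkt set" where
  "uses R S e = {p\<in>S. \<exists>ds. R (psrc p) (pdst p) = Some ds \<and> e \<in> fst ` set ds}"

definition short :: "(nat \<times> nat) list \<Rightarrow> nat \<Rightarrow> nat \<Rightarrow> nat \<Rightarrow> bool" where
  "short E h s t \<longleftrightarrow> (\<exists>ds. walk E s ds t \<and> distinct (nodes E s ds) \<and> length ds \<le> h)"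

definition simple_routing :: "(nat \<times> nat) list \<Rightarrow> nat \<Rightarrow> routing \<Rightarrow> bool" where
  "simple_routing E H R \<longleftrightarrow> (\<forall>s t ds. R s t = Some ds \<longrightarrow> walk E s ds t \<and> distinct (nodes E s ds) \<and> length ds \<le> H)"

text \<open>The given weights are arbitrary, but the clusters need a bounded spread. Adding the
  average to every weight provides it and merely doubles the totals, which turns 32 into 64 and 24
  into 12. That \<open>b\<close> is chosen before \<open>S\<close> is essential for taking maxima
  over demands.\<close>

lemma weighted_routing_exists:
  fixes \<alpha> \<beta> :: "nat \<Rightarrow> real"
  assumes G: "wf_graph n E" "E \<noteq> []" "0 < h" "0 < n" "n \<le> 2 ^ l" "4 * length E \<le> 2 ^ L" "0 < L"
    and pos: "\<forall>e<length E. 0 < \<alpha> e" "\<forall>v<n. 0 < \<beta> v"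
  defines "\<rho> \<equiv> 48 * L * (l + 2)"
  shows "\<exists>R Z (b :: nat \<Rightarrow> real). simple_routing E (8 * L * \<rho> * h) R \<and>
     (\<forall>s<n. \<forall>t<n. s \<notin> Z \<and> t \<notin> Z \<and> short E h s t \<longrightarrow> R s t \<noteq> None) \<and>
     (\<forall>S e. finite S \<and> routable E h S \<longrightarrow> card (uses R S e) \<le> b e) \<and>
     (\<Sum>e<length E. \<alpha> e * b e) \<le> 64 * L * \<rho> * h * sum \<alpha> {..<length E} \<and>
     Z \<subseteq> {..<n} \<and> 12 * sum \<beta> Z \<le> sum \<beta> {..<n}"
proof -
  define m where "m = length E"
  have m: "0 < m" using G(2) by (simp add: m_def)
  define w where "w = (\<lambda>e. \<alpha> e + sum \<alpha> {..<m} / m)"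
  define \<nu> where "\<nu> = (\<lambda>v. \<beta> v + sum \<beta> {..<n} / n)"
  have sw: "sum w {..<m} = 2 * sum \<alpha> {..<m}" using m by (simp add: w_def sum.distrib)
  have sn: "sum \<nu> {..<n} = 2 * sum \<beta> {..<n}" using G(4) by (simp add: \<nu>_def sum.distrib)
  have s0: "0 < sum \<alpha> {..<m}" "0 < sum \<beta> {..<n}" using pos m G(4) by (auto intro!: sum_pos simp: m_def)
  interpret hop_metric n E h L w
  proof
    fix e assume e: "e < length E"
    show "0 < w e" using pos(1)[rule_format, OF e] s0 m by (simp add: w_def add_pos_pos)
    have "4 * real m \<le> 2 ^ L" using G(6) unfolding m_def
      by (metis of_nat_le_iff of_nat_mult of_nat_numeral of_nat_power)
    then have "4 * real m * (sum \<alpha> {..<m} / m) \<le> 2 ^ L * w e"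
      using pos(1)[rule_format, OF e] s0 by (intro mult_mono) (auto simp: w_def)
    then show "2 * sum w {..<length E} \<le> 2 ^ L * w e" using sw m by (simp add: m_def)
  qed (use G in auto)
  have "0 < \<nu> v \<and> sum \<nu> {..<n} \<le> 2 * n * \<nu> v" if "v < n" for v
  proof
    show "0 < \<nu> v" using pos(2)[rule_format, OF that] s0 G(4) by (simp add: \<nu>_def add_pos_pos)
    have "2 * n * (sum \<beta> {..<n} / n) \<le> 2 * n * \<nu> v" using pos(2)[rule_format, OF that] by (intro mult_left_mono) (auto simp: \<nu>_def)
    then show "sum \<nu> {..<n} \<le> 2 * n * \<nu> v" using sn G(4) by simp
  qed
  then obtain c Z where cZ: "hop_clusters n E h L w c Z \<rho>" "Z \<subseteq> {..<n}" "24 * sum \<nu> Z \<le> sum \<nu> {..<n}"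
    using hop_clusters_exist[of \<nu> l] G unfolding \<rho>_def by blast
  interpret hop_clusters n E h L w c Z \<rho> by (rule cZ(1))
  have "simple_routing E (8 * L * \<rho> * h) route" unfolding simple_routing_def
    by (intro allI impI conjI) (rule route_Some, assumption)+
  moreover have "route s t \<noteq> None" if "s < n" "t < n" "s \<notin> Z" "t \<notin> Z" "short E h s t" for s t
    using that route_defined unfolding short_def by blast
  moreover have "card (uses route S e) \<le> load e" if "finite S" "routable E h S" for S e
    using load_bound[OF that] unfolding uses_def .
  moreover have "(\<Sum>e<length E. \<alpha> e * load e) \<le> 64 * L * \<rho> * h * sum \<alpha> {..<length E}"
  proof -
    have "(\<Sum>e<length E. \<alpha> e * load e) \<le> (\<Sum>e<length E. w e * load e)"
      using s0 load_nonneg by (intro sum_mono mult_right_mono) (auto simp: w_def)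
    also have "\<dots> \<le> 32 * L * \<rho> * h * wt" by (rule weighted_load)
    also have "\<dots> = 64 * L * \<rho> * h * sum \<alpha> {..<length E}" using sw by (simp add: wt_def m_def)
    finally show ?thesis .
  qed
  moreover have "12 * sum \<beta> Z \<le> sum \<beta> {..<n}"
  proof -
    have "sum \<beta> Z \<le> sum \<nu> Z" using s0 by (intro sum_mono) (auto simp: \<nu>_def)
    then show ?thesis using cZ(3) sn by simp
  qed
  ultimately show ?thesis using cZ(2) by (intro exI[of _ route] exI[of _ Z] exI[of _ load]) auto
qed

text \<open>Multiplicative weights over edges and nodes. An edge costs its worst load over all
  demands, divided by \<open>K\<close>; an unpadded node costs 12. As the average costs are at most
  3, an edge gets at most \<open>3 * K\<close> (192 is 3 times 64), and a node is unpadded in at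
  most a quarter of the routings, so a pair is lost in at most half of them.\<close>

lemma routing_family_exists:
  assumes G: "wf_graph n E" "E \<noteq> []" "0 < h" "0 < n" "n \<le> 2 ^ l" "4 * length E \<le> 2 ^ L" "0 < L" and U: "finite U"
  defines "\<rho> \<equiv> 48 * L * (l + 2)"
  shows "\<exists>Rs. Rs \<noteq> [] \<and> (\<forall>R\<in>set Rs. simple_routing E (8 * L * \<rho> * h) R) \<and>
     (\<forall>s<n. \<forall>t<n. short E h s t \<longrightarrow> length Rs \<le> 2 * length (filter (\<lambda>R. R s t \<noteq> None) Rs)) \<and>
     (\<forall>S e. S \<subseteq> U \<and> routable E h S \<and> e < length E \<longrightarrow> (\<Sum>R\<leftarrow>Rs. card (uses R S e)) \<le> 192 * L * \<rho> * h * length Rs)"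
proof -
  define K where "K = 64 * L * \<rho> * h"
  have K: "0 < K" using G by (simp add: K_def \<rho>_def)
  define fam where "fam = {S. S \<subseteq> U \<and> routable E h S}"
  have fam: "finite fam" "{} \<in> fam" using U by (auto simp: fam_def routable_def)
  define mx where "mx = (\<lambda>R e. Max ((\<lambda>S. card (uses R S e)) ` fam))"
  have mx: "card (uses R S e) \<le> mx R e" if "S \<in> fam" for R S e
    unfolding mx_def using fam that by (intro Max_ge) auto
  have mxU: "mx R e \<le> card U" for R e
    unfolding mx_def using fam U by (subst Max_le_iff) (auto simp: fam_def uses_def intro!: card_mono)
  define X where "X = {(R, Z). simple_routing E (8 * L * \<rho> * h) R \<and>
     (\<forall>s<n. \<forall>t<n. s \<notin> Z \<and> t \<notin> Z \<and> short E h s t \<longrightarrow> R s t \<noteq> None)}"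
  define cost :: "routing \<times> nat set \<Rightarrow> nat + nat \<Rightarrow> real" where
    "cost = (\<lambda>(R, Z) i. case i of Inl e \<Rightarrow> mx R e / K | Inr v \<Rightarrow> if v \<in> Z then 12 else 0)"
  define I :: "(nat + nat) set" where "I = {..<length E} <+> {..<n}"
  have sumI: "sum f I = (\<Sum>e<length E. f (Inl e)) + (\<Sum>v<n. f (Inr v))" for f :: "nat + nat \<Rightarrow> real"
    unfolding I_def by (simp add: sum.Plus)
  have "\<exists>xs. xs \<noteq> [] \<and> set xs \<subseteq> X \<and> (\<forall>i\<in>I. (\<Sum>x\<leftarrow>xs. cost x i) \<le> 3 * length xs)"
  proof (rule multiplicative_weights)
    show "finite I" by (simp add: I_def)
    show "0 < real (card U) + 12" by simp
    fix x i
    have "real (mx R e) / K \<le> card U" for R e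
    proof -
      have "real (mx R e) / K \<le> real (mx R e)" using K by (simp add: divide_le_eq mult_le_cancel_left1)
      then show ?thesis using mxU[of R e] by linarith
    qed
    then show "0 \<le> cost x i \<and> cost x i \<le> real (card U) + 12"
      by (auto simp: cost_def add_increasing2 split: prod.split sum.split)
  next
    fix w :: "nat + nat \<Rightarrow> real" assume w: "\<And>i. i \<in> I \<Longrightarrow> 0 < w i"
    have wpos: "\<forall>e<length E. 0 < w (Inl e)" "\<forall>v<n. 0 < w (Inr v)" using w by (auto simp: I_def)
    from weighted_routing_exists[OF G, of "\<lambda>e. w (Inl e)" "\<lambda>v. w (Inr v)", OF wpos]
    obtain R Z and b :: "nat \<Rightarrow> real" where R: "simple_routing E (8 * L * \<rho> * h) R"
     "\<forall>s<n. \<forall>t<n. s \<notin> Z \<and> t \<notin> Z \<and> short E h s t \<longrightarrow> R s t \<noteq> None"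
     "\<forall>S e. finite S \<and> routable E h S \<longrightarrow> card (uses R S e) \<le> b e"
     "(\<Sum>e<length E. w (Inl e) * b e) \<le> 64 * real L * real \<rho> * real h * (\<Sum>e<length E. w (Inl e))"
     "Z \<subseteq> {..<n}" "12 * (\<Sum>v\<in>Z. w (Inr v)) \<le> (\<Sum>v<n. w (Inr v))"
      unfolding \<rho>_def[symmetric] by (elim exE conjE) (rule that)
    \<comment> \<open>The maximum is attained by a single demand, to which the demand-independent
      bound \<open>b\<close> applies.\<close>
    have mxb: "mx R e \<le> b e" for e
    proof -
      have "mx R e \<in> (\<lambda>S. card (uses R S e)) ` fam" unfolding mx_def using fam by (intro Max_in) auto
      then obtain S where "S \<in> fam" "mx R e = card (uses R S e)" by blast
      then show ?thesis using R(3)[rule_format, of S e] U finite_subset[of S U] by (auto simp: fam_def)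
    qed
    have "(\<Sum>e<length E. w (Inl e) * (mx R e / K)) \<le> (\<Sum>e<length E. w (Inl e) * b e / K)"
    proof (intro sum_mono)
      fix e assume "e \<in> {..<length E}"
      then have "w (Inl e) * mx R e \<le> w (Inl e) * b e" using wpos(1) mxb[of e] by (intro mult_left_mono) (auto intro: less_imp_le)
      then show "w (Inl e) * (mx R e / K) \<le> w (Inl e) * b e / K" by (simp add: divide_right_mono)
    qed
    also have "\<dots> = (\<Sum>e<length E. w (Inl e) * b e) / K" by (simp add: sum_divide_distrib)
    also have "\<dots> \<le> (\<Sum>e<length E. w (Inl e))" using R(4) K
      by (simp add: divide_le_eq K_def mult.commute)
    finally have 1: "(\<Sum>e<length E. w (Inl e) * (mx R e / K)) \<le> (\<Sum>e<length E. w (Inl e))" .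
    have "(\<Sum>v<n. w (Inr v) * (if v \<in> Z then 12 else 0)) = (\<Sum>v<n. if v \<in> Z then 12 * w (Inr v) else 0)"
      by (intro sum.cong) auto
    also have "\<dots> = (\<Sum>v\<in>{..<n} \<inter> Z. 12 * w (Inr v))" by (rule sum.inter_restrict[symmetric]) simp
    also have "{..<n} \<inter> Z = Z" using R(5) by blast
    finally have 2: "(\<Sum>v<n. w (Inr v) * (if v \<in> Z then 12 else 0)) \<le> (\<Sum>v<n. w (Inr v))"
      using R(6) by (simp add: sum_distrib_left)
    have "(\<Sum>i\<in>I. w i * cost (R, Z) i) \<le> (\<Sum>i\<in>I. w i)" unfolding sumI using 1 2 by (simp add: cost_def)
    moreover have "(R, Z) \<in> X" using R(1,2) by (simp add: X_def)
    ultimately show "\<exists>x\<in>X. (\<Sum>i\<in>I. w i * cost x i) \<le> (\<Sum>i\<in>I. w i)" by blast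
  qed
  then obtain xs where xs: "xs \<noteq> []" "set xs \<subseteq> X" "\<And>i. i \<in> I \<Longrightarrow> (\<Sum>x\<leftarrow>xs. cost x i) \<le> 3 * length xs" by blast
  define Rs where "Rs = map fst xs"
  have "simple_routing E (8 * L * \<rho> * h) R" if "R \<in> set Rs" for R
    using that xs(2) by (auto simp: Rs_def X_def)
  moreover have "length Rs \<le> 2 * length (filter (\<lambda>R. R s t \<noteq> None) Rs)" if st: "s < n" "t < n" "short E h s t" for s t
  proof -
    have drop: "4 * length (filter (\<lambda>x. v \<in> snd x) xs) \<le> length xs" if "v < n" for v
    proof -
      have "(\<Sum>x\<leftarrow>xs. cost x (Inr v)) = 12 * length (filter (\<lambda>x. v \<in> snd x) xs)"
        by (induction xs) (auto simp: cost_def split: prod.split)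
      then have "12 * real (length (filter (\<lambda>x. v \<in> snd x) xs)) \<le> 3 * length xs" using xs(3)[of "Inr v"] that by (simp add: I_def InrI)
      then show ?thesis by linarith
    qed
    have "length xs \<le> length (filter (\<lambda>x. fst x s t \<noteq> None) xs) + length (filter (\<lambda>x. s \<in> snd x) xs) + length (filter (\<lambda>x. t \<in> snd x) xs)"
      using xs(2)
    proof (induction xs)
      case (Cons x xs)
      have "x \<in> X" using Cons.prems by simp
      then have "\<forall>s<n. \<forall>t<n. s \<notin> snd x \<and> t \<notin> snd x \<and> short E h s t \<longrightarrow> fst x s t \<noteq> None"
        unfolding X_def by (simp add: case_prod_unfold)
      then have "fst x s t \<noteq> None \<or> s \<in> snd x \<or> t \<in> snd x" using st by blast
      then show ?case using Cons by auto
    qed simp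
    then have "length xs \<le> 2 * length (filter (\<lambda>x. fst x s t \<noteq> None) xs)" using drop[of s] drop[of t] st by linarith
    then show ?thesis by (simp add: Rs_def filter_map comp_def)
  qed
  moreover have "(\<Sum>R\<leftarrow>Rs. card (uses R S e)) \<le> 192 * L * \<rho> * h * length Rs" if S: "S \<subseteq> U" "routable E h S" "e < length E" for S e
  proof -
    have "real (\<Sum>R\<leftarrow>Rs. card (uses R S e)) = (\<Sum>x\<leftarrow>xs. real (card (uses (fst x) S e)))"
      unfolding Rs_def by (induction xs) auto
    also have "\<dots> \<le> (\<Sum>x\<leftarrow>xs. K * cost x (Inl e))"
    proof (rule sum_list_mono)
      fix x :: "routing \<times> nat set"
      have "card (uses (fst x) S e) \<le> mx (fst x) e" using S by (intro mx) (simp add: fam_def)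
      then show "real (card (uses (fst x) S e)) \<le> K * cost x (Inl e)" using K by (auto simp: cost_def split: prod.split)
    qed
    also have "\<dots> = K * (\<Sum>x\<leftarrow>xs. cost x (Inl e))" by (rule sum_list_const_mult)
    also have "\<dots> \<le> real K * real (3 * length xs)" using xs(3)[of "Inl e"] S K by (intro mult_left_mono) (auto simp: I_def)
    finally have "real (\<Sum>R\<leftarrow>Rs. card (uses R S e)) \<le> real (K * 3 * length Rs)" by (simp add: Rs_def)
    then have "(\<Sum>R\<leftarrow>Rs. card (uses R S e)) \<le> K * 3 * length Rs" by (simp only: of_nat_le_iff)
    then show ?thesis by (simp add: K_def mult_ac)
  qed
  ultimately show ?thesis using xs(1) by (intro exI[of _ Rs]) (auto simp: Rs_def)
qed

section \<open>Random choices\<close>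

lemma sum_Pow_prod:
  fixes f :: "'a \<Rightarrow> real"
  assumes "finite T"
  shows "(\<Sum>A\<in>Pow T. \<Prod>p\<in>A. f p) = (\<Prod>p\<in>T. 1 + f p)"
  using prod_add[OF assms, of f "\<lambda>_. 1"] by (simp add: add.commute)

lemma prod_one_plus_le_exp:
  fixes f :: "'a \<Rightarrow> real"
  assumes "\<And>p. p \<in> T \<Longrightarrow> 0 \<le> f p"
  shows "(\<Prod>p\<in>T. 1 + f p) \<le> exp (\<Sum>p\<in>T. f p)"
proof (cases "finite T")
  case True
  have "(\<Prod>p\<in>T. 1 + f p) \<le> (\<Prod>p\<in>T. exp (f p))"
    using assms by (intro prod_mono) (auto simp: add_increasing)
  then show ?thesis using True by (simp add: exp_sum)
qed simp

text \<open>Replacing 64 by 128 gains more than \<open>2 ^ B\<close> on every set of more than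
  \<open>B\<close> elements. The sum over all subsets is at most \<open>exp (128 * \<mu>)\<close>,
  and \<open>exp x \<le> 1 + x * exp x\<close> keeps the excess over 1 proportional to
  \<open>\<mu>\<close>; this is needed because one such factor is taken for each of the many
  slots.\<close>

lemma large_subset_weight:
  fixes a :: "'a \<Rightarrow> real"
  assumes "finite T" "\<And>p. p \<in> T \<Longrightarrow> 0 \<le> a p" "(\<Sum>p\<in>T. a p) \<le> 1"
  shows "(\<Sum>A | A \<subseteq> T \<and> (A = {} \<or> B < card A). \<Prod>p\<in>A. 64 * a p)
     \<le> 1 + (128 * exp 128 / 2 ^ B) * (\<Sum>p\<in>T. a p)"
proof -
  define \<mu> where "\<mu> = (\<Sum>p\<in>T. a p)"
  have \<mu>: "0 \<le> \<mu>" "\<mu> \<le> 1" using assms by (auto simp: \<mu>_def intro: sum_nonneg)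
  define \<A> where "\<A> = {A. A \<subseteq> T \<and> B < card A}"
  have fin: "finite \<A>" "finite (Pow T)" using assms(1) by (auto simp: \<A>_def)
  have split: "{A. A \<subseteq> T \<and> (A = {} \<or> B < card A)} = insert {} \<A>" "{} \<notin> \<A>"
    by (auto simp: \<A>_def)
  have "(\<Sum>A\<in>\<A>. \<Prod>p\<in>A. 64 * a p) \<le> (\<Sum>A\<in>\<A>. (1 / 2 ^ B) * (\<Prod>p\<in>A. 128 * a p))"
  proof (intro sum_mono)
    fix A assume "A \<in> \<A>"
    then have A: "A \<subseteq> T" "B < card A" by (auto simp: \<A>_def)
    have nn: "0 \<le> (\<Prod>p\<in>A. 64 * a p)" using A assms(2) by (intro prod_nonneg) auto
    have "(\<Prod>p\<in>A. 128 * a p) = (\<Prod>p\<in>A. 2 * (64 * a p))" by simp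
    also have "\<dots> = 2 ^ card A * (\<Prod>p\<in>A. 64 * a p)" by (simp only: prod.distrib prod_constant)
    also have "\<dots> \<ge> 2 ^ B * (\<Prod>p\<in>A. 64 * a p)"
      using A nn by (intro mult_right_mono power_increasing) auto
    finally show "(\<Prod>p\<in>A. 64 * a p) \<le> (1 / 2 ^ B) * (\<Prod>p\<in>A. 128 * a p)"
      by (simp add: field_simps)
  qed
  also have "\<dots> = (1 / 2 ^ B) * (\<Sum>A\<in>\<A>. \<Prod>p\<in>A. 128 * a p)" by (simp add: sum_distrib_left)
  also have "\<dots> \<le> (1 / 2 ^ B) * (128 * exp 128 * \<mu>)"
  proof (intro mult_left_mono)
    have "(\<Sum>A\<in>\<A>. \<Prod>p\<in>A. 128 * a p) + 1 = (\<Sum>A\<in>insert {} \<A>. \<Prod>p\<in>A. 128 * a p)"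
      using fin split by simp
    also have "\<dots> \<le> (\<Sum>A\<in>Pow T. \<Prod>p\<in>A. 128 * a p)"
    proof (intro sum_mono2)
      show "insert {} \<A> \<subseteq> Pow T" by (auto simp: \<A>_def)
      fix A assume "A \<in> Pow T - insert {} \<A>"
      then show "0 \<le> (\<Prod>p\<in>A. 128 * a p)" using assms(2) by (intro prod_nonneg) auto
    qed (use fin in simp)
    also have "\<dots> = (\<Prod>p\<in>T. 1 + 128 * a p)" using assms(1) by (rule sum_Pow_prod)
    also have "\<dots> \<le> exp (\<Sum>p\<in>T. 128 * a p)" using assms(2) by (intro prod_one_plus_le_exp) auto
    also have "\<dots> = exp (128 * \<mu>)" by (simp add: \<mu>_def sum_distrib_left)
    also have "\<dots> \<le> 1 + (128 * \<mu>) * exp (128 * \<mu>)"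
    proof -
      have "exp (128 * \<mu>) * (1 - 128 * \<mu>) \<le> exp (128 * \<mu>) * exp (- (128 * \<mu>))"
        using exp_ge_add_one_self[of "- (128 * \<mu>)"] by (intro mult_left_mono) auto
      then show ?thesis by (simp add: algebra_simps exp_minus)
    qed
    also have "\<dots> \<le> 1 + (128 * \<mu>) * exp 128"
      using \<mu> by (intro add_left_mono mult_left_mono) auto
    finally show "(\<Sum>A\<in>\<A>. \<Prod>p\<in>A. 128 * a p) \<le> 128 * exp 128 * \<mu>" by (simp add: mult_ac)
  qed simp
  finally show ?thesis using split fin by (simp add: \<mu>_def)
qed

text \<open>The dropped packets form disjoint groups of more than \<open>B\<close> packets, each group passing through
  a common slot. The union bound over all such groupings \<open>g\<close> factorises over the slots.\<close>

lemma many_dropped_count: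
  fixes Opt :: "'p \<Rightarrow> 'o set" and pass :: "'p \<Rightarrow> 'o \<Rightarrow> 'f \<Rightarrow> bool" and n :: real
  defines "a \<equiv> \<lambda>p f. card {x \<in> Opt p. pass p x f} / card (Opt p)"
  assumes fin: "finite P" "finite F" "\<And>p. p \<in> P \<Longrightarrow> finite (Opt p) \<and> Opt p \<noteq> {}"
    and T: "T \<subseteq> P" "card T \<le> k"
    and load: "\<And>f. f \<in> F \<Longrightarrow> (\<Sum>p\<in>T. a p f) \<le> 1"
    and len: "\<And>p. p \<in> T \<Longrightarrow> (\<Sum>f\<in>F. a p f) \<le> n"
    and B: "128 * exp 128 * n \<le> 2 ^ B" and "0 \<le> n"
  shows "card {\<omega> \<in> PiE P Opt. \<exists>D g. D \<subseteq> T \<and> k < 2 * card D \<and> g ` D \<subseteq> F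
      \<and> (\<forall>f\<in>g ` D. B < card {p\<in>D. g p = f}) \<and> (\<forall>p\<in>D. pass p (\<omega> p) (g p))}
     \<le> card (PiE P Opt) / 2 ^ k" (is "real (card ?Bad) \<le> _")
proof -
  have fT: "finite T" using T fin(1) finite_subset by blast
  have a0: "0 \<le> a p f" for p f by (simp add: a_def)
  define \<A> where "\<A> = {A. A \<subseteq> T \<and> (A = {} \<or> B < card A)}"
  have f\<A>: "finite \<A>" using fT by (auto simp: \<A>_def)
  define G where "G = {G \<in> PiE F (\<lambda>_. \<A>). disjoint_family_on G F \<and> k < 2 * (\<Sum>f\<in>F. card (G f))}"
  have fPiF: "finite (PiE F (\<lambda>_. \<A>))" using fin f\<A> by (intro finite_PiE) auto
  have fG: "finite G" unfolding G_def using fPiF by simp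
  define ev where "ev = (\<lambda>G. {\<omega> \<in> PiE P Opt. \<forall>f\<in>F. \<forall>p\<in>G f. pass p (\<omega> p) f})"
  have fPi: "finite (PiE P Opt)" using fin by (intro finite_PiE) auto
  have sub: "?Bad \<subseteq> (\<Union>H\<in>G. ev H)"
  proof
    fix \<omega> assume "\<omega> \<in> ?Bad"
    note \<omega>_bad = CollectD[OF this]
    note \<omega> = conjunct1[OF \<omega>_bad]
    obtain D g where D: "D \<subseteq> T" "k < 2 * card D" "g ` D \<subseteq> F"
      "\<forall>f\<in>g ` D. B < card {p\<in>D. g p = f}" "\<forall>p\<in>D. pass p (\<omega> p) (g p)"
      using conjunct2[OF \<omega>_bad] by (elim exE conjE) (rule that)
    have fD: "finite D" using D fT finite_subset by blast
    \<comment> \<open>The fibres of \<open>g\<close>; slots where nothing was dropped get the empty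
      set, which \<open>\<A>\<close> admits.\<close>
    define H where "H = (\<lambda>f\<in>F. {p\<in>D. g p = f})"
    have "H \<in> PiE F (\<lambda>_. \<A>)"
    proof (rule PiE_I)
      fix f assume f: "f \<in> F"
      show "H f \<in> \<A>"
      proof (cases "f \<in> g ` D")
        case True
        then show ?thesis using D(1,4) f by (auto simp: H_def \<A>_def)
      next
        case False
        then show ?thesis using f D(1) by (auto simp: H_def \<A>_def)
      qed
    qed (simp add: H_def)
    moreover have "disjoint_family_on H F" by (auto simp: H_def disjoint_family_on_def)
    moreover have "(\<Sum>f\<in>F. card (H f)) = card D"
    proof -
      have "card D = (\<Sum>f\<in>F. card {p\<in>D. g p = f})"
        using sum.group[OF fD fin(2) D(3), of "\<lambda>_. 1::nat"] by simp
      then show ?thesis by (simp add: H_def)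
    qed
    ultimately have "H \<in> G" using D(2) by (simp add: G_def)
    moreover have "\<omega> \<in> ev H" using \<omega> D(5) by (auto simp: ev_def H_def)
    ultimately show "\<omega> \<in> (\<Union>H\<in>G. ev H)" by blast
  qed
  \<comment> \<open>Disjoint groups concern different packets, whose choices are independent; each
    packet is constrained by at most one slot.\<close>
  have ev: "card (ev H) = card (PiE P Opt) * (\<Prod>f\<in>F. \<Prod>p\<in>H f. a p f)" if "H \<in> G" for H
  proof -
    have H: "H f \<subseteq> T" if "f \<in> F" for f
      using PiE_mem[of H F "\<lambda>_. \<A>" f] that \<open>H \<in> G\<close> by (auto simp: G_def \<A>_def)
    have disj: "disjoint_family_on H F" using that by (simp add: G_def)
    have UH: "(\<Union>f\<in>F. H f) \<subseteq> P" using H T(1) by blast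
    define Opt' where "Opt' = (\<lambda>p. {x \<in> Opt p. \<forall>f\<in>F. p \<in> H f \<longrightarrow> pass p x f})"
    define r where "r = (\<lambda>p. real (card (Opt' p)) / card (Opt p))"
    have "ev H = PiE P Opt'"
    proof (intro set_eqI iffI)
      fix \<omega> assume "\<omega> \<in> ev H"
      then show "\<omega> \<in> PiE P Opt'" by (auto simp: ev_def Opt'_def PiE_iff)
    next
      fix \<omega> assume \<omega>: "\<omega> \<in> PiE P Opt'"
      have "pass p (\<omega> p) f" if "f \<in> F" "p \<in> H f" for f p
      proof -
        have "p \<in> P" using H that T(1) by blast
        then show ?thesis using \<omega> that by (auto simp: Opt'_def dest: PiE_mem)
      qed
      then show "\<omega> \<in> ev H" using \<omega> by (auto simp: ev_def Opt'_def PiE_iff)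
    qed
    then have "real (card (ev H)) = (\<Prod>p\<in>P. real (card (Opt' p)))" using fin by (simp add: card_PiE)
    also have "\<dots> = (\<Prod>p\<in>P. card (Opt p) * r p)"
      using fin(3) by (intro prod.cong) (auto simp: r_def)
    also have "\<dots> = card (PiE P Opt) * (\<Prod>p\<in>P. r p)"
      using fin by (simp add: card_PiE prod.distrib)
    also have "(\<Prod>p\<in>P. r p) = (\<Prod>p\<in>(\<Union>f\<in>F. H f). r p)"
    proof (rule prod.mono_neutral_right)
      show "\<forall>p\<in>P - (\<Union>f\<in>F. H f). r p = 1"
      proof
        fix p assume p: "p \<in> P - (\<Union>f\<in>F. H f)"
        then have "Opt' p = Opt p" by (auto simp: Opt'_def)
        then show "r p = 1" using fin(3)[of p] p by (auto simp: r_def)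
      qed
    qed (use fin(1) UH in auto)
    also have "\<dots> = (\<Prod>f\<in>F. \<Prod>p\<in>H f. r p)"
    proof (intro prod.UNION_disjoint fin(2) ballI impI)
      show "finite (H f)" if "f \<in> F" for f using H[OF that] fT by (rule finite_subset)
      show "H f \<inter> H f' = {}" if "f \<in> F" "f' \<in> F" "f \<noteq> f'" for f f'
        using disj that by (simp add: disjoint_family_on_def)
    qed
    also have "\<dots> = (\<Prod>f\<in>F. \<Prod>p\<in>H f. a p f)"
    proof (intro prod.cong refl)
      fix f p assume fp: "f \<in> F" "p \<in> H f"
      then have "f' = f" if "f' \<in> F" "p \<in> H f'" for f'
        using that disj by (auto simp: disjoint_family_on_def)
      then have "(\<forall>f'\<in>F. p \<in> H f' \<longrightarrow> pass p x f') \<longleftrightarrow> pass p x f" for x using fp by metis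
      then have "Opt' p = {x \<in> Opt p. pass p x f}" unfolding Opt'_def by simp
      then show "r p = a p f" by (simp add: r_def a_def)
    qed
    finally show ?thesis .
  qed
  have "real (card ?Bad) \<le> real (card (\<Union>H\<in>G. ev H))"
    using sub fG fPi by (intro of_nat_mono card_mono finite_UN_I) (auto simp: ev_def)
  also have "\<dots> \<le> (\<Sum>H\<in>G. real (card (ev H)))"
    unfolding of_nat_sum[symmetric] by (intro of_nat_mono card_UN_le fG)
  also have "\<dots> = card (PiE P Opt) * (\<Sum>H\<in>G. \<Prod>f\<in>F. \<Prod>p\<in>H f. a p f)"
    by (simp add: ev sum_distrib_left)
  \<comment> \<open>More than \<open>k / 2\<close> grouped packets, each weighted by 64, gain
    \<open>64^(k/2) = 8^k\<close>. The relaxed sum below costs only \<open>exp k \<le> 4^k\<close>,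
    so \<open>2^-k\<close> remains.\<close>
  also have "\<dots> \<le> card (PiE P Opt) * ((1 / 8 ^ k) * 4 ^ k)"
  proof (intro mult_left_mono)
    have "(\<Sum>H\<in>G. \<Prod>f\<in>F. \<Prod>p\<in>H f. a p f) \<le> (\<Sum>H\<in>G. (1 / 8 ^ k) * (\<Prod>f\<in>F. \<Prod>p\<in>H f. 64 * a p f))"
    proof (intro sum_mono)
      fix H assume "H \<in> G"
      then have H: "k < 2 * (\<Sum>f\<in>F. card (H f))" by (simp add: G_def)
      define x where "x = (\<Prod>f\<in>F. \<Prod>p\<in>H f. a p f)"
      have x: "0 \<le> x" unfolding x_def by (intro prod_nonneg a0 ballI)
      have "(\<Prod>f\<in>F. \<Prod>p\<in>H f. 64 * a p f) = (\<Prod>f\<in>F. 64 ^ card (H f)) * x"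
        by (simp add: prod.distrib x_def)
      also have "(\<Prod>f\<in>F. 64 ^ card (H f)) = (64::real) ^ (\<Sum>f\<in>F. card (H f))"
        by (rule power_sum[symmetric])
      also have "\<dots> = 8 ^ (2 * (\<Sum>f\<in>F. card (H f)))" by (simp add: power_mult)
      finally have "8 ^ k * x \<le> (\<Prod>f\<in>F. \<Prod>p\<in>H f. 64 * a p f)"
        using H x by (simp add: mult_right_mono power_increasing)
      then show "x \<le> (1 / 8 ^ k) * (\<Prod>f\<in>F. \<Prod>p\<in>H f. 64 * a p f)" by (simp add: field_simps)
    qed
    also have "\<dots> = (1 / 8 ^ k) * (\<Sum>H\<in>G. \<Prod>f\<in>F. \<Prod>p\<in>H f. 64 * a p f)" by (simp add: sum_distrib_left)
    also have "\<dots> \<le> (1 / 8 ^ k) * 4 ^ k"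
    proof (intro mult_left_mono)
      \<comment> \<open>Forgetting disjointness and total size makes the groups of different slots
        independent, so that the sum of products becomes a product of sums.\<close>
      have "(\<Sum>H\<in>G. \<Prod>f\<in>F. \<Prod>p\<in>H f. 64 * a p f) \<le> (\<Sum>H\<in>PiE F (\<lambda>_. \<A>). \<Prod>f\<in>F. \<Prod>p\<in>H f. 64 * a p f)"
        using fPiF a0 by (intro sum_mono2) (auto simp: G_def intro!: prod_nonneg)
      also have "\<dots> = (\<Prod>f\<in>F. \<Sum>A\<in>\<A>. \<Prod>p\<in>A. 64 * a p f)"
        using prod_sum_PiE[OF fin(2), of "\<lambda>_. \<A>" "\<lambda>f A. \<Prod>p\<in>A. 64 * a p f"] f\<A> by simp
      also have "\<dots> \<le> (\<Prod>f\<in>F. 1 + (128 * exp 128 / 2 ^ B) * (\<Sum>p\<in>T. a p f))"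
        using a0 load fT unfolding \<A>_def
        by (intro prod_mono conjI large_subset_weight sum_nonneg prod_nonneg) auto
      also have "\<dots> \<le> exp (\<Sum>f\<in>F. (128 * exp 128 / 2 ^ B) * (\<Sum>p\<in>T. a p f))"
        using a0 by (intro prod_one_plus_le_exp mult_nonneg_nonneg sum_nonneg) auto
      also have "(\<Sum>f\<in>F. (128 * exp 128 / 2 ^ B) * (\<Sum>p\<in>T. a p f))
          = (128 * exp 128 / 2 ^ B) * (\<Sum>p\<in>T. \<Sum>f\<in>F. a p f)"
        by (subst sum.swap) (simp add: sum_distrib_left)
      also have "exp \<dots> \<le> exp ((128 * exp 128 / 2 ^ B) * (k * n))"
      proof -
        have "(\<Sum>p\<in>T. \<Sum>f\<in>F. a p f) \<le> (\<Sum>p\<in>T. n)" using len by (intro sum_mono)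
        also have "\<dots> \<le> k * n" using T(2) \<open>0 \<le> n\<close> by (simp add: mult_right_mono)
        finally show ?thesis by (simp add: mult_left_mono divide_right_mono)
      qed
      also have "\<dots> \<le> exp (real k)"
      proof -
        have "(128 * exp 128 / 2 ^ B) * (k * n) = k * ((128 * exp 128 * n) / 2 ^ B)" by simp
        also have "\<dots> \<le> real k * 1" using B by (intro mult_left_mono) auto
        finally show ?thesis by simp
      qed
      also have "\<dots> \<le> 4 ^ k"
        using exp_of_nat_mult[of k "1::real"] exp_le by (simp add: power_mono)
      finally show "(\<Sum>H\<in>G. \<Prod>f\<in>F. \<Prod>p\<in>H f. 64 * a p f) \<le> 4 ^ k" .
    qed simp
    finally show "(\<Sum>H\<in>G. \<Prod>f\<in>F. \<Prod>p\<in>H f. a p f) \<le> (1 / 8 ^ k) * 4 ^ k" .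
  qed simp
  also have "(1 / 8 ^ k) * 4 ^ k = (1 / 2 ^ k :: real)"
    by (simp add: field_simps flip: power_mult_distrib)
  finally show ?thesis by simp
qed

text \<open>Method of conditional expectations: \<open>S\<close> is bad as long as more than half of it survives, and it
  is weighted by \<open>(2^i / 2N)^|S|\<close> after \<open>i\<close> steps.\<close>

lemma halving_sequence_exists:
  fixes \<Phi> :: "'w \<Rightarrow> 'p set \<Rightarrow> 'p set"
  assumes "finite \<Omega>" "\<Omega> \<noteq> {}" "finite U" "\<S> \<subseteq> Pow U"
    and sub: "\<And>\<omega> T. \<Phi> \<omega> T \<subseteq> T"
    and closed: "\<And>S T. S \<in> \<S> \<Longrightarrow> T \<subseteq> S \<Longrightarrow> T \<in> \<S>"
    and tail: "\<And>T k. T \<in> \<S> \<Longrightarrow> card T \<le> k \<Longrightarrow> card {\<omega>\<in>\<Omega>. k < 2 * card (\<Phi> \<omega> T)} \<le> card \<Omega> / 2 ^ k"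
    and r: "2 * card U \<le> 2 ^ r"
  shows "\<exists>\<omega>s. length \<omega>s = r \<and> set \<omega>s \<subseteq> \<Omega> \<and> (\<forall>S\<in>\<S>. 2 * card (fold \<Phi> \<omega>s S) \<le> card S)"
proof (cases "U = {}")
  case True
  obtain \<omega> where "\<omega> \<in> \<Omega>" using assms(2) by blast
  have "fold \<Phi> \<omega>s {} = {}" for \<omega>s
  proof (induction \<omega>s)
    case (Cons \<omega> \<omega>s) then show ?case using sub[of \<omega> "{}"] by simp
  qed simp
  moreover have "S = {}" if "S \<in> \<S>" for S using True assms(4) that by blast
  ultimately have "2 * card (fold \<Phi> \<omega>s S) \<le> card S" if "S \<in> \<S>" for \<omega>s S using that by fastforce
  then show ?thesis using \<open>\<omega> \<in> \<Omega>\<close> by (intro exI[of _ "replicate r \<omega>"]) (auto simp del: fold_replicate)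
next
  case False
  define N where "N = real (card U)"
  have N: "N \<ge> 1" using False assms(3) by (simp add: N_def Suc_le_eq card_gt_0_iff)
  define wt where "wt = (\<lambda>i (S :: 'p set). (2 ^ i / (2 * N)) ^ card S)"
  have wt0: "0 \<le> wt i S" for i S using N by (simp add: wt_def)
  have f\<S>: "finite \<S>" using assms(3,4) finite_subset by blast
  define bad where "bad = (\<lambda>\<omega>s. {S\<in>\<S>. card S < 2 * card (fold \<Phi> \<omega>s S)})"
  have fbad: "finite (bad \<omega>s)" for \<omega>s using f\<S> by (simp add: bad_def)
  have fsub: "fold \<Phi> \<omega>s S \<subseteq> S" for \<omega>s S
  proof (induction \<omega>s arbitrary: S)
    case (Cons \<omega> \<omega>s) then show ?case using sub[of \<omega> S] by fastforce
  qed simp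
  have "\<exists>\<omega>s. length \<omega>s = i \<and> set \<omega>s \<subseteq> \<Omega> \<and> (\<Sum>S\<in>bad \<omega>s. wt i S) < 1" for i
  proof (induction i)
    case 0
    \<comment> \<open>The empty set is never bad, and the nonempty subsets of \<open>U\<close> weigh
      \<open>(1 + 1 / (2 * N)) ^ N - 1\<close>, which is below
      \<open>exp (1/2) - 1 < 1\<close>.\<close>
    have "(\<Sum>S\<in>bad []. wt 0 S) \<le> (\<Sum>S\<in>Pow U - {{}}. wt 0 S)"
      using assms(3,4) wt0 by (intro sum_mono2) (auto simp: bad_def)
    also have "\<dots> = (\<Sum>S\<in>Pow U. \<Prod>p\<in>S. 1 / (2 * N)) - 1"
      using assms(3) by (subst sum_diff1) (auto simp: wt_def)
    also have "(\<Sum>S\<in>Pow U. \<Prod>p\<in>S. 1 / (2 * N)) = (\<Prod>p\<in>U. 1 + 1 / (2 * N))"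
      using assms(3) by (rule sum_Pow_prod)
    also have "\<dots> \<le> exp (\<Sum>p\<in>U. 1 / (2 * N))" using N by (intro prod_one_plus_le_exp) auto
    also have "(\<Sum>p\<in>U. 1 / (2 * N)) = 1 / 2" using N by (simp add: N_def)
    also have "exp (1 / 2 :: real) < 2"
    proof -
      have "exp (1 / 2 :: real) ^ 2 = exp 1" by (simp add: exp_of_nat_mult[symmetric])
      also have "\<dots> < 2 ^ 2" using exp_le by simp
      finally show ?thesis by (rule power_less_imp_less_base) simp
    qed
    finally show ?case by (intro exI[of _ "[]"]) simp
  next
    case (Suc i)
    then obtain \<omega>s where \<omega>s: "length \<omega>s = i" "set \<omega>s \<subseteq> \<Omega>" "(\<Sum>S\<in>bad \<omega>s. wt i S) < 1" by blast
    define X where "X = (\<lambda>\<omega>. {S \<in> bad \<omega>s. card S < 2 * card (\<Phi> \<omega> (fold \<Phi> \<omega>s S))})"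
    \<comment> \<open>Survivors only decrease, so a set that is bad after one more choice was bad
      before.\<close>
    have badX: "bad (\<omega>s @ [\<omega>]) \<subseteq> X \<omega>" for \<omega>
    proof
      fix S assume S: "S \<in> bad (\<omega>s @ [\<omega>])"
      then have "S \<in> \<S>" "card S < 2 * card (\<Phi> \<omega> (fold \<Phi> \<omega>s S))" by (auto simp: bad_def)
      moreover have "finite (fold \<Phi> \<omega>s S)"
        using fsub \<open>S \<in> \<S>\<close> assms(3,4) by (meson PowD finite_subset subsetD)
      then have "card (\<Phi> \<omega> (fold \<Phi> \<omega>s S)) \<le> card (fold \<Phi> \<omega>s S)" using sub by (intro card_mono)
      ultimately show "S \<in> X \<omega>" by (auto simp: X_def bad_def)
    qed
    have fX: "finite (X \<omega>)" for \<omega> using fbad by (simp add: X_def)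
    have "(\<Sum>\<omega>\<in>\<Omega>. \<Sum>S\<in>X \<omega>. wt (Suc i) S) = (\<Sum>\<omega>\<in>\<Omega>. \<Sum>S\<in>bad \<omega>s. if card S < 2 * card (\<Phi> \<omega> (fold \<Phi> \<omega>s S)) then wt (Suc i) S else 0)"
      unfolding X_def using fbad by (intro sum.cong refl sum.inter_filter) auto
    also have "\<dots> = (\<Sum>S\<in>bad \<omega>s. \<Sum>\<omega>\<in>\<Omega>. if card S < 2 * card (\<Phi> \<omega> (fold \<Phi> \<omega>s S)) then wt (Suc i) S else 0)"
      by (rule sum.swap)
    also have "\<dots> = (\<Sum>S\<in>bad \<omega>s. wt (Suc i) S * card {\<omega>\<in>\<Omega>. card S < 2 * card (\<Phi> \<omega> (fold \<Phi> \<omega>s S))})"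
      using assms(1) by (intro sum.cong refl) (simp flip: sum.inter_filter)
    also have "\<dots> \<le> (\<Sum>S\<in>bad \<omega>s. wt i S * card \<Omega>)"
    proof (intro sum_mono)
      fix S assume "S \<in> bad \<omega>s"
      then have S: "S \<in> \<S>" by (simp add: bad_def)
      have "finite S" using S assms(3,4) finite_subset by blast
      \<comment> \<open>The tail bound is applied to the survivors of \<open>S\<close> but with
        \<open>k = card S\<close>; the gain \<open>2 ^ card S\<close> is exactly the growth of the
        weight in this step.\<close>
      then have "card {\<omega>\<in>\<Omega>. card S < 2 * card (\<Phi> \<omega> (fold \<Phi> \<omega>s S))} \<le> card \<Omega> / 2 ^ card S"
        using closed[OF S fsub] fsub by (intro tail card_mono)
      then have "wt (Suc i) S * card {\<omega>\<in>\<Omega>. card S < 2 * card (\<Phi> \<omega> (fold \<Phi> \<omega>s S))} \<le> wt (Suc i) S * (card \<Omega> / 2 ^ card S)"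
        using wt0 by (intro mult_left_mono) auto
      also have "\<dots> = wt i S * card \<Omega>" by (simp add: wt_def power_mult_distrib power_divide)
      finally show "wt (Suc i) S * card {\<omega>\<in>\<Omega>. card S < 2 * card (\<Phi> \<omega> (fold \<Phi> \<omega>s S))} \<le> wt i S * card \<Omega>" .
    qed
    also have "\<dots> = (\<Sum>S\<in>bad \<omega>s. wt i S) * card \<Omega>" by (simp add: sum_distrib_right)
    also have "\<dots> < 1 * real (card \<Omega>)"
      using \<omega>s(3) assms(1,2) by (intro mult_strict_right_mono) (auto simp: card_gt_0_iff)
    finally have "\<exists>\<omega>\<in>\<Omega>. (\<Sum>S\<in>X \<omega>. wt (Suc i) S) < 1"
      using sum_mono[of \<Omega> "\<lambda>_. 1" "\<lambda>\<omega>. \<Sum>S\<in>X \<omega>. wt (Suc i) S"] by fastforce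
    then obtain \<omega> where \<omega>: "\<omega> \<in> \<Omega>" "(\<Sum>S\<in>X \<omega>. wt (Suc i) S) < 1" by blast
    have "(\<Sum>S\<in>bad (\<omega>s @ [\<omega>]). wt (Suc i) S) \<le> (\<Sum>S\<in>X \<omega>. wt (Suc i) S)"
      using badX fX wt0 by (intro sum_mono2) auto
    then show ?case using \<omega> \<omega>s by (intro exI[of _ "\<omega>s @ [\<omega>]"]) auto
  qed
  then obtain \<omega>s where \<omega>s: "length \<omega>s = r" "set \<omega>s \<subseteq> \<Omega>" "(\<Sum>S\<in>bad \<omega>s. wt r S) < 1" by blast
  have "bad \<omega>s = {}"
  proof (rule ccontr)
    assume "bad \<omega>s \<noteq> {}"
    then obtain S where S: "S \<in> bad \<omega>s" by blast
    \<comment> \<open>By now every weight is at least 1, so a single bad set contradicts the total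
      weight below 1.\<close>
    have "2 * N \<le> 2 ^ r" using r unfolding N_def by (metis of_nat_le_iff of_nat_mult of_nat_numeral of_nat_power)
    then have "1 \<le> wt r S" using N by (simp add: wt_def one_le_power)
    also have "\<dots> \<le> (\<Sum>S\<in>bad \<omega>s. wt r S)" using S fbad wt0 by (intro member_le_sum) auto
    finally show False using \<omega>s(3) by simp
  qed
  then have "2 * card (fold \<Phi> \<omega>s S) \<le> card S" if "S \<in> \<S>" for S
  proof -
    have "S \<notin> bad \<omega>s" using \<open>bad \<omega>s = {}\<close> by simp
    then show ?thesis using that by (simp add: bad_def)
  qed
  then show ?thesis using \<omega>s by blast
qed

section \<open>Supersteps\<close>

declare split_paired_Ex [simp del] split_paired_All [simp del]

type_synonym wish = "pkt \<Rightarrow> dedge option"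

definition group :: "(nat \<times> nat) list \<Rightarrow> wish \<Rightarrow> (pkt \<Rightarrow> nat) \<Rightarrow> dedge \<Rightarrow> pkt set" where
  "group E w loc d = {q. loc q \<noteq> pdst q \<and> w q = Some d \<and> loc q = dtail E d}"

definition sstep :: "(nat \<times> nat) list \<Rightarrow> nat \<Rightarrow> wish \<Rightarrow> (pkt \<Rightarrow> nat) \<Rightarrow> (pkt \<Rightarrow> nat)" where
  "sstep E B w loc p = (case w p of None \<Rightarrow> loc p
     | Some d \<Rightarrow> if p \<in> group E w loc d \<and> card (group E w loc d) \<le> B then dhead E d else loc p)"

text \<open>Without self-loops a packet that has moved is no longer at the tail of its edge and
  cannot rejoin its group in the same superstep.\<close>

definition proper_wish :: "(nat \<times> nat) list \<Rightarrow> wish \<Rightarrow> bool" where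
  "proper_wish E w \<longleftrightarrow> (\<forall>p d. w p = Some d \<longrightarrow> fst d < length E \<and> dtail E d \<noteq> dhead E d)"

text \<open>An overfull group stays overfull during the whole superstep, because none of its packets
  moves; so the table recognises it without memory.\<close>

definition table :: "(nat \<times> nat) list \<Rightarrow> nat \<Rightarrow> wish list \<Rightarrow> rtable" where
  "table E B ws t v S p = (if t div B < length ws then
     (case (ws ! (t div B)) p of None \<Rightarrow> None
      | Some d \<Rightarrow> let Q = {q\<in>S. (ws ! (t div B)) q = Some d} in
          if fst d < length E \<and> dtail E d = v \<and> p \<in> Q \<and> card Q \<le> B \<and> p = (SOME q. q \<in> Q) then Some d else None)
     else None)"

lemma valid_table: "valid_table n E (table E B ws)"
  unfolding valid_table_def
proof (intro allI impI conjI)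
  fix t v S p d assume "table E B ws t v S p = Some d"
  then show "p \<in> S" "fst d < length E" "dtail E d = v"
    by (auto simp: table_def Let_def split: if_splits option.splits)
next
  fix t v S
  show "inj_on (table E B ws t v S) {p. table E B ws t v S p \<noteq> None}"
  proof (rule inj_onI)
    fix p q assume "p \<in> {p. table E B ws t v S p \<noteq> None}" "table E B ws t v S p = table E B ws t v S q"
    then obtain d where d: "table E B ws t v S p = Some d" "table E B ws t v S q = Some d" by auto
    have choice: "p = (SOME q. q \<in> {q\<in>S. (ws ! (t div B)) q = Some d})" if "table E B ws t v S p = Some d" for p
      using that unfolding table_def Let_def by (auto split: if_splits option.splits)
    show "p = q" using choice[OF d(1)] choice[OF d(2)] by (rule trans[OF _ sym])
  qed
qed

lemma superstep_run:
  assumes fin: "finite P" and proper: "proper_wish E (ws ! \<sigma>)" and \<sigma>: "\<sigma> < length ws" and B: "0 < B"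
    and start: "\<And>p. p \<in> P \<Longrightarrow> run E (table E B ws) P (B * \<sigma>) p = loc p"
    and out: "\<And>p. p \<notin> P \<Longrightarrow> loc p = pdst p"
    and p: "p \<in> P"
  shows "run E (table E B ws) P (B * Suc \<sigma>) p = sstep E B (ws ! \<sigma>) loc p"
proof -
  define w where "w = ws ! \<sigma>"
  define G where "G = group E w loc"
  have GP: "G d \<subseteq> P" for d using out by (auto simp: G_def group_def)
  have fG: "finite (G d)" for d using GP fin finite_subset by blast
  define A where "A = table E B ws"
  define good where "good = {p. \<exists>d. w p = Some d \<and> p \<in> G d \<and> card (G d) \<le> B}"
  define mv where "mv = (\<lambda>M p. if p \<in> M then dhead E (the (w p)) else loc p)"
  \<comment> \<open>\<open>M\<close> is the set of packets moved so far: after \<open>j\<close>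
    steps at least \<open>j\<close> members of every small group, or all of them, and none of an
    overfull one.\<close>
  have "\<exists>M. M \<subseteq> good \<and> (\<forall>p\<in>P. run E A P (B * \<sigma> + j) p = mv M p) \<and>
      (\<forall>d. card (G d) \<le> B \<longrightarrow> card (G d - M) \<le> card (G d) - j)" if "j \<le> B" for j
    using that
  proof (induction j)
    case 0
    then show ?case using start by (intro exI[of _ "{}"]) (auto simp: mv_def A_def)
  next
    case (Suc j)
    then obtain M where M: "M \<subseteq> good" "\<And>p. p \<in> P \<Longrightarrow> run E A P (B * \<sigma> + j) p = mv M p"
      "\<And>d. card (G d) \<le> B \<Longrightarrow> card (G d - M) \<le> card (G d) - j" by auto
    have div: "(B * \<sigma> + j) div B = \<sigma>" using Suc.prems by simp
    have at: "{q \<in> at_node P (run E A P (B * \<sigma> + j)) (dtail E d). w q = Some d} = G d - M" for d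
    proof (intro set_eqI iffI)
      fix q assume q: "q \<in> {q \<in> at_node P (run E A P (B * \<sigma> + j)) (dtail E d). w q = Some d}"
      then have q: "q \<in> P" "w q = Some d" "mv M q = dtail E d" "mv M q \<noteq> pdst q"
        using M(2)[of q] by (auto simp: at_node_def)
      have "dtail E d \<noteq> dhead E d" using q(2) proper unfolding proper_wish_def w_def by blast
      then have "q \<notin> M" using q by (auto simp: mv_def)
      then show "q \<in> G d - M" using q by (auto simp: mv_def G_def group_def)
    next
      fix q assume q: "q \<in> G d - M"
      then show "q \<in> {q \<in> at_node P (run E A P (B * \<sigma> + j)) (dtail E d). w q = Some d}"
        using M(2)[of q] GP[of d] by (auto simp: at_node_def mv_def G_def group_def)
    qed
    define pick where "pick = (\<lambda>d. SOME q. q \<in> G d - M)"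
    have pick: "pick d \<in> G d - M" if "G d - M \<noteq> {}" for d
      using that unfolding pick_def by (meson ex_in_conv someI_ex)
    define M' where "M' = M \<union> {p. \<exists>d. w p = Some d \<and> p \<in> G d - M \<and> card (G d) \<le> B \<and> p = pick d}"
    have tbl: "A (B * \<sigma> + j) v S q = (case w q of None \<Rightarrow> None
      | Some d \<Rightarrow> let Q = {q\<in>S. w q = Some d} in
          if fst d < length E \<and> dtail E d = v \<and> q \<in> Q \<and> card Q \<le> B \<and> q = (SOME q. q \<in> Q) then Some d else None)" for v S q
      unfolding A_def table_def div w_def using \<sigma> by simp
    \<comment> \<open>The table sees only the remainder of a group; this shows that it still judges
      the size of the original group correctly.\<close>
    have GMcard: "card (G d - M) \<le> B \<longleftrightarrow> card (G d) \<le> B" for d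
    proof
      assume "card (G d) \<le> B"
      then show "card (G d - M) \<le> B" using card_mono[OF fG[of d], of "G d - M"] by simp
    next
      assume le: "card (G d - M) \<le> B"
      show "card (G d) \<le> B"
      proof (rule ccontr)
        assume n: "\<not> card (G d) \<le> B"
        have "G d \<inter> M = {}"
        proof (rule ccontr)
          assume "G d \<inter> M \<noteq> {}"
          then obtain q where q: "q \<in> G d" "q \<in> M" by blast
          then have "w q = Some d" by (simp add: G_def group_def)
          then show False using M(1) q n by (auto simp: good_def)
        qed
        then have "G d - M = G d" by blast
        then show False using le n by simp
      qed
    qed
    have "run E A P (B * \<sigma> + Suc j) q = mv M' q" if q: "q \<in> P" for q
    proof (cases "q \<in> M")
      case True
      then obtain d where d: "w q = Some d" "q \<in> G d" using M(1) by (auto simp: good_def)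
      have "run E A P (B * \<sigma> + j) q = dhead E d" using M(2)[OF q] True d by (simp add: mv_def)
      moreover have "dtail E d \<noteq> dhead E d" using d(1) proper unfolding proper_wish_def w_def by blast
      ultimately have "run E A P (B * \<sigma> + Suc j) q = dhead E d"
        using d by (simp add: step_def tbl Let_def)
      then show ?thesis using True d by (simp add: mv_def M'_def)
    next
      case False
      then have loc: "run E A P (B * \<sigma> + j) q = loc q" using M(2)[OF q] by (simp add: mv_def)
      show ?thesis
      proof (cases "\<exists>d. w q = Some d \<and> q \<in> G d")
        case True
        then obtain d where d: "w q = Some d" "q \<in> G d" by blast
        then have ld: "loc q = dtail E d" "loc q \<noteq> pdst q" by (auto simp: G_def group_def)
        have E: "fst d < length E" using d(1) proper unfolding proper_wish_def w_def by blast
        have an: "q \<in> at_node P (run E A P (B * \<sigma> + j)) (dtail E d)" using q loc ld by (simp add: at_node_def)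
        have "run E A P (B * \<sigma> + Suc j) q = (if card (G d - M) \<le> B \<and> q = pick d then dhead E d else loc q)"
          using an d E ld loc at[of d] False by (simp add: step_def tbl Let_def pick_def)
        moreover have "q \<in> M' \<longleftrightarrow> card (G d) \<le> B \<and> q = pick d" using False d by (auto simp: M'_def)
        ultimately show ?thesis using GMcard[of d] d by (auto simp: mv_def)
      next
        case nG: False
        then have "q \<notin> M'" using False by (auto simp: M'_def)
        moreover have "run E A P (B * \<sigma> + Suc j) q = loc q"
        proof (cases "w q")
          case None
          then show ?thesis using loc by (simp add: step_def tbl)
        next
          case (Some d)
          then have "q \<notin> G d" using nG by blast
          then have "\<not> (loc q \<noteq> pdst q \<and> dtail E d = loc q)" using Some by (auto simp: G_def group_def)
          then show ?thesis using loc Some by (auto simp: step_def tbl Let_def at_node_def)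
        qed
        ultimately show ?thesis by (simp add: mv_def)
      qed
    qed
    moreover have "M' \<subseteq> good" using M(1) by (auto simp: M'_def good_def)
    moreover have "card (G d - M') \<le> card (G d) - Suc j" if d: "card (G d) \<le> B" for d
    proof (cases "G d - M = {}")
      case True
      then have "G d - M' = {}" by (auto simp: M'_def)
      then show ?thesis by (simp only: card.empty le0)
    next
      case False
      then have pk: "pick d \<in> G d - M" by (rule pick)
      then have "pick d \<in> M'" using d by (auto simp: M'_def G_def group_def)
      then have "G d - M' \<subseteq> G d - M - {pick d}" by (auto simp: M'_def)
      then have "card (G d - M') \<le> card (G d - M - {pick d})" using fG by (intro card_mono) auto
      also have "\<dots> = card (G d - M) - 1" using pk by simp
      finally show ?thesis using M(3)[OF d] by linarith
    qed
    ultimately show ?case by (intro exI[of _ M']) simp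
  qed
  from this[of B] obtain M where M: "M \<subseteq> good" "run E A P (B * \<sigma> + B) p = mv M p"
      "\<And>d. card (G d) \<le> B \<Longrightarrow> card (G d - M) \<le> card (G d) - B" using p by auto
  have "good \<subseteq> M"
  proof
    fix q assume "q \<in> good"
    then obtain d where d: "q \<in> G d" "card (G d) \<le> B" by (auto simp: good_def)
    then have "card (G d - M) = 0" using M(3)[of d] by simp
    then have "G d - M = {}" using fG by simp
    then show "q \<in> M" using d by blast
  qed
  then have "M = good" using M(1) by blast
  then have "mv M p = sstep E B w loc p"
    unfolding mv_def sstep_def good_def G_def by (auto split: option.split)
  then show ?thesis using M(2) by (simp add: A_def w_def add.commute)
qed

text \<open>Absent packets are represented as delivered. A state in which all undelivered packets
  are at their sources is thus \<open>start\<close> of a set.\<close>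

definition start :: "pkt set \<Rightarrow> pkt \<Rightarrow> nat" where
  "start S p = (if p \<in> S then psrc p else pdst p)"

lemma sstep_delivered: "loc p = pdst p \<Longrightarrow> sstep E B w loc p = pdst p"
  by (auto simp: sstep_def group_def split: option.split)

lemma fold_sstep_delivered: "loc p = pdst p \<Longrightarrow> fold (sstep E B) ws loc p = pdst p"
  by (induction ws arbitrary: loc) (auto simp: sstep_delivered)

lemma supersteps_run:
  assumes "finite P" "\<And>w. w \<in> set ws \<Longrightarrow> proper_wish E w" "0 < B" "p \<in> P" "\<sigma> \<le> length ws"
  shows "run E (table E B ws) P (B * \<sigma>) p = fold (sstep E B) (take \<sigma> ws) (start P) p"
  using assms(4,5)
proof (induction \<sigma> arbitrary: p)
  case 0
  then show ?case by (simp add: start_def)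
next
  case (Suc \<sigma>)
  have "run E (table E B ws) P (B * Suc \<sigma>) p = sstep E B (ws ! \<sigma>) (fold (sstep E B) (take \<sigma> ws) (start P)) p"
  proof (rule superstep_run[OF assms(1)])
    show "proper_wish E (ws ! \<sigma>)" using Suc.prems assms(2) by simp
    show "fold (sstep E B) (take \<sigma> ws) (start P) q = pdst q" if "q \<notin> P" for q
      using that by (intro fold_sstep_delivered) (simp add: start_def)
  qed (use Suc assms(3) in simp_all)
  then show ?case using Suc.prems by (simp add: take_Suc_conv_app_nth)
qed

section \<open>Phases\<close>

locale phase_plan =
  fixes E :: "(nat \<times> nat) list" and B \<Lambda> :: nat and ds :: "pkt \<Rightarrow> dedge list" and \<delta> :: "pkt \<Rightarrow> nat"
  assumes ds_walk: "ds p \<noteq> [] \<Longrightarrow> walk E (psrc p) (ds p) (pdst p)"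
    and ds_simple: "distinct (nodes E (psrc p) (ds p))"
    and ds_time: "\<delta> p + length (ds p) \<le> \<Lambda>"
begin

text \<open>The wish follows the clock, not the position. A stopped packet falls behind, and as its
  walk is simple, no later wish starts at its node; it stays out of all groups without any record
  that it stopped.\<close>

definition fw :: "nat \<Rightarrow> wish" where
  "fw \<tau> p = (if \<delta> p \<le> \<tau> \<and> \<tau> < \<delta> p + length (ds p) then Some (ds p ! (\<tau> - \<delta> p)) else None)"

definition bw :: "nat \<Rightarrow> wish" where
  "bw \<tau> p = map_option flip (fw \<tau> p)"

definition phase :: "wish list" where
  "phase = map fw [0..<\<Lambda>] @ map bw (rev [0..<\<Lambda>])"

definition node :: "pkt \<Rightarrow> nat \<Rightarrow> nat" where
  "node p i = nodes E (psrc p) (ds p) ! i"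

lemma node_0: "node p 0 = psrc p"
  by (simp add: node_def)

lemma node_inj: "i \<le> length (ds p) \<Longrightarrow> j \<le> length (ds p) \<Longrightarrow> node p i = node p j \<longleftrightarrow> i = j"
  unfolding node_def using ds_simple[of p] by (intro nth_eq_iff_index_eq) auto

lemma node_last: "ds p \<noteq> [] \<Longrightarrow> node p (length (ds p)) = pdst p"
  unfolding node_def using ds_walk by (rule walk_last)

lemma node_pdst: "i \<le> length (ds p) \<Longrightarrow> ds p \<noteq> [] \<Longrightarrow> node p i = pdst p \<longleftrightarrow> i = length (ds p)"
  using node_inj[of i p "length (ds p)"] node_last[of p] by simp

lemma fw_SomeD:
  assumes "fw \<tau> p = Some d"
  shows "\<delta> p \<le> \<tau>" "\<tau> - \<delta> p < length (ds p)" "ds p \<noteq> []" "dtail E d = node p (\<tau> - \<delta> p)"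
    "dhead E d = node p (Suc (\<tau> - \<delta> p))" "fst d < length E" "d = ds p ! (\<tau> - \<delta> p)"
proof -
  show a: "\<delta> p \<le> \<tau>" "\<tau> - \<delta> p < length (ds p)" "d = ds p ! (\<tau> - \<delta> p)"
    using assms by (auto simp: fw_def split: if_splits)
  then show b: "ds p \<noteq> []" by auto
  show "dtail E d = node p (\<tau> - \<delta> p)" using walk_tail_nth[OF ds_walk[OF b] a(2)] a(3) by (simp add: node_def)
  show "dhead E d = node p (Suc (\<tau> - \<delta> p))" using nodes_Suc[OF a(2)] a(3) by (simp add: node_def)
  show "fst d < length E" using walk_edges[OF ds_walk[OF b]] a by simp
qed

lemma proper_phase: "w \<in> set phase \<Longrightarrow> proper_wish E w"
proof -
  have ok: "fst d < length E \<and> dtail E d \<noteq> dhead E d" if "fw \<tau> p = Some d" for \<tau> p d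
    using fw_SomeD[OF that] node_inj[of "\<tau> - \<delta> p" p "Suc (\<tau> - \<delta> p)"] by simp
  have "proper_wish E (fw \<tau>)" for \<tau> unfolding proper_wish_def using ok by blast
  moreover have "proper_wish E (bw \<tau>)" for \<tau> unfolding proper_wish_def
  proof (intro allI impI)
    fix p d assume "bw \<tau> p = Some d"
    then obtain d' where "fw \<tau> p = Some d'" "d = flip d'" by (auto simp only: bw_def map_option_eq_Some)
    then show "fst d < length E \<and> dtail E d \<noteq> dhead E d" using ok[of \<tau> p d'] by auto
  qed
  ultimately show "w \<in> set phase \<Longrightarrow> proper_wish E w" by (auto simp: phase_def)
qed

definition forward :: "pkt set \<Rightarrow> nat \<Rightarrow> pkt \<Rightarrow> nat" where
  "forward T \<tau> = fold (sstep E B) (map fw [0..<\<tau>]) (start T)"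

lemma forward_Suc: "forward T (Suc \<tau>) = sstep E B (fw \<tau>) (forward T \<tau>)"
  by (simp add: forward_def)

text \<open>\<open>st p\<close> is the number of hops made by \<open>p\<close>, and \<open>g p\<close> the slot at which \<open>p\<close> was dropped.\<close>

definition fstate :: "pkt set \<Rightarrow> nat \<Rightarrow> (pkt \<Rightarrow> nat) \<Rightarrow> (pkt \<Rightarrow> (nat \<times> dedge) option) \<Rightarrow> bool" where
  "fstate T \<tau> st g \<longleftrightarrow>
     (\<forall>p\<in>T. forward T \<tau> p = node p (st p)) \<and>
     (\<forall>p\<in>T. g p = None \<longrightarrow> st p = min (\<tau> - \<delta> p) (length (ds p))) \<and>
     (\<forall>p\<in>T. \<forall>\<tau>' d. g p = Some (\<tau>', d) \<longrightarrow> \<tau>' < \<tau> \<and> fw \<tau>' p = Some d \<and> st p = \<tau>' - \<delta> p) \<and>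
     (\<forall>p\<in>T. \<forall>f. g p = Some f \<longrightarrow> B < card {q\<in>T. g q = Some f}) \<and>
     (\<forall>\<tau>'<\<tau>. \<forall>d. card {p\<in>T. fw \<tau>' p = Some d \<and> \<tau>' - \<delta> p < st p} \<le> B)"

lemma fstate_bound:
  assumes "fstate T \<tau> st g" "p \<in> T"
  shows "st p \<le> length (ds p)" "st p \<le> \<tau> - \<delta> p"
proof -
  have "st p \<le> min (\<tau> - \<delta> p) (length (ds p))"
  proof (cases "g p")
    case None
    then show ?thesis using assms by (simp add: fstate_def)
  next
    case (Some f)
    then obtain \<tau>' d where f: "g p = Some (\<tau>', d)" by (cases f) auto
    then have "\<tau>' < \<tau>" "fw \<tau>' p = Some d" "st p = \<tau>' - \<delta> p" using assms unfolding fstate_def by blast+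
    then show ?thesis using fw_SomeD[of \<tau>' p d] by auto
  qed
  then show "st p \<le> length (ds p)" "st p \<le> \<tau> - \<delta> p" by auto
qed

lemma fstate_exists:
  assumes fin: "finite T"
  shows "\<exists>st g. fstate T \<tau> st g"
proof (induction \<tau>)
  case 0
  have "fstate T 0 (\<lambda>_. 0) (\<lambda>_. None)" by (simp add: fstate_def forward_def start_def node_0)
  then show ?case by blast
next
  case (Suc \<tau>)
  then obtain st g where F: "fstate T \<tau> st g" by blast
  note bnd = fstate_bound[OF F]
  have F1: "\<And>p. p \<in> T \<Longrightarrow> forward T \<tau> p = node p (st p)"
    and F2: "\<And>p. p \<in> T \<Longrightarrow> g p = None \<Longrightarrow> st p = min (\<tau> - \<delta> p) (length (ds p))"
    and F3: "\<And>p \<tau>' d. p \<in> T \<Longrightarrow> g p = Some (\<tau>', d) \<Longrightarrow> \<tau>' < \<tau> \<and> fw \<tau>' p = Some d \<and> st p = \<tau>' - \<delta> p"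
    and F4: "\<And>p f. p \<in> T \<Longrightarrow> g p = Some f \<Longrightarrow> B < card {q\<in>T. g q = Some f}"
    and F5: "\<And>\<tau>' d. \<tau>' < \<tau> \<Longrightarrow> card {p\<in>T. fw \<tau>' p = Some d \<and> \<tau>' - \<delta> p < st p} \<le> B"
    using F unfolding fstate_def by blast+
  define G where "G = (\<lambda>d. {q\<in>T. fw \<tau> q = Some d \<and> st q = \<tau> - \<delta> q})"
  have out: "forward T \<tau> q = pdst q" if "q \<notin> T" for q
    unfolding forward_def using that by (intro fold_sstep_delivered) (simp add: start_def)
  \<comment> \<open>On a simple walk the position determines the number of hops, so a packet stands
    at the tail of its wish exactly if it is on schedule.\<close>
  have grp: "group E (fw \<tau>) (forward T \<tau>) d = G d" for d
  proof (intro set_eqI iffI)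
    fix q assume "q \<in> group E (fw \<tau>) (forward T \<tau>) d"
    then have q: "q \<in> T" "fw \<tau> q = Some d" "forward T \<tau> q = dtail E d" using out[of q] by (auto simp: group_def)
    then show "q \<in> G d" using fw_SomeD[OF q(2)] F1[OF q(1)] bnd[OF q(1)] node_inj[of "st q" q "\<tau> - \<delta> q"] by (simp add: G_def)
  next
    fix q assume "q \<in> G d"
    then have q: "q \<in> T" "fw \<tau> q = Some d" "st q = \<tau> - \<delta> q" by (auto simp: G_def)
    then show "q \<in> group E (fw \<tau>) (forward T \<tau>) d"
      using fw_SomeD[OF q(2)] F1[OF q(1)] bnd[OF q(1)] node_pdst[of "st q" q] by (auto simp: group_def)
  qed
  have G_fresh: "g q = None" if q: "q \<in> G d" for q d
  proof (rule ccontr)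
    assume "g q \<noteq> None"
    then obtain \<tau>' d' where "g q = Some (\<tau>', d')" by auto
    then have "\<tau>' < \<tau>" "fw \<tau>' q = Some d'" "st q = \<tau>' - \<delta> q" using F3[of q] q by (auto simp: G_def)
    moreover have "st q = \<tau> - \<delta> q" using q by (simp add: G_def)
    ultimately show False using fw_SomeD(1)[of \<tau>' q d'] by linarith
  qed
  have G_uniq: "fw \<tau> q = Some d" if "q \<in> G d" for q d using that by (simp add: G_def)
  define moves where "moves = (\<lambda>q. \<exists>d. q \<in> G d \<and> card (G d) \<le> B)"
  define st' where "st' = (\<lambda>q. if moves q then Suc (st q) else st q)"
  define g' where "g' = (\<lambda>q. if \<exists>d. q \<in> G d \<and> B < card (G d) then Some (\<tau>, the (fw \<tau> q)) else g q)"
  have g'I: "g' q = Some (\<tau>, d)" if "q \<in> G d" "B < card (G d)" for q d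
  proof -
    have "\<exists>d. q \<in> G d \<and> B < card (G d)" using that by blast
    then show ?thesis using G_uniq[OF that(1)] by (simp add: g'_def)
  qed
  have movesD: "q \<in> T" "fw \<tau> q \<noteq> None" "st q = \<tau> - \<delta> q" "\<delta> q \<le> \<tau>" "\<not> (\<exists>d. q \<in> G d \<and> B < card (G d))" if m: "moves q" for q
  proof -
    obtain d where d: "q \<in> G d" "card (G d) \<le> B" using m by (auto simp: moves_def)
    show "q \<in> T" "fw \<tau> q \<noteq> None" "st q = \<tau> - \<delta> q" using d by (auto simp: G_def)
    show "\<delta> q \<le> \<tau>" using fw_SomeD(1) G_uniq[OF d(1)] by blast
    have "d' = d" if "q \<in> G d'" for d' using G_uniq[OF that] G_uniq[OF d(1)] by simp
    then show "\<not> (\<exists>d. q \<in> G d \<and> B < card (G d))" using d(2) by auto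
  qed
  have "fstate T (Suc \<tau>) st' g'"
    unfolding fstate_def
  proof (intro conjI ballI allI impI)
    fix p assume p: "p \<in> T"
    show "forward T (Suc \<tau>) p = node p (st' p)"
    proof (cases "fw \<tau> p")
      case None
      then have "\<not> moves p" using movesD(2) by blast
      then show ?thesis using None F1[OF p] by (simp add: forward_Suc sstep_def st'_def)
    next
      case (Some d)
      have "moves p \<longleftrightarrow> p \<in> G d \<and> card (G d) \<le> B"
        using G_uniq[of p] Some by (auto simp: moves_def)
      moreover have "st p = \<tau> - \<delta> p" if "p \<in> G d" using that by (simp add: G_def)
      ultimately show ?thesis using Some F1[OF p] fw_SomeD(5)[OF Some] by (simp add: forward_Suc sstep_def grp st'_def)
    qed
    show "st' p = min (Suc \<tau> - \<delta> p) (length (ds p))" if n: "g' p = None"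
    proof -
      have g: "g p = None" "\<not> (\<exists>d. p \<in> G d \<and> B < card (G d))" using n by (auto simp: g'_def split: if_splits)
      have st: "st p = min (\<tau> - \<delta> p) (length (ds p))" using F2[OF p g(1)] .
      show ?thesis
      proof (cases "fw \<tau> p")
        case None
        then have "\<not> moves p" using movesD(2) by blast
        then show ?thesis using st None by (auto simp: st'_def fw_def split: if_splits)
      next
        case (Some d)
        note d = fw_SomeD[OF Some]
        have "p \<in> G d" using p Some st d(2) by (simp add: G_def)
        then have "moves p" unfolding moves_def using g(2) not_less by blast
        then show ?thesis using st d(1,2) by (simp add: st'_def)
      qed
    qed
    show "\<tau>' < Suc \<tau>" "fw \<tau>' p = Some d" "st' p = \<tau>' - \<delta> p" if s: "g' p = Some (\<tau>', d)" for \<tau>' d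
    proof -
      have "\<tau>' < Suc \<tau> \<and> fw \<tau>' p = Some d \<and> st' p = \<tau>' - \<delta> p"
      proof (cases "\<exists>d. p \<in> G d \<and> B < card (G d)")
        case True
        then obtain e where e: "p \<in> G e" "B < card (G e)" by blast
        then have "\<tau>' = \<tau>" "d = e" using g'I[OF e] s by auto
        moreover have "\<not> moves p" using movesD(5) True by blast
        ultimately show ?thesis using e by (simp add: G_def st'_def)
      next
        case False
        then have "g p = Some (\<tau>', d)" using s unfolding g'_def if_not_P[OF False] by simp
        then have o: "\<tau>' < \<tau> \<and> fw \<tau>' p = Some d \<and> st p = \<tau>' - \<delta> p" by (rule F3[OF p])
        then have "\<not> moves p" using movesD(3)[of p] fw_SomeD(1)[of \<tau>' p d] by linarith
        then show ?thesis using o by (simp add: st'_def)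
      qed
      then show "\<tau>' < Suc \<tau>" "fw \<tau>' p = Some d" "st' p = \<tau>' - \<delta> p" by auto
    qed
    show "B < card {q\<in>T. g' q = Some f}" if s: "g' p = Some f" for f
    proof (cases "\<exists>d. p \<in> G d \<and> B < card (G d)")
      case True
      then obtain e where e: "p \<in> G e" "B < card (G e)" by blast
      then have f: "f = (\<tau>, e)" using g'I[OF e] s by simp
      have "G e \<subseteq> {q\<in>T. g' q = Some f}" using g'I[OF _ e(2)] f by (auto simp: G_def)
      then have "card (G e) \<le> card {q\<in>T. g' q = Some f}" using fin by (intro card_mono) auto
      then show ?thesis using e(2) by simp
    next
      case False
      then have gf: "g p = Some f" using s unfolding g'_def if_not_P[OF False] by simp
      have "g' q = Some f" if "q \<in> T" "g q = Some f" for q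
        using that G_fresh[of q] by (auto simp: g'_def)
      then have "{q\<in>T. g q = Some f} \<subseteq> {q\<in>T. g' q = Some f}" by blast
      then have "card {q\<in>T. g q = Some f} \<le> card {q\<in>T. g' q = Some f}" using fin by (intro card_mono) auto
      then show ?thesis using F4[OF p gf] by simp
    qed
  next
    fix \<tau>' d assume t: "\<tau>' < Suc \<tau>"
    show "card {p\<in>T. fw \<tau>' p = Some d \<and> \<tau>' - \<delta> p < st' p} \<le> B"
    proof (cases "\<tau>' = \<tau>")
      case True
      have sub: "q \<in> G d \<and> card (G d) \<le> B" if q: "q \<in> T" "fw \<tau> q = Some d" "\<tau> - \<delta> q < st' q" for q
      proof -
        have "moves q" using q(3) bnd(2)[OF q(1)] by (auto simp: st'_def split: if_splits)
        then obtain e where e: "q \<in> G e" "card (G e) \<le> B" by (auto simp: moves_def)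
        then have "e = d" using G_uniq[OF e(1)] q(2) by simp
        then show ?thesis using e by simp
      qed
      show ?thesis
      proof (cases "card (G d) \<le> B")
        case le: True
        have "{p\<in>T. fw \<tau>' p = Some d \<and> \<tau>' - \<delta> p < st' p} \<subseteq> G d" using sub True by blast
        then have "card {p\<in>T. fw \<tau>' p = Some d \<and> \<tau>' - \<delta> p < st' p} \<le> card (G d)"
          using fin by (intro card_mono) (auto simp: G_def)
        then show ?thesis using le by simp
      next
        case False
        then have "{p\<in>T. fw \<tau>' p = Some d \<and> \<tau>' - \<delta> p < st' p} = {}" using sub True by blast
        then show ?thesis by (simp only: card.empty le0)
      qed
    next
      case False
      then have lt: "\<tau>' < \<tau>" using t by simp
      have "\<tau>' - \<delta> q < st q" if "fw \<tau>' q = Some d" "\<tau>' - \<delta> q < st' q" for q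
      proof (cases "moves q")
        case True
        then show ?thesis using movesD(3)[OF True] fw_SomeD(1)[OF that(1)] lt by linarith
      next
        case False
        then show ?thesis using that(2) by (simp add: st'_def)
      qed
      then have "{p\<in>T. fw \<tau>' p = Some d \<and> \<tau>' - \<delta> p < st' p} \<subseteq> {p\<in>T. fw \<tau>' p = Some d \<and> \<tau>' - \<delta> p < st p}" by blast
      then have "card {p\<in>T. fw \<tau>' p = Some d \<and> \<tau>' - \<delta> p < st' p} \<le> card {p\<in>T. fw \<tau>' p = Some d \<and> \<tau>' - \<delta> p < st p}"
        using fin by (intro card_mono) auto
      then show ?thesis using F5[OF lt, of d] by simp
    qed
  qed
  then show ?case by blast
qed

text \<open>Reversed in time, a packet recrosses an edge at the slot at which it crossed it. All its
  competitors crossed in that slot too, so there are at most \<open>B\<close> and nobody is stopped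
  on the way home.\<close>

lemma backward_state:
  assumes fin: "finite T" and F: "fstate T \<Lambda> st g" and "k \<le> \<Lambda>" and p: "p \<in> T" and und: "forward T \<Lambda> p \<noteq> pdst p"
  shows "fold (sstep E B) (map bw (rev [\<Lambda> - k..<\<Lambda>])) (forward T \<Lambda>) p = node p (min (st p) (\<Lambda> - k - \<delta> p))"
  using assms(3) p und
proof (induction k arbitrary: p)
  case 0
  have "st p \<le> \<Lambda> - \<delta> p" using fstate_bound[OF F 0(2)] by simp
  then show ?case using 0 F by (simp add: fstate_def)
next
  case (Suc k)
  define \<tau> where "\<tau> = \<Lambda> - Suc k"
  have \<tau>: "\<tau> < \<Lambda>" "\<Lambda> - k = Suc \<tau>" using Suc.prems(1) by (auto simp: \<tau>_def)
  define loc where "loc = fold (sstep E B) (map bw (rev [\<Lambda> - k..<\<Lambda>])) (forward T \<Lambda>)"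
  have loc: "loc q = node q (min (st q) (Suc \<tau> - \<delta> q))" if "q \<in> T" "forward T \<Lambda> q \<noteq> pdst q" for q
    using Suc.IH[OF _ that] Suc.prems(1) \<tau>(2) by (simp add: loc_def)
  have dlv: "loc q = pdst q" if "forward T \<Lambda> q = pdst q" for q
    unfolding loc_def using that by (rule fold_sstep_delivered)
  have out: "forward T \<Lambda> q = pdst q" if "q \<notin> T" for q
    unfolding forward_def using that by (intro fold_sstep_delivered) (simp add: start_def)
  have "fold (sstep E B) (map bw (rev [\<Lambda> - Suc k..<\<Lambda>])) (forward T \<Lambda>) p = sstep E B (bw \<tau>) loc p"
    using \<tau> by (simp add: loc_def \<tau>_def[symmetric] upt_conv_Cons)
  also have "\<dots> = node p (min (st p) (\<tau> - \<delta> p))"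
  proof (cases "fw \<tau> p")
    case None
    have "min (st p) (Suc \<tau> - \<delta> p) = min (st p) (\<tau> - \<delta> p)"
      using None fstate_bound(1)[OF F Suc.prems(2)] by (auto simp: fw_def split: if_splits)
    then show ?thesis using None loc[OF Suc.prems(2,3)] by (simp add: sstep_def bw_def)
  next
    case (Some d)
    note d = fw_SomeD[OF Some]
    have grp: "group E (bw \<tau>) loc (flip d) \<subseteq> {q\<in>T. fw \<tau> q = Some d \<and> \<tau> - \<delta> q < st q}"
    proof
      fix q assume "q \<in> group E (bw \<tau>) loc (flip d)"
      then have q: "loc q \<noteq> pdst q" "bw \<tau> q = Some (flip d)" "loc q = dhead E d" by (auto simp: group_def)
      then have fwq: "fw \<tau> q = Some d" by (auto simp: bw_def dest: injD[OF inj_flip])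
      have qT: "q \<in> T" "forward T \<Lambda> q \<noteq> pdst q" using q(1) out dlv by blast+
      have "node q (min (st q) (Suc \<tau> - \<delta> q)) = node q (Suc (\<tau> - \<delta> q))"
        using loc[OF qT] q(3) fw_SomeD(5)[OF fwq] by simp
      then have "min (st q) (Suc \<tau> - \<delta> q) = Suc (\<tau> - \<delta> q)"
        using fw_SomeD(2)[OF fwq] fstate_bound(1)[OF F qT(1)] by (subst (asm) node_inj) auto
      then have "\<tau> - \<delta> q < st q" by linarith
      then show "q \<in> {q\<in>T. fw \<tau> q = Some d \<and> \<tau> - \<delta> q < st q}" using qT fwq by simp
    qed
    then have "card (group E (bw \<tau>) loc (flip d)) \<le> card {q\<in>T. fw \<tau> q = Some d \<and> \<tau> - \<delta> q < st q}"
      using fin by (intro card_mono) auto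
    also have "\<dots> \<le> B" using F \<tau>(1) unfolding fstate_def by blast
    finally have small: "card (group E (bw \<tau>) loc (flip d)) \<le> B" .
    have bwp: "bw \<tau> p = Some (flip d)" using Some by (simp add: bw_def)
    show ?thesis
    proof (cases "\<tau> - \<delta> p < st p")
      case True
      then have m: "min (st p) (Suc \<tau> - \<delta> p) = Suc (\<tau> - \<delta> p)" using d(1) by simp
      \<comment> \<open>Only the last node of the walk is the destination, so an undelivered packet
        is not absorbed while returning.\<close>
      have "st p \<noteq> length (ds p)" using Suc.prems(2,3) F d(3) node_last[of p] by (auto simp: fstate_def)
      then have "st p < length (ds p)" using fstate_bound(1)[OF F Suc.prems(2)] by simp
      then have "loc p \<noteq> pdst p" using loc[OF Suc.prems(2,3)] m True node_pdst[of "Suc (\<tau> - \<delta> p)" p] d(3) by simp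
      then have "p \<in> group E (bw \<tau>) loc (flip d)"
        using bwp loc[OF Suc.prems(2,3)] m d(5) by (simp add: group_def)
      then have "sstep E B (bw \<tau>) loc p = dtail E d" using bwp small by (simp add: sstep_def)
      then show ?thesis using d(4) True by simp
    next
      case False
      then have "p \<notin> group E (bw \<tau>) loc (flip d)" using grp by blast
      then have "sstep E B (bw \<tau>) loc p = loc p" using bwp by (simp add: sstep_def)
      moreover have "min (st p) (Suc \<tau> - \<delta> p) = min (st p) (\<tau> - \<delta> p)" using False by simp
      ultimately show ?thesis using loc[OF Suc.prems(2,3)] by simp
    qed
  qed
  finally show ?case by (simp add: \<tau>_def)
qed

definition remain :: "pkt set \<Rightarrow> pkt set" where
  "remain T = {p. fold (sstep E B) phase (start T) p \<noteq> pdst p}"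

lemma fold_phase: "fold (sstep E B) phase (start T) = fold (sstep E B) (map bw (rev [0..<\<Lambda>])) (forward T \<Lambda>)"
  by (simp add: phase_def forward_def)

lemma remain_nontrivial: "p \<in> remain T \<Longrightarrow> p \<in> T \<and> psrc p \<noteq> pdst p"
proof (rule ccontr)
  assume p: "p \<in> remain T" and "\<not> (p \<in> T \<and> psrc p \<noteq> pdst p)"
  then have "start T p = pdst p" by (auto simp: start_def)
  then have "fold (sstep E B) phase (start T) p = pdst p" by (rule fold_sstep_delivered)
  then show False using p by (simp add: remain_def)
qed

lemma remain_subset: "remain T \<subseteq> T"
  using remain_nontrivial by blast

lemma remain_forward:
  assumes fin: "finite T" and "p \<in> T" "psrc p \<noteq> pdst p"
  shows "p \<in> remain T \<longleftrightarrow> forward T \<Lambda> p \<noteq> pdst p"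
    and "p \<in> remain T \<Longrightarrow> fold (sstep E B) phase (start T) p = psrc p"
proof -
  obtain st g where F: "fstate T \<Lambda> st g" using fstate_exists[OF fin] by blast
  have ret: "fold (sstep E B) phase (start T) p = psrc p" if "forward T \<Lambda> p \<noteq> pdst p"
    using backward_state[OF fin F order_refl assms(2) that] by (simp add: fold_phase node_0)
  have "fold (sstep E B) phase (start T) p = pdst p" if "forward T \<Lambda> p = pdst p"
    unfolding fold_phase using that by (rule fold_sstep_delivered)
  then show *: "p \<in> remain T \<longleftrightarrow> forward T \<Lambda> p \<noteq> pdst p"
    using ret assms(3) by (cases "forward T \<Lambda> p = pdst p") (simp_all add: remain_def)
  then show "p \<in> remain T \<Longrightarrow> fold (sstep E B) phase (start T) p = psrc p" using ret by simp
qed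

lemma phase_start: 
  assumes "finite T"
  shows "fold (sstep E B) phase (start T) = start (remain T)"
proof
  fix p
  show "fold (sstep E B) phase (start T) p = start (remain T) p"
  proof (cases "p \<in> remain T")
    case True
    then show ?thesis using remain_forward(2)[OF assms] remain_nontrivial[OF True] by (simp add: start_def)
  next
    case False
    then show ?thesis by (simp add: remain_def start_def)
  qed
qed

text \<open>Supplies the groups for \<open>many_dropped_count\<close>. A packet remains exactly if
  it was dropped, and an overfull group is dropped as a whole, so the group lies inside the
  remainder.\<close>

lemma remain_groups:
  assumes fin: "finite T" and ne: "\<And>p. p \<in> T \<Longrightarrow> psrc p \<noteq> pdst p \<Longrightarrow> ds p \<noteq> []"
  shows "\<exists>g. (\<forall>f\<in>g ` remain T. B < card {p\<in>remain T. g p = f}) \<and>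
     (\<forall>p\<in>remain T. fst (g p) < \<Lambda> \<and> fw (fst (g p)) p = Some (snd (g p)))"
proof -
  obtain st g where F: "fstate T \<Lambda> st g" using fstate_exists[OF fin] by blast
  have iff: "p \<in> remain T \<longleftrightarrow> g p \<noteq> None" if p: "p \<in> T" "psrc p \<noteq> pdst p" for p
  proof -
    have b: "st p \<le> length (ds p)" using fstate_bound[OF F p(1)] by simp
    have "forward T \<Lambda> p \<noteq> pdst p \<longleftrightarrow> st p < length (ds p)"
      using F p(1) node_pdst[OF b ne[OF p]] b by (auto simp: fstate_def)
    also have "\<dots> \<longleftrightarrow> g p \<noteq> None"
    proof (cases "g p")
      case None
      then have "st p = min (\<Lambda> - \<delta> p) (length (ds p))" using F p(1) unfolding fstate_def by blast
      then show ?thesis using None ds_time[of p] by simp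
    next
      case (Some f)
      then obtain \<tau>' d where "g p = Some (\<tau>', d)" by (cases f) auto
      then have "fw \<tau>' p = Some d" "st p = \<tau>' - \<delta> p" using F p(1) unfolding fstate_def by blast+
      then show ?thesis using fw_SomeD(2)[of \<tau>' p d] Some by simp
    qed
    finally show ?thesis using remain_forward(1)[OF fin p] by simp
  qed
  have gtriv: "psrc p \<noteq> pdst p" if p: "p \<in> T" "g p \<noteq> None" for p
  proof
    assume eq: "psrc p = pdst p"
    obtain \<tau>' d where "g p = Some (\<tau>', d)" using p(2) by auto
    then have "fw \<tau>' p = Some d" using F p(1) unfolding fstate_def by blast
    then have "ds p \<noteq> []" by (rule fw_SomeD(3))
    then show False using node_last[of p] node_0[of p] node_inj[of 0 p "length (ds p)"] eq by simp
  qed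
  have g: "g p = Some (the (g p))" if "p \<in> remain T" for p
  proof -
    have "g p \<noteq> None" using iff[of p] that remain_nontrivial[OF that] by blast
    then show ?thesis by simp
  qed
  have "B < card {q\<in>remain T. the (g q) = the (g p)}" if p: "p \<in> remain T" for p
  proof -
    have pT: "p \<in> T" using remain_subset p by blast
    have "{q\<in>T. g q = Some (the (g p))} \<subseteq> {q\<in>remain T. the (g q) = the (g p)}"
    proof
      fix q assume q: "q \<in> {q\<in>T. g q = Some (the (g p))}"
      then have "q \<in> T" "g q \<noteq> None" by auto
      then have "q \<in> remain T" using iff gtriv by blast
      then show "q \<in> {q\<in>remain T. the (g q) = the (g p)}" using q by simp
    qed
    then have "card {q\<in>T. g q = Some (the (g p))} \<le> card {q\<in>remain T. the (g q) = the (g p)}"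
      using finite_subset[OF remain_subset fin] by (intro card_mono) auto
    moreover have "B < card {q\<in>T. g q = Some (the (g p))}" using F pT g[OF p] unfolding fstate_def by blast
    ultimately show ?thesis by simp
  qed
  moreover have "fst (the (g p)) < \<Lambda> \<and> fw (fst (the (g p))) p = Some (snd (the (g p)))" if p: "p \<in> remain T" for p
  proof -
    have pT: "p \<in> T" using remain_subset p by blast
    have "g p = Some (fst (the (g p)), snd (the (g p)))" using g[OF p] by simp
    then show ?thesis using F pT unfolding fstate_def by blast
  qed
  ultimately show ?thesis by (intro exI[of _ "\<lambda>p. the (g p)"]) auto
qed

end

section \<open>Schedules\<close>

text \<open>A simple walk contains \<open>d\<close> at most once, so for each \<open>j\<close> at
  most one delay makes it cross \<open>d\<close> at time \<open>\<tau>\<close>. This is what the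
  delays are for.\<close>

lemma pass_count_le:
  fixes ds :: "nat \<Rightarrow> dedge list"
  assumes "finite J" "\<And>j. j \<in> J \<Longrightarrow> distinct (ds j)"
  shows "card {x \<in> J \<times> {..<\<Delta>}. snd x \<le> \<tau> \<and> \<tau> < snd x + length (ds (fst x)) \<and> ds (fst x) ! (\<tau> - snd x) = d}
     \<le> card {j\<in>J. d \<in> set (ds j)}" (is "card ?X \<le> _")
proof (rule card_inj_on_le)
  show "inj_on fst ?X"
  proof (rule inj_onI)
    fix x y assume x: "x \<in> ?X" and y: "y \<in> ?X" and eq: "fst x = fst y"
    have "\<tau> - snd x = \<tau> - snd y"
      using x y eq nth_eq_iff_index_eq[OF assms(2)[of "fst x"], of "\<tau> - snd x" "\<tau> - snd y"] by auto
    then show "x = y" using x y eq by (auto simp: prod_eq_iff)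
  qed
  show "fst ` ?X \<subseteq> {j\<in>J. d \<in> set (ds j)}" by (auto intro!: nth_mem)
qed (use assms(1) in simp)

text \<open>A phase runs \<open>2 * \<Lambda>\<close> supersteps, where \<open>\<Lambda>\<close> is
  \<open>2 * 192 + 8 = 392\<close> times \<open>L * \<rho> * h\<close>; hence 784. A block of
  \<open>r\<close> phases halves every routable demand, and \<open>r\<close> blocks exhaust it since
  \<open>card U < 2 ^ r\<close>.\<close>

lemma epoch_exists:
  assumes G: "wf_graph n E" "E \<noteq> []" "0 < h" "0 < n" "n \<le> 2 ^ l" "4 * length E \<le> 2 ^ L" "0 < L"
    and U: "finite U" "\<And>p. p \<in> U \<Longrightarrow> psrc p < n \<and> pdst p < n"
    and B: "128 * exp 128 * real n \<le> 2 ^ B" and r: "2 * card U \<le> 2 ^ r" "card U < 2 ^ r"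
  defines "\<rho> \<equiv> 48 * L * (l + 2)"
  shows "\<exists>ws. (\<forall>w\<in>set ws. proper_wish E w) \<and> length ws = r * r * (784 * L * \<rho> * h) \<and>
     (\<forall>S\<subseteq>U. \<exists>S'\<subseteq>S. fold (sstep E B) ws (start S) = start S' \<and> (routable E h S \<longrightarrow> S' = {}))"
proof -
  define H where "H = 8 * L * \<rho> * h"
  define K where "K = 192 * L * \<rho> * h"
  \<comment> \<open>A packet chooses among at least \<open>M / 2\<close> routings and
    \<open>\<Delta>\<close> delays, and the \<open>M\<close> routings together load an edge at most
    \<open>K * M\<close> times. So \<open>2 * K\<close> delays bring the mean load of a slot down to
    1.\<close>
  define \<Delta> where "\<Delta> = 2 * K"
  define \<Lambda> where "\<Lambda> = \<Delta> + H"
  have K: "0 < K" "0 < \<Delta>" using G by (auto simp: K_def \<rho>_def \<Delta>_def)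
  obtain Rs where Rs: "Rs \<noteq> []" "\<forall>R\<in>set Rs. simple_routing E H R"
     "\<forall>s<n. \<forall>t<n. short E h s t \<longrightarrow> length Rs \<le> 2 * length (filter (\<lambda>R. R s t \<noteq> None) Rs)"
     "\<forall>S e. S \<subseteq> U \<and> routable E h S \<and> e < length E \<longrightarrow> (\<Sum>R\<leftarrow>Rs. card (uses R S e)) \<le> K * length Rs"
    using routing_family_exists[OF G U(1)] unfolding \<rho>_def[symmetric] H_def[symmetric] K_def[symmetric]
    by (elim exE conjE) (rule that)
  define M where "M = length Rs"
  have M: "0 < M" using Rs(1) by (simp add: M_def)
  define J where "J = (\<lambda>p. {j. j < M \<and> (Rs ! j) (psrc p) (pdst p) \<noteq> None})"
  have fJ: "finite (J p)" for p by (simp add: J_def)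
  define Opt where "Opt = (\<lambda>p. J p \<times> {..<\<Delta>})"
  define rt where "rt = (\<lambda>p j. the ((Rs ! j) (psrc p) (pdst p)))"
  have rt: "walk E (psrc p) (rt p j) (pdst p)" "distinct (nodes E (psrc p) (rt p j))" "length (rt p j) \<le> H"
    "(Rs ! j) (psrc p) (pdst p) = Some (rt p j)" if "j \<in> J p" for p j
  proof -
    have j: "j < length Rs" "(Rs ! j) (psrc p) (pdst p) = Some (rt p j)" using that by (auto simp: J_def rt_def M_def)
    then have "simple_routing E H (Rs ! j)" using Rs(2) by simp
    then show "walk E (psrc p) (rt p j) (pdst p)" "distinct (nodes E (psrc p) (rt p j))" "length (rt p j) \<le> H"
      "(Rs ! j) (psrc p) (pdst p) = Some (rt p j)" using j(2) unfolding simple_routing_def by blast+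
  qed
  \<comment> \<open>Choices are made for every packet of \<open>U\<close> that some routing serves,
    before the demand is known; the others get the empty walk and stay where they are.\<close>
  define P where "P = {p\<in>U. Opt p \<noteq> {}}"
  have fP: "finite P" using U by (simp add: P_def)
  define \<Omega> where "\<Omega> = PiE P Opt"
  define ds where "ds = (\<lambda>(\<omega> :: pkt \<Rightarrow> nat \<times> nat) p. if p \<in> P then rt p (fst (\<omega> p)) else [])"
  define \<delta> where "\<delta> = (\<lambda>(\<omega> :: pkt \<Rightarrow> nat \<times> nat) p. if p \<in> P then snd (\<omega> p) else 0 :: nat)"
  have f\<Omega>: "finite \<Omega>" unfolding \<Omega>_def using fP fJ by (intro finite_PiE) (auto simp: Opt_def)
  have \<Omega>ne: "\<Omega> \<noteq> {}" unfolding \<Omega>_def by (auto simp: PiE_eq_empty_iff P_def)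
  have plan: "phase_plan E \<Lambda> (ds \<omega>) (\<delta> \<omega>)" if "\<omega> \<in> \<Omega>" for \<omega>
  proof
    fix p
    have o: "fst (\<omega> p) \<in> J p" "snd (\<omega> p) < \<Delta>" if "p \<in> P"
      using PiE_mem[OF \<open>\<omega> \<in> \<Omega>\<close>[unfolded \<Omega>_def] that] by (auto simp: Opt_def)
    show "ds \<omega> p \<noteq> [] \<Longrightarrow> walk E (psrc p) (ds \<omega> p) (pdst p)" using rt(1)[OF o(1)] by (auto simp: ds_def split: if_splits)
    show "distinct (nodes E (psrc p) (ds \<omega> p))" using rt(2)[OF o(1)] by (auto simp: ds_def nodes_def)
    show "\<delta> \<omega> p + length (ds \<omega> p) \<le> \<Lambda>" using rt(3)[OF o(1)] o(2) by (auto simp: ds_def \<delta>_def \<Lambda>_def)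
  qed
  \<comment> \<open>For \<open>\<omega>\<close> in \<open>\<Omega>\<close> this is just the
    remainder; the intersection guarantees \<open>\<Phi> \<omega> T \<subseteq> T\<close> for all
    other \<open>\<omega>\<close> as well.\<close>
  define \<Phi> where "\<Phi> = (\<lambda>\<omega> T. T \<inter> phase_plan.remain E B \<Lambda> (ds \<omega>) (\<delta> \<omega>) T)"
  define pass where "pass = (\<lambda>p x f. snd x \<le> fst f \<and> fst f < snd x + length (rt p (fst x)) \<and> rt p (fst x) ! (fst f - snd x) = (snd f :: dedge))"
  define F :: "(nat \<times> dedge) set" where "F = {..<\<Lambda>} \<times> ({..<length E} \<times> UNIV)"
  have fF: "finite F" by (simp add: F_def)
  define fam where "fam = {S. S \<subseteq> U \<and> routable E h S}"
  have tail: "card {\<omega>\<in>\<Omega>. k < 2 * card (\<Phi> \<omega> T)} \<le> card \<Omega> / 2 ^ k" if T: "T \<in> fam" and k: "card T \<le> k" for T k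
  proof -
    have TU: "T \<subseteq> U" "routable E h T" using T by (auto simp: fam_def)
    have fT: "finite T" using TU U finite_subset by blast
    have half: "M \<le> 2 * card (J p)" if "p \<in> T" for p
    proof -
      have "short E h (psrc p) (pdst p)" using TU(2) that unfolding routable_def short_def by blast
      then have "M \<le> 2 * length (filter (\<lambda>R. R (psrc p) (pdst p) \<noteq> None) Rs)"
        using Rs(3) U(2)[of p] TU(1) that unfolding M_def by blast
      then show ?thesis by (simp add: length_filter_conv_card J_def M_def)
    qed
    have J0: "0 < card (J p)" if "p \<in> T" for p using half[OF that] M by simp
    have TP: "T \<subseteq> P"
    proof
      fix p assume p: "p \<in> T"
      then have "J p \<noteq> {}" using J0[OF p] by auto
      then have "Opt p \<noteq> {}" using K by (auto simp: Opt_def)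
      then show "p \<in> P" using p TU by (auto simp: P_def)
    qed
    have "{\<omega>\<in>\<Omega>. k < 2 * card (\<Phi> \<omega> T)} \<subseteq> {\<omega> \<in> PiE P Opt. \<exists>D g. D \<subseteq> T \<and> k < 2 * card D \<and> g ` D \<subseteq> F
      \<and> (\<forall>f\<in>g ` D. B < card {p\<in>D. g p = f}) \<and> (\<forall>p\<in>D. pass p (\<omega> p) (g p))}"
    proof (intro subsetI CollectI conjI)
      fix \<omega> assume "\<omega> \<in> {\<omega>\<in>\<Omega>. k < 2 * card (\<Phi> \<omega> T)}"
      then have \<omega>: "\<omega> \<in> \<Omega>" "k < 2 * card (\<Phi> \<omega> T)" by auto
      show "\<omega> \<in> PiE P Opt" using \<omega>(1) by (simp add: \<Omega>_def)
      interpret phase_plan E B \<Lambda> "ds \<omega>" "\<delta> \<omega>" by (rule plan[OF \<omega>(1)])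
      have \<Phi>: "\<Phi> \<omega> T = remain T" using remain_subset unfolding \<Phi>_def by blast
      have "ds \<omega> p \<noteq> []" if p: "p \<in> T" "psrc p \<noteq> pdst p" for p
      proof
        assume e: "ds \<omega> p = []"
        have pP: "p \<in> P" using p TP by blast
        then have "fst (\<omega> p) \<in> J p" using PiE_mem[of \<omega> P Opt p] \<omega>(1) by (auto simp: Opt_def \<Omega>_def)
        then have "walk E (psrc p) [] (pdst p)" using rt(1)[of "fst (\<omega> p)" p] e pP by (simp add: ds_def)
        then show False using p(2) by simp
      qed
      from remain_groups[OF fT this] obtain g where g: "\<forall>f\<in>g ` remain T. B < card {p\<in>remain T. g p = f}"
        "\<And>p. p \<in> remain T \<Longrightarrow> fst (g p) < \<Lambda> \<and> fw (fst (g p)) p = Some (snd (g p))" by blast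
      have "g ` remain T \<subseteq> F"
      proof
        fix f assume "f \<in> g ` remain T"
        then obtain p where p: "p \<in> remain T" "f = g p" by blast
        then show "f \<in> F" using g(2)[OF p(1)] fw_SomeD(6)[of "fst (g p)" p "snd (g p)"] by (simp add: F_def mem_Times_iff)
      qed
      moreover have "pass p (\<omega> p) (g p)" if p: "p \<in> remain T" for p
      proof -
        have "p \<in> P" using p TP remain_subset by blast
        then have "ds \<omega> p = rt p (fst (\<omega> p))" "\<delta> \<omega> p = snd (\<omega> p)" by (simp_all add: ds_def \<delta>_def)
        then show ?thesis using g(2)[OF p] unfolding fw_def pass_def by (auto split: if_splits)
      qed
      ultimately show "\<exists>D g. D \<subseteq> T \<and> k < 2 * card D \<and> g ` D \<subseteq> F
        \<and> (\<forall>f\<in>g ` D. B < card {p\<in>D. g p = f}) \<and> (\<forall>p\<in>D. pass p (\<omega> p) (g p))"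
        using remain_subset \<omega>(2) g(1) unfolding \<Phi> by blast
    qed
    moreover have "finite {\<omega> \<in> PiE P Opt. \<exists>D g. D \<subseteq> T \<and> k < 2 * card D \<and> g ` D \<subseteq> F
      \<and> (\<forall>f\<in>g ` D. B < card {p\<in>D. g p = f}) \<and> (\<forall>p\<in>D. pass p (\<omega> p) (g p))}"
      using f\<Omega> unfolding \<Omega>_def by simp
    ultimately have "card {\<omega>\<in>\<Omega>. k < 2 * card (\<Phi> \<omega> T)} \<le> card {\<omega> \<in> PiE P Opt. \<exists>D g. D \<subseteq> T \<and> k < 2 * card D \<and> g ` D \<subseteq> F
      \<and> (\<forall>f\<in>g ` D. B < card {p\<in>D. g p = f}) \<and> (\<forall>p\<in>D. pass p (\<omega> p) (g p))}"
      by (intro card_mono)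
    moreover have "real (card {\<omega> \<in> PiE P Opt. \<exists>D g. D \<subseteq> T \<and> k < 2 * card D \<and> g ` D \<subseteq> F
      \<and> (\<forall>f\<in>g ` D. B < card {p\<in>D. g p = f}) \<and> (\<forall>p\<in>D. pass p (\<omega> p) (g p))}) \<le> card (PiE P Opt) / 2 ^ k"
    proof (rule many_dropped_count[OF fP fF _ TP k _ _ B])
      show "finite (Opt p) \<and> Opt p \<noteq> {}" if "p \<in> P" for p using that fJ by (auto simp: Opt_def P_def)
    next
      fix f assume f: "f \<in> F"
      obtain \<tau> d where fd: "f = (\<tau>, d)" by (cases f)
      have e: "fst d < length E" using f fd by (auto simp: F_def)
      have dist: "distinct (rt p j)" if "j \<in> J p" for p j
        using simple_walk_distinct_edges[OF rt(1,2)[OF that]] distinct_map by blast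
      have one: "card {x \<in> Opt p. pass p x f} / card (Opt p) \<le> 2 / (M * \<Delta>) * card {j. j < M \<and> p \<in> uses (Rs ! j) T (fst d)}" if p: "p \<in> T" for p
      proof -
        have "card {x \<in> Opt p. pass p x f} \<le> card {j\<in>J p. d \<in> set (rt p j)}"
          using pass_count_le[OF fJ[of p], of "rt p" \<Delta> \<tau> d] dist unfolding Opt_def pass_def fd fst_conv snd_conv by blast
        also have "\<dots> \<le> card {j. j < M \<and> p \<in> uses (Rs ! j) T (fst d)}"
        proof (intro card_mono subsetI)
          fix j assume j: "j \<in> {j\<in>J p. d \<in> set (rt p j)}"
          then have "(Rs ! j) (psrc p) (pdst p) = Some (rt p j)" "j < M" "fst d \<in> fst ` set (rt p j)"
            using rt(4)[of j p] by (auto simp: J_def)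
          then show "j \<in> {j. j < M \<and> p \<in> uses (Rs ! j) T (fst d)}" using p by (auto simp: uses_def)
        qed simp
        finally have c: "card {x \<in> Opt p. pass p x f} \<le> card {j. j < M \<and> p \<in> uses (Rs ! j) T (fst d)}" .
        have "real M \<le> real (2 * card (J p))" using half[OF p] by (simp only: of_nat_le_iff)
        then have "real M * \<Delta> \<le> real (2 * card (J p)) * \<Delta>" by (rule mult_right_mono) simp
        then have "real M * \<Delta> \<le> 2 * real (card (Opt p))" unfolding Opt_def card_cartesian_product by simp
        moreover have "0 < real M * \<Delta>" "0 < real (card (Opt p))" using M K J0[OF p] by (auto simp: Opt_def card_cartesian_product)
        ultimately have "1 / real (card (Opt p)) \<le> 2 / (M * \<Delta>)" by (simp add: field_simps)
        then have "real (card {x \<in> Opt p. pass p x f}) * (1 / card (Opt p)) \<le> card {j. j < M \<and> p \<in> uses (Rs ! j) T (fst d)} * (2 / (M * \<Delta>))"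
          using c by (intro mult_mono) auto
        then show ?thesis by (simp add: mult.commute)
      qed
      have "(\<Sum>p\<in>T. card {x \<in> Opt p. pass p x f} / card (Opt p)) \<le> (\<Sum>p\<in>T. 2 / (M * \<Delta>) * card {j. j < M \<and> p \<in> uses (Rs ! j) T (fst d)})"
        using one by (intro sum_mono)
      also have "\<dots> = 2 / (M * \<Delta>) * real (\<Sum>p\<in>T. card {j. j < M \<and> p \<in> uses (Rs ! j) T (fst d)})"
        by (simp add: sum_distrib_left)
      also have "\<dots> \<le> 2 / (M * \<Delta>) * real (K * M)"
      proof (intro mult_left_mono of_nat_mono)
        have "(\<Sum>p\<in>T. card {j. j < M \<and> p \<in> uses (Rs ! j) T (fst d)}) = (\<Sum>p\<in>T. \<Sum>j<M. if p \<in> uses (Rs ! j) T (fst d) then 1 else 0)"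
          by (intro sum.cong refl) (simp flip: sum.inter_filter)
        also have "\<dots> = (\<Sum>j<M. \<Sum>p\<in>T. if p \<in> uses (Rs ! j) T (fst d) then 1 else 0)" by (rule sum.swap)
        also have "\<dots> = (\<Sum>j<M. card (uses (Rs ! j) T (fst d)))"
        proof (intro sum.cong refl)
          fix j
          have "{p\<in>T. p \<in> uses (Rs ! j) T (fst d)} = uses (Rs ! j) T (fst d)" by (auto simp: uses_def)
          then show "(\<Sum>p\<in>T. if p \<in> uses (Rs ! j) T (fst d) then 1 else 0) = card (uses (Rs ! j) T (fst d))"
            using fT by (simp flip: sum.inter_filter)
        qed
        also have "\<dots> = (\<Sum>R\<leftarrow>Rs. card (uses R T (fst d)))"
          by (simp add: sum_list_sum_nth M_def atLeast0LessThan)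
        also have "\<dots> \<le> K * M" using Rs(4) TU e by (simp add: M_def)
        finally show "(\<Sum>p\<in>T. card {j. j < M \<and> p \<in> uses (Rs ! j) T (fst d)}) \<le> K * M" .
      qed simp
      also have "\<dots> = 1" using M K by (simp add: \<Delta>_def)
      finally show "(\<Sum>p\<in>T. card {x \<in> Opt p. pass p x f} / card (Opt p)) \<le> 1" .
    next
      fix p assume p: "p \<in> T"
      have fO: "finite (Opt p)" using fJ by (simp add: Opt_def)
      have "(\<Sum>f\<in>F. card {x \<in> Opt p. pass p x f}) = (\<Sum>f\<in>F. \<Sum>x\<in>Opt p. if pass p x f then 1 else 0)"
        using fO by (intro sum.cong refl) (simp flip: sum.inter_filter)
      also have "\<dots> = (\<Sum>x\<in>Opt p. \<Sum>f\<in>F. if pass p x f then 1 else 0)" by (rule sum.swap)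
      also have "\<dots> = (\<Sum>x\<in>Opt p. card {f\<in>F. pass p x f})" using fF by (intro sum.cong refl) (simp flip: sum.inter_filter)
      also have "\<dots> \<le> (\<Sum>x\<in>Opt p. n)"
      proof (intro sum_mono)
        fix x assume "x \<in> Opt p"
        then have j: "fst x \<in> J p" by (auto simp: Opt_def)
        have "{f\<in>F. pass p x f} \<subseteq> (\<lambda>i. (snd x + i, rt p (fst x) ! i)) ` {..<length (rt p (fst x))}"
        proof
          fix f assume f: "f \<in> {f\<in>F. pass p x f}"
          then have "f = (snd x + (fst f - snd x), rt p (fst x) ! (fst f - snd x))" "fst f - snd x < length (rt p (fst x))"
            by (auto simp: pass_def prod_eq_iff)
          then show "f \<in> (\<lambda>i. (snd x + i, rt p (fst x) ! i)) ` {..<length (rt p (fst x))}" by blast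
        qed
        then have "card {f\<in>F. pass p x f} \<le> card ((\<lambda>i. (snd x + i, rt p (fst x) ! i)) ` {..<length (rt p (fst x))})"
          by (intro card_mono) auto
        also have "\<dots> \<le> length (rt p (fst x))" using card_image_le[of "{..<length (rt p (fst x))}"] by simp
        also have "\<dots> \<le> n" using simple_walk_length[OF G(1) rt(1)[OF j] _ rt(2)[OF j]] U(2)[of p] p TU by auto
        finally show "card {f\<in>F. pass p x f} \<le> n" .
      qed
      finally have "(\<Sum>f\<in>F. card {x \<in> Opt p. pass p x f}) \<le> card (Opt p) * n" by simp
      then have "real (\<Sum>f\<in>F. card {x \<in> Opt p. pass p x f}) \<le> real (card (Opt p) * n)" by (simp only: of_nat_le_iff)
      then have "(\<Sum>f\<in>F. real (card {x \<in> Opt p. pass p x f})) \<le> card (Opt p) * real n" by simp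
      moreover have "0 < real (card (Opt p))" using J0[OF p] K by (simp add: Opt_def card_cartesian_product)
      ultimately have "(\<Sum>f\<in>F. real (card {x \<in> Opt p. pass p x f})) / card (Opt p) \<le> real n" by (simp add: divide_le_eq mult.commute)
      then show "(\<Sum>f\<in>F. card {x \<in> Opt p. pass p x f} / card (Opt p)) \<le> real n" by (simp add: sum_divide_distrib)
    qed simp
    ultimately show ?thesis unfolding \<Omega>_def by linarith
  qed
  have "\<exists>\<omega>s. length \<omega>s = r \<and> set \<omega>s \<subseteq> \<Omega> \<and> (\<forall>S\<in>fam. 2 * card (fold \<Phi> \<omega>s S) \<le> card S)"
  proof (rule halving_sequence_exists[OF f\<Omega> \<Omega>ne U(1)])
    show "\<Phi> \<omega> T \<subseteq> T" for \<omega> T by (simp add: \<Phi>_def)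
    show "T \<in> fam" if "S \<in> fam" "T \<subseteq> S" for S T
      using that routable_subset[of E h S T] finite_subset[OF _ U(1)] by (auto simp: fam_def)
  qed (use tail r(1) in \<open>auto simp: fam_def\<close>)
  then obtain \<omega>s where \<omega>s: "length \<omega>s = r" "set \<omega>s \<subseteq> \<Omega>" "\<And>S. S \<in> fam \<Longrightarrow> 2 * card (fold \<Phi> \<omega>s S) \<le> card S" by blast
  define ph where "ph = (\<lambda>\<omega>. phase_plan.phase \<Lambda> (ds \<omega>) (\<delta> \<omega>))"
  define blk where "blk = concat (map ph \<omega>s)"
  define \<Psi> where "\<Psi> = fold \<Phi> \<omega>s"
  have \<Psi>sub: "fold \<Phi> xs S \<subseteq> S" for xs S
  proof (induction xs arbitrary: S)
    case (Cons x xs)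
    have "fold \<Phi> xs (\<Phi> x S) \<subseteq> \<Phi> x S" by (rule Cons.IH)
    then show ?case by (auto simp: \<Phi>_def)
  qed simp
  have blk: "fold (sstep E B) blk (start S) = start (\<Psi> S)" if "finite S" for S
    using \<omega>s(2) that unfolding blk_def \<Psi>_def
  proof (induction \<omega>s arbitrary: S)
    case (Cons \<omega> \<omega>s)
    interpret phase_plan E B \<Lambda> "ds \<omega>" "\<delta> \<omega>" using Cons.prems by (intro plan) auto
    have "\<Phi> \<omega> S = remain S" using remain_subset unfolding \<Phi>_def by blast
    then have "fold (sstep E B) (ph \<omega>) (start S) = start (\<Phi> \<omega> S)"
      using phase_start[OF Cons.prems(2)] by (simp add: ph_def)
    moreover have "finite (\<Phi> \<omega> S)" using Cons.prems(2) by (simp add: \<Phi>_def)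
    ultimately show ?case using Cons by simp
  qed simp
  define ws where "ws = concat (replicate r blk)"
  have fin_iter: "finite ((\<Psi> ^^ k) S) \<and> (\<Psi> ^^ k) S \<subseteq> S" if "finite S" for k S
  proof (induction k)
    case (Suc k)
    have "\<Psi> ((\<Psi> ^^ k) S) \<subseteq> (\<Psi> ^^ k) S" unfolding \<Psi>_def by (rule \<Psi>sub)
    then show ?case using Suc finite_subset by auto
  qed (use that in simp)
  have run: "fold (sstep E B) (concat (replicate k blk)) (start S) = start ((\<Psi> ^^ k) S)" if "finite S" for k S
  proof (induction k)
    case (Suc k)
    have "concat (replicate (Suc k) blk) = concat (replicate k blk) @ blk"
      unfolding replicate_Suc replicate_append_same[symmetric] by simp
    then show ?case using Suc blk fin_iter[OF that, of k] by simp
  qed simp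
  have halve: "2 ^ k * card ((\<Psi> ^^ k) S) \<le> card S" if S: "S \<in> fam" for S k
  proof (induction k)
    case (Suc k)
    have fS: "finite S" using S U finite_subset by (auto simp: fam_def)
    have "(\<Psi> ^^ k) S \<in> fam"
      using S fin_iter[OF fS, of k] routable_subset[of E h S "(\<Psi> ^^ k) S"] fS by (auto simp: fam_def)
    then have "2 * card (\<Psi> ((\<Psi> ^^ k) S)) \<le> card ((\<Psi> ^^ k) S)" unfolding \<Psi>_def by (rule \<omega>s(3))
    then have "2 ^ k * (2 * card (\<Psi> ((\<Psi> ^^ k) S))) \<le> 2 ^ k * card ((\<Psi> ^^ k) S)" by (rule mult_le_mono2)
    then have "2 ^ k * (2 * card (\<Psi> ((\<Psi> ^^ k) S))) \<le> card S" using Suc by (rule le_trans)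
    then show ?case by (simp add: mult_ac)
  qed simp
  have "proper_wish E w" if "w \<in> set ws" for w
  proof -
    have "w \<in> set blk" using that by (auto simp: ws_def)
    then obtain \<omega> where \<omega>: "\<omega> \<in> \<Omega>" "w \<in> set (ph \<omega>)" using \<omega>s(2) by (auto simp: blk_def)
    interpret phase_plan E B \<Lambda> "ds \<omega>" "\<delta> \<omega>" by (rule plan[OF \<omega>(1)])
    show ?thesis using \<omega>(2) proper_phase by (simp add: ph_def)
  qed
  moreover have "length ws = r * r * (784 * L * \<rho> * h)"
  proof -
    have "length (ph \<omega>) = 784 * L * \<rho> * h" if "\<omega> \<in> \<Omega>" for \<omega>
    proof -
      interpret phase_plan E B \<Lambda> "ds \<omega>" "\<delta> \<omega>" by (rule plan[OF that])
      have "length (ph \<omega>) = 2 * \<Lambda>" unfolding ph_def phase_def by simp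
      then show ?thesis by (simp add: \<Lambda>_def \<Delta>_def K_def H_def)
    qed
    then have "length blk = r * (784 * L * \<rho> * h)"
      using \<omega>s(1,2) unfolding blk_def
    proof (induction \<omega>s arbitrary: r)
      case (Cons \<omega> \<omega>s)
      then show ?case by (auto simp: algebra_simps)
    qed simp
    then show ?thesis unfolding ws_def by (simp add: length_concat sum_list_replicate)
  qed
  moreover have "\<exists>S'\<subseteq>S. fold (sstep E B) ws (start S) = start S' \<and> (routable E h S \<longrightarrow> S' = {})" if S: "S \<subseteq> U" for S
  proof (intro exI[of _ "(\<Psi> ^^ r) S"] conjI impI)
    have fS: "finite S" using S U finite_subset by blast
    show "(\<Psi> ^^ r) S \<subseteq> S" using fin_iter[OF fS] by blast
    show "fold (sstep E B) ws (start S) = start ((\<Psi> ^^ r) S)" unfolding ws_def by (rule run[OF fS])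
    assume "routable E h S"
    then have "2 ^ r * card ((\<Psi> ^^ r) S) \<le> card S" using S by (intro halve) (simp add: fam_def)
    also have "\<dots> \<le> card U" using S U by (intro card_mono)
    finally have "2 ^ r * card ((\<Psi> ^^ r) S) < 2 ^ r" using r(2) by (rule le_less_trans)
    then have "card ((\<Psi> ^^ r) S) = 0" by simp
    then show "(\<Psi> ^^ r) S = {}" using fin_iter[OF fS, of r] by simp
  qed
  ultimately show ?thesis by blast
qed

text \<open>Epoch lengths double, so those up to \<open>j\<close> sum to less than twice the last.
  Guesses that are too small leave a subset of the packets at their sources, which is still routable
  for \<open>2 ^ j\<close>.\<close>

lemma concat_schedules:
  assumes ep: "\<And>j. (\<forall>w\<in>set (ep j). proper_wish E w) \<and> length (ep j) = Y * 2 ^ j \<and>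
     (\<forall>S\<subseteq>U. \<exists>S'\<subseteq>S. fold (sstep E B) (ep j) (start S) = start S' \<and> (routable E (2 ^ j) S \<longrightarrow> S' = {}))"
    and B: "0 < B" and fin: "finite S" "S \<subseteq> U" and j: "j \<le> J" "routable E (2 ^ j) S"
  shows "delivered_by E (table E B (concat (map ep [0..<Suc J]))) S (B * (Y * (2 ^ Suc j - 1)))"
proof -
  define ws where "ws = concat (map ep [0..<Suc J])"
  have len: "length (concat (map ep [0..<k])) = Y * (2 ^ k - 1)" for k
  proof (induction k)
    case (Suc k)
    have "(2::nat) ^ k \<ge> 1" by simp
    then have "Y * (2 ^ k - 1) + Y * 2 ^ k = Y * (2 ^ Suc k - 1)" by (simp add: algebra_simps mult_2)
    then show ?case using Suc ep[of k] by simp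
  qed simp
  have "[0..<Suc J] = [0..<Suc j] @ [Suc j..<Suc J]"
    using upt_add_eq_append[of 0 "Suc j" "J - j"] j(1) by simp
  then have "ws = concat (map ep [0..<Suc j]) @ concat (map ep [Suc j..<Suc J])" by (simp add: ws_def)
  then have tk: "take (Y * (2 ^ Suc j - 1)) ws = concat (map ep [0..<Suc j])" "Y * (2 ^ Suc j - 1) \<le> length ws"
    using len[of "Suc j"] by auto
  have state: "\<exists>S'\<subseteq>S. fold (sstep E B) (concat (map ep [0..<k])) (start S) = start S'" for k
  proof (induction k)
    case (Suc k)
    then obtain S' where S': "S' \<subseteq> S" "fold (sstep E B) (concat (map ep [0..<k])) (start S) = start S'" by blast
    have "S' \<subseteq> U" using S'(1) fin(2) by blast
    then obtain S'' where "S'' \<subseteq> S'" "fold (sstep E B) (ep k) (start S') = start S''" using ep[of k] by blast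
    then show ?case using S' by (intro exI[of _ S'']) auto
  qed auto
  obtain S' where S': "S' \<subseteq> S" "fold (sstep E B) (concat (map ep [0..<j])) (start S) = start S'" using state by blast
  have "S' \<subseteq> U" "routable E (2 ^ j) S'" using S'(1) fin routable_subset[OF j(2) S'(1)] by auto
  then have "fold (sstep E B) (ep j) (start S') = start {}" using ep[of j] by blast
  then have fin_state: "fold (sstep E B) (concat (map ep [0..<Suc j])) (start S) = start {}" using S'(2) by simp
  have proper: "proper_wish E w" if "w \<in> set ws" for w using that ep by (auto simp: ws_def)
  have "run E (table E B ws) S (B * (Y * (2 ^ Suc j - 1))) p = pdst p" if "p \<in> S" for p
  proof -
    have "run E (table E B ws) S (B * (Y * (2 ^ Suc j - 1))) p
        = fold (sstep E B) (take (Y * (2 ^ Suc j - 1)) ws) (start S) p"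
      by (rule supersteps_run[OF fin(1) _ B that tk(2)]) (rule proper)
    also have "\<dots> = start {} p" unfolding tk(1) fin_state ..
    finally show ?thesis by (simp add: start_def)
  qed
  then show ?thesis by (simp add: delivered_by_def ws_def)
qed

section \<open>The universe of packets and the final constants\<close>

definition packets :: "nat \<Rightarrow> nat \<Rightarrow> pkt set" where
  "packets n a = {..<n} \<times> {..<n} \<times> {..n ^ a}"

lemma packets_iff: "p \<in> packets n a \<longleftrightarrow> psrc p < n \<and> pdst p < n \<and> pid p \<le> n ^ a"
  by (auto simp: packets_def psrc_def pdst_def pid_def mem_Times_iff)

lemma finite_packets: "finite (packets n a)"
  by (simp add: packets_def)

lemma card_packets:
  assumes "n \<le> 2 ^ l"
  shows "2 * card (packets n a) \<le> 2 ^ ((a + 2) * l + 2)"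
proof -
  have na: "n ^ a \<le> 2 ^ (a * l)" using power_mono[OF assms, of a] by (simp add: power_mult[symmetric] mult.commute)
  have "card (packets n a) = n * (n * Suc (n ^ a))" by (simp add: packets_def card_cartesian_product)
  also have "\<dots> \<le> 2 ^ l * (2 ^ l * (2 * 2 ^ (a * l)))"
  proof (intro mult_le_mono assms)
    have "(1::nat) \<le> 2 ^ (a * l)" by simp
    then show "Suc (n ^ a) \<le> 2 * 2 ^ (a * l)" using na by linarith
  qed
  also have "2 * \<dots> = 2 ^ ((a + 2) * l + 2)" by (simp add: power_add algebra_simps)
  finally show ?thesis by simp
qed

text \<open>The number of epochs has to be fixed before the demand is known. Any finite bound will
  do, since epochs after the delivery do not delay it.\<close>

lemma OPT_bounded:
  "\<exists>b. \<forall>ps. set ps \<subseteq> packets n a \<and> distinct ps \<longrightarrow> OPT n E (demand_of ps) \<le> b"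
proof -
  define X where "X = {ps. set ps \<subseteq> packets n a \<and> distinct ps}"
  have "finite X" unfolding X_def
    using finite_subset_distinct[OF finite_packets[of n a]] by simp
  then have "finite ((\<lambda>ps. OPT n E (demand_of ps)) ` X)" by simp
  then have "\<forall>ps\<in>X. OPT n E (demand_of ps) \<le> Max ((\<lambda>ps. OPT n E (demand_of ps)) ` X)" by simp
  then show ?thesis unfolding X_def by blast
qed

lemma ceiling_log_bounds:
  assumes "2 \<le> n"
  defines "l \<equiv> nat \<lceil>log 2 (real n)\<rceil>"
  shows "n \<le> 2 ^ l" "1 \<le> l" "real l \<le> 2 * log 2 (real n)"
proof -
  have lg: "1 \<le> log 2 (real n)" using assms(1) by simp
  then have l: "real l = \<lceil>log 2 (real n)\<rceil>" by (simp add: l_def)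
  have "log 2 (real n) \<le> real l" using l by simp
  then have "real n \<le> 2 powr l" using assms(1) by (simp add: log_le_iff)
  then have "real n \<le> real (2 ^ l)" by (simp add: powr_realpow)
  then show "n \<le> 2 ^ l" by (simp only: of_nat_le_iff)
  show "real l \<le> 2 * log 2 (real n)" using l lg by linarith
  have "1 \<le> real l" using l lg by linarith
  then show "1 \<le> l" by simp
qed

text \<open>Edge lengths presuppose \<open>0 < h\<close> and an edge; moreover optimum 0 leaves no
  time at all. In both cases every packet is already at its destination.\<close>

lemma trivial_demand_delivered:
  assumes "routable E h (set ps)" "h = 0 \<or> E = []"
  shows "delivered_by E A (set ps) 0"
proof -
  obtain Q where Q: "\<forall>p\<in>set ps. walk E (psrc p) (Q p) (pdst p) \<and> distinct (nodes E (psrc p) (Q p)) \<and> length (Q p) \<le> h"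
    using assms(1) unfolding routable_def by blast
  have "psrc p = pdst p" if "p \<in> set ps" for p
    using Q that assms(2) by (cases "Q p") auto
  then show ?thesis by (simp add: delivered_by_def)
qed

theorem theorem1p1:
  "\<forall>a::nat. \<exists>c::nat. \<forall>n E.
     n \<ge> 2 \<and> wf_graph n E \<and> length E \<le> n ^ a \<longrightarrow>
     (\<exists>A. valid_table n E A \<and>
        (\<forall>ps. length ps \<le> n ^ a \<and> distinct (map pid ps) \<and> (\<forall>p \<in> set ps. pid p \<le> n ^ a) \<and>
              (\<forall>p \<in> set ps. psrc p < n \<and> pdst p < n) \<and>
              (\<exists>Ps. (\<forall>q \<in># Ps. is_path n E q) \<and> satisfies E Ps (demand_of ps)) \<longrightarrow>
           (\<exists>T. delivered_by E A (set ps) T \<and>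
                real T \<le> real c * (log 2 (real n)) ^ c * real (OPT n E (demand_of ps)))))"
proof
  fix a :: nat
  obtain C0 :: nat where C0: "128 * exp 128 < (2::real) ^ C0" using real_arch_pow[of 2 "128 * exp 128"] by auto
  \<comment> \<open>The constants of \<open>4 * (B * Y)\<close> after bounding each factor by a
    multiple of \<open>l\<close>; 4 comes from \<open>2 ^ Suc j \<le> 4 * h\<close>. The powers of
    \<open>l\<close> are one from \<open>B\<close>, two from \<open>r * r\<close>, one from
    \<open>L\<close> and two from \<open>\<rho>\<close>, six in all.\<close>
  define C where "C = 4 * (1 + C0) * 784 * (a + 4) ^ 2 * (a + 2) * (144 * (a + 2))"
  \<comment> \<open>64 is the sixth power of the 2 in \<open>l \<le> 2 * log 2 n\<close>; adding 6
    makes \<open>c\<close> serve as the exponent too.\<close>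
  define c where "c = 64 * C + 6"
  show "\<exists>c::nat. \<forall>n E.
     n \<ge> 2 \<and> wf_graph n E \<and> length E \<le> n ^ a \<longrightarrow>
     (\<exists>A. valid_table n E A \<and>
        (\<forall>ps. length ps \<le> n ^ a \<and> distinct (map pid ps) \<and> (\<forall>p \<in> set ps. pid p \<le> n ^ a) \<and>
              (\<forall>p \<in> set ps. psrc p < n \<and> pdst p < n) \<and>
              (\<exists>Ps. (\<forall>q \<in># Ps. is_path n E q) \<and> satisfies E Ps (demand_of ps)) \<longrightarrow>
           (\<exists>T. delivered_by E A (set ps) T \<and>
                real T \<le> real c * (log 2 (real n)) ^ c * real (OPT n E (demand_of ps)))))"
  proof (intro exI[of _ c] allI impI)
    fix n :: nat and E :: "(nat \<times> nat) list"
    assume "n \<ge> 2 \<and> wf_graph n E \<and> length E \<le> n ^ a"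
    then have n: "2 \<le> n" and wf: "wf_graph n E" and m: "length E \<le> n ^ a" by auto
    define l where "l = nat \<lceil>log 2 (real n)\<rceil>"
    note l = ceiling_log_bounds[OF n, folded l_def]
    define L where "L = a * l + 2"
    define \<rho> where "\<rho> = 48 * L * (l + 2)"
    define B where "B = l + C0"
    define r where "r = (a + 2) * l + 2"
    define Y where "Y = r * r * (784 * L * \<rho>)"
    obtain b where b: "\<And>ps. set ps \<subseteq> packets n a \<Longrightarrow> distinct ps \<Longrightarrow> OPT n E (demand_of ps) \<le> b"
      using OPT_bounded[of n a E] by blast
    have Bpos: "0 < B" using l by (simp add: B_def)
    have "\<exists>ep. E \<noteq> [] \<longrightarrow> (\<forall>j. (\<forall>w\<in>set (ep j). proper_wish E w) \<and> length (ep j) = Y * 2 ^ j \<and>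
       (\<forall>S\<subseteq>packets n a. \<exists>S'\<subseteq>S. fold (sstep E B) (ep j) (start S) = start S' \<and> (routable E (2 ^ j) S \<longrightarrow> S' = {})))"
    proof (cases "E = []")
      case False
      have "\<exists>ws. (\<forall>w\<in>set ws. proper_wish E w) \<and> length ws = r * r * (784 * L * \<rho> * 2 ^ j) \<and>
       (\<forall>S\<subseteq>packets n a. \<exists>S'\<subseteq>S. fold (sstep E B) ws (start S) = start S' \<and> (routable E (2 ^ j) S \<longrightarrow> S' = {}))" for j :: nat
        unfolding \<rho>_def
      proof (rule epoch_exists[OF wf False])
        show "n \<le> 2 ^ l" by (rule l(1))
        have "n ^ a \<le> 2 ^ (a * l)" using power_mono[OF l(1), of a] by (simp add: power_mult[symmetric] mult.commute)
        then show "4 * length E \<le> 2 ^ L" using m by (simp add: L_def power_add)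
        have "real n \<le> real (2 ^ l)" using l(1) by (simp only: of_nat_le_iff)
        then have "128 * exp 128 * real n \<le> 2 ^ C0 * 2 ^ l" using C0 by (intro mult_mono) auto
        then show "128 * exp 128 * real n \<le> 2 ^ B" by (simp add: B_def power_add mult.commute)
        show "2 * card (packets n a) \<le> 2 ^ r" unfolding r_def by (rule card_packets[OF l(1)])
        then show "card (packets n a) < 2 ^ r" by (cases "card (packets n a)") auto
      qed (use n in \<open>auto simp: L_def finite_packets packets_iff\<close>)
      then have "\<forall>j. \<exists>ws. (\<forall>w\<in>set ws. proper_wish E w) \<and> length ws = Y * 2 ^ j \<and>
       (\<forall>S\<subseteq>packets n a. \<exists>S'\<subseteq>S. fold (sstep E B) ws (start S) = start S' \<and> (routable E (2 ^ j) S \<longrightarrow> S' = {}))"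
        by (simp add: Y_def mult.assoc)
      from choice[OF this] show ?thesis by blast
    qed simp
    then obtain ep where ep: "E \<noteq> [] \<Longrightarrow> \<forall>j. (\<forall>w\<in>set (ep j). proper_wish E w) \<and> length (ep j) = Y * 2 ^ j \<and>
       (\<forall>S\<subseteq>packets n a. \<exists>S'\<subseteq>S. fold (sstep E B) (ep j) (start S) = start S' \<and> (routable E (2 ^ j) S \<longrightarrow> S' = {}))"
      by blast
    define A where "A = table E B (concat (map ep [0..<Suc b]))"
    show "\<exists>A. valid_table n E A \<and>
        (\<forall>ps. length ps \<le> n ^ a \<and> distinct (map pid ps) \<and> (\<forall>p \<in> set ps. pid p \<le> n ^ a) \<and>
              (\<forall>p \<in> set ps. psrc p < n \<and> pdst p < n) \<and>
              (\<exists>Ps. (\<forall>q \<in># Ps. is_path n E q) \<and> satisfies E Ps (demand_of ps)) \<longrightarrow>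
           (\<exists>T. delivered_by E A (set ps) T \<and>
                real T \<le> real c * (log 2 (real n)) ^ c * real (OPT n E (demand_of ps))))"
    proof (intro exI[of _ A] conjI allI impI)
      show "valid_table n E A" unfolding A_def by (rule valid_table)
      fix ps :: "pkt list"
      assume H: "length ps \<le> n ^ a \<and> distinct (map pid ps) \<and> (\<forall>p \<in> set ps. pid p \<le> n ^ a) \<and>
              (\<forall>p \<in> set ps. psrc p < n \<and> pdst p < n) \<and>
              (\<exists>Ps. (\<forall>q \<in># Ps. is_path n E q) \<and> satisfies E Ps (demand_of ps))"
      then have dist: "distinct ps" by (simp add: distinct_map)
      have sub: "set ps \<subseteq> packets n a" using H packets_iff by blast
      define h where "h = OPT n E (demand_of ps)"
      have rt: "routable E h (set ps)" using H routable_OPT dist unfolding h_def by blast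
      have hb: "h \<le> b" unfolding h_def by (rule b[OF sub dist])
      show "\<exists>T. delivered_by E A (set ps) T \<and>
                real T \<le> real c * (log 2 (real n)) ^ c * real (OPT n E (demand_of ps))"
      proof (cases "h = 0 \<or> E = []")
        case True
        have "0 \<le> log 2 (real n)" using n by simp
        then show ?thesis using trivial_demand_delivered[OF rt True] by (intro exI[of _ 0]) simp
      next
        case False
        define j where "j = (LEAST j. h \<le> 2 ^ j)"
        \<comment> \<open>It yields \<open>j \<le> h \<le> b\<close>, so epoch \<open>j\<close>
          belongs to the table.\<close>
        have "h \<le> 2 ^ h" by (simp add: less_imp_le)
        then have j: "h \<le> 2 ^ j" "j \<le> h" unfolding j_def by (rule LeastI, rule Least_le)
        have j2: "2 ^ j \<le> 2 * h"
        proof (cases j)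
          case (Suc i)
          then have "\<not> h \<le> 2 ^ i" using not_less_Least[of i "\<lambda>j. h \<le> 2 ^ j"] by (simp add: j_def)
          then show ?thesis using Suc by simp
        qed (use False in simp)
        have "delivered_by E A (set ps) (B * (Y * (2 ^ Suc j - 1)))" unfolding A_def
          using ep False j hb Bpos sub routable_mono[OF rt j(1)]
          by (intro concat_schedules[of ep E Y "packets n a"]) auto
        moreover have "real (B * (Y * (2 ^ Suc j - 1))) \<le> real c * (log 2 (real n)) ^ c * real h"
        proof -
          define x where "x = log 2 (real n)"
          have x: "1 \<le> x" using n by (simp add: x_def)
          have l1: "y \<le> y * l" for y :: nat using l(2) by simp
          have "r \<le> (a + 4) * l" using l1[of 2] by (simp add: r_def algebra_simps)
          moreover have Lb: "L \<le> (a + 2) * l" using l1[of 2] by (simp add: L_def algebra_simps)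
          moreover have "\<rho> \<le> 48 * ((a + 2) * l) * (3 * l)" unfolding \<rho>_def
            using l(2) by (intro mult_le_mono Lb) auto
          moreover have "B \<le> (1 + C0) * l" using l1[of C0] by (simp add: B_def algebra_simps)
          ultimately have "4 * (B * Y) \<le> 4 * (((1 + C0) * l) * (((a + 4) * l) * ((a + 4) * l) * (784 * ((a + 2) * l) * (48 * ((a + 2) * l) * (3 * l)))))"
            unfolding Y_def by (intro mult_le_mono order_refl)
          also have "\<dots> = C * l ^ 6"
          proof -
            have "4 * ((u * l) * ((v * l) * (v * l) * (784 * (w * l) * (48 * (w * l) * (3 * l)))))
              = 4 * u * 784 * v ^ 2 * w * (144 * w) * l ^ 6" for u v w :: nat
            proof -
              have "l ^ 6 = l * (l * (l * (l * (l * l))))" by (simp add: numeral_eq_Suc)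
              then show ?thesis by (simp add: power2_eq_square mult_ac)
            qed
            then show ?thesis unfolding C_def by blast
          qed
          finally have BY: "4 * (B * Y) \<le> C * l ^ 6" .
          have "B * (Y * (2 ^ Suc j - 1)) \<le> B * (Y * (2 * 2 ^ j))" by (intro mult_le_mono) auto
          also have "\<dots> \<le> B * (Y * (2 * (2 * h)))" using j2 by (intro mult_le_mono) auto
          also have "\<dots> = 4 * (B * Y) * h" by simp
          also have "\<dots> \<le> C * l ^ 6 * h" using mult_le_mono1[OF BY] .
          finally have "real (B * (Y * (2 ^ Suc j - 1))) \<le> real (C * l ^ 6 * h)" by (simp only: of_nat_le_iff)
          also have "\<dots> = C * real l ^ 6 * h" by simp
          also have "\<dots> \<le> C * (2 * x) ^ 6 * h" using l(3) by (intro mult_right_mono mult_left_mono power_mono) (auto simp: x_def)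
          also have "\<dots> = (64 * C) * x ^ 6 * h" by (simp add: power_mult_distrib)
          also have "\<dots> \<le> c * x ^ c * h"
            using x by (intro mult_right_mono mult_mono power_increasing) (auto simp: c_def)
          finally show ?thesis by (simp add: x_def)
        qed
        ultimately show ?thesis unfolding h_def by blast
      qed
    qed
  qed
qed

end
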